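(* Let $K$ be any field. For the Poisson superalgebra $\mathbf P=\mathrm{Poisson}(V_0,V_1,V_2)$ and the associative algebra $\mathbf A=\mathrm{Alg}(v_0,v_1,v_2)$ one has $$\mathrm{GKdim}\,\mathbf P=\underline{\mathrm{GKdim}}\,\mathbf P=\mathrm{GKdim}\,\mathbf A=\underline{\mathrm{GKdim}}\,\mathbf A=2\log_\lambda2\approx3.3036,$$ where $\lambda\approx1.5214$ is the real root of $t^3-t-2$.
   Context: $\mathbf A$: let $\Lambda$ be the Grassmann algebra over $K$ on odd $x_0,x_1,\dots$, $x_i$ acting by left multiplication, $\partial_i$ the superderivation with $\partial_i(x_j)=\delta_{ij}$, $v_i=\sum_{k\ge0}\big(\prod_{n=0}^{k-1}x_{i+3n}x_{i+3n+1}\big)\partial_{i+3k}$; $\mathbf A$ is the associative subalgebra of $\operatorname{End}\Lambda$ generated by $v_0,v_1,v_2$. $\mathbf P$: let $H_\infty=\Lambda(x_i,y_i\mid i\ge0)$ (odd generators) with Poisson bracket determined by $\{y_i,x_j\}=\delta_{ij}$, $\{x_i,x_j\}=\{y_i,y_j\}=0$ and the super Leibniz rule; let $\widetilde H$ be its completion by formal sums $c\cdot1+\sum\lambda_{\alpha,\beta}x^\alpha y^\beta$ over monomials with $\beta\ne0$ and (largest index in $\alpha$) $<$ (largest index in $\beta$), to which product and bracket extend. $V_i=\sum_{k\ge0}\big(\prod_{n=0}^{k-1}x_{i+3n}x_{i+3n+1}\big)y_{i+3k}$, and $\mathbf P$ is the smallest unital subalgebra of $\widetilde H$ containing $V_0,V_1,V_2$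 closed under product and bracket, and, if $\operatorname{char}K=2$, under the formal square of odd elements (determined by $m^{[2]}=0$ for odd monomials $m$ in $x_i,y_i$ and $(f+g)^{[2]}=f^{[2]}+\{f,g\}+g^{[2]}$). Growth functions count the dimension of the span of all monomials (products, brackets, and in characteristic $2$ formal squares) in the given generators with total number of generator occurrences at most $n$; $\mathrm{GKdim}=\limsup\ln\gamma(n)/\ln n$, $\underline{\mathrm{GKdim}}=\liminf\ln\gamma(n)/\ln n$. *)

theory Defs
  imports Complex_Main "HOL-Library.Function_Algebras" "HOL-Library.Extended_Real"
    "HOL-Library.Liminf_Limsup"
begin

text \<open>Elements of the relevant vector spaces are represented by their coefficient
  functions with values in the field; scaling is pointwise.\<close>

definition fscale :: "'k::field \<Rightarrow> ('a \<Rightarrow> 'k) \<Rightarrow> ('a \<Rightarrow> 'k)" where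
  "fscale c f = (\<lambda>x. c * f x)"

lemma vector_space_fscale: "vector_space (fscale :: 'k::field \<Rightarrow> ('a \<Rightarrow> 'k) \<Rightarrow> _)"
  by unfold_locales (auto simp: fscale_def fun_eq_iff algebra_simps)

definition span_dim :: "('a \<Rightarrow> 'k::field) set \<Rightarrow> nat" where
  "span_dim F = vector_space.dim fscale F"

definition inv_count :: "nat set \<Rightarrow> nat set \<Rightarrow> nat" where
  "inv_count A B = card {(a, b). a \<in> A \<and> b \<in> B \<and> b < a}"

text \<open>An element of \<open>\<Lambda>\<close> is given by its coefficients w.r.t. the monomials
  \<open>x_S = x_{s1} ... x_{sk}\<close> (\<open>s1 < ... < sk\<close>, \<open>S\<close> finite).\<close>
type_synonym 'k grass = "nat set \<Rightarrow> 'k"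

definition gmono :: "nat set \<Rightarrow> 'k::field grass" where
  "gmono S = (\<lambda>R. if R = S then 1 else 0)"

definition gmul :: "'k::field grass \<Rightarrow> 'k grass \<Rightarrow> 'k grass" where
  "gmul a b = (\<lambda>R. if finite R then
      (\<Sum>A\<in>Pow R. (-1) ^ inv_count A (R - A) * a A * b (R - A)) else 0)"

definition gder :: "nat \<Rightarrow> 'k::field grass \<Rightarrow> 'k grass" where
  "gder j a = (\<lambda>R. if j \<notin> R then (-1) ^ card {s\<in>R. s < j} * a (insert j R) else 0)"

text \<open>Index set of \<open>\<Prod>_{n<k} x_{i+3n} x_{i+3n+1}\<close>.\<close>
definition pairset :: "nat \<Rightarrow> nat \<Rightarrow> nat set" where
  "pairset i k = {i + 3 * n | n. n < k} \<union> {i + 3 * n + 1 | n. n < k}"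

text \<open>\<open>v_i(a) = \<Sum>_k (\<Prod>_{n<k} x_{i+3n}x_{i+3n+1}) \<partial>_{i+3k} a\<close> (finitely many nonzero terms).\<close>
definition vop :: "nat \<Rightarrow> 'k::field grass \<Rightarrow> 'k grass" where
  "vop i a = (\<Sum>k | gder (i + 3 * k) a \<noteq> 0. gmul (gmono (pairset i k)) (gder (i + 3 * k) a))"

text \<open>Linear operators on \<open>\<Lambda>\<close> are represented by their matrices:
  \<open>T (S, R)\<close> is the coefficient of \<open>x_R\<close> in \<open>T(x_S)\<close>.\<close>
type_synonym 'k gop = "nat set \<times> nat set \<Rightarrow> 'k"

definition vmat :: "nat \<Rightarrow> 'k::field gop" where
  "vmat i = (\<lambda>(S, R). if finite S then vop i (gmono S) R else 0)"

definition mcomp :: "'k::field gop \<Rightarrow> 'k gop \<Rightarrow> 'k gop" where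
  "mcomp T U = (\<lambda>(S, R). \<Sum>Q | U (S, Q) \<noteq> 0. U (S, Q) * T (Q, R))"

inductive amon :: "nat \<Rightarrow> 'k::field gop \<Rightarrow> bool" where
  agen: "i < 3 \<Longrightarrow> amon 1 (vmat i)"
| amul: "amon a T \<Longrightarrow> amon b U \<Longrightarrow> amon (a + b) (mcomp T U)"

definition agrowth :: "'k::field itself \<Rightarrow> nat \<Rightarrow> nat" where
  "agrowth _ n = span_dim {T :: 'k gop. \<exists>k. 1 \<le> k \<and> k \<le> n \<and> amon k T}"

text \<open>A (formal) element of \<open>H\<close> (or its completion) is given by its coefficients
  w.r.t. the monomials \<open>x^\<alpha> y^\<beta> = x_{a1}...x_{ak} y_{b1}...y_{bl}\<close>
  (increasing indices, \<open>\<alpha>, \<beta>\<close> finite).\<close>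
type_synonym 'k hser = "nat set \<times> nat set \<Rightarrow> 'k"

definition hmono :: "nat set \<times> nat set \<Rightarrow> 'k::field hser" where
  "hmono m = (\<lambda>m'. if m' = m then 1 else 0)"

definition hmul :: "'k::field hser \<Rightarrow> 'k hser \<Rightarrow> 'k hser" where
  "hmul f g = (\<lambda>(\<rho>, \<sigma>). if finite \<rho> \<and> finite \<sigma> then
     (\<Sum>\<alpha>\<in>Pow \<rho>. \<Sum>\<beta>\<in>Pow \<sigma>.
        (-1) ^ (card \<beta> * card (\<rho> - \<alpha>) + inv_count \<alpha> (\<rho> - \<alpha>) + inv_count \<beta> (\<sigma> - \<beta>))
        * f (\<alpha>, \<beta>) * g (\<rho> - \<alpha>, \<sigma> - \<beta>)) else 0)"

text \<open>Right derivatives (acting on the left factor) and left derivatives.\<close>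
definition rdy :: "nat \<Rightarrow> 'k::field hser \<Rightarrow> 'k hser" where
  "rdy i f = (\<lambda>(\<alpha>, \<beta>). if i \<notin> \<beta> then (-1) ^ card {b\<in>\<beta>. i < b} * f (\<alpha>, insert i \<beta>) else 0)"

definition rdx :: "nat \<Rightarrow> 'k::field hser \<Rightarrow> 'k hser" where
  "rdx i f = (\<lambda>(\<alpha>, \<beta>). if i \<notin> \<alpha> then
      (-1) ^ (card {a\<in>\<alpha>. i < a} + card \<beta>) * f (insert i \<alpha>, \<beta>) else 0)"

definition ldx :: "nat \<Rightarrow> 'k::field hser \<Rightarrow> 'k hser" where
  "ldx i g = (\<lambda>(\<gamma>, \<delta>). if i \<notin> \<gamma> then (-1) ^ card {a\<in>\<gamma>. a < i} * g (insert i \<gamma>, \<delta>) else 0)"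

definition ldy :: "nat \<Rightarrow> 'k::field hser \<Rightarrow> 'k hser" where
  "ldy i g = (\<lambda>(\<gamma>, \<delta>). if i \<notin> \<delta> then
      (-1) ^ (card \<gamma> + card {b\<in>\<delta>. b < i}) * g (\<gamma>, insert i \<delta>) else 0)"

text \<open>Poisson bracket \<open>{f,g} = \<Sum>_i (f \<partial>/\<partial>y_i)(\<partial>/\<partial>x_i g) + (f \<partial>/\<partial>x_i)(\<partial>/\<partial>y_i g)\<close>,
  the unique super-Leibniz extension of \<open>{y_i,x_j} = \<delta>_ij\<close>, \<open>{x_i,x_j} = {y_i,y_j} = 0\<close>;
  coefficientwise only finitely many \<open>i\<close> contribute on the completion.\<close>
definition bterm :: "'k::field hser \<Rightarrow> 'k hser \<Rightarrow> nat \<Rightarrow> 'k hser" where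
  "bterm f g i = hmul (rdy i f) (ldx i g) + hmul (rdx i f) (ldy i g)"

definition hbr :: "'k::field hser \<Rightarrow> 'k hser \<Rightarrow> 'k hser" where
  "hbr f g = (\<lambda>m. \<Sum>i | bterm f g i m \<noteq> 0. bterm f g i m)"

definition hodd :: "'k::field hser \<Rightarrow> bool" where
  "hodd f \<longleftrightarrow> (\<forall>\<alpha> \<beta>. f (\<alpha>, \<beta>) \<noteq> 0 \<longrightarrow> odd (card \<alpha> + card \<beta>))"

text \<open>A strict linear order on monomials, used to write
  \<open>f^[2] = \<Sum>_{m < m'} \<lambda>_m \<lambda>_m' {m, m'}\<close> for \<open>f = \<Sum>_m \<lambda>_m m\<close> odd.\<close>
definition scode :: "nat set \<Rightarrow> nat" where
  "scode A = (\<Sum>i\<in>A. 2 ^ i)"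

definition mless :: "nat set \<times> nat set \<Rightarrow> nat set \<times> nat set \<Rightarrow> bool" where
  "mless m m' \<longleftrightarrow> scode (fst m) < scode (fst m')
      \<or> (scode (fst m) = scode (fst m') \<and> scode (snd m) < scode (snd m'))"

definition sqterm :: "'k::field hser \<Rightarrow> (nat set \<times> nat set) \<times> (nat set \<times> nat set)
    \<Rightarrow> nat set \<times> nat set \<Rightarrow> 'k" where
  "sqterm f p m = (if mless (fst p) (snd p) then
      f (fst p) * f (snd p) * hbr (hmono (fst p)) (hmono (snd p)) m else 0)"

definition hsq :: "'k::field hser \<Rightarrow> 'k hser" where
  "hsq f = (\<lambda>m. \<Sum>p | sqterm f p m \<noteq> 0. sqterm f p m)"

definition Vser :: "nat \<Rightarrow> 'k::field hser" where
  "Vser i = (\<lambda>(\<alpha>, \<beta>). if \<exists>k. \<alpha> = pairset i k \<and> \<beta> = {i + 3 * k} then 1 else 0)"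

inductive pmon :: "nat \<Rightarrow> 'k::field hser \<Rightarrow> bool" where
  pgen: "i < 3 \<Longrightarrow> pmon 1 (Vser i)"
| pmul: "pmon a f \<Longrightarrow> pmon b g \<Longrightarrow> pmon (a + b) (hmul f g)"
| pbr: "pmon a f \<Longrightarrow> pmon b g \<Longrightarrow> pmon (a + b) (hbr f g)"
| psq: "CHAR('k) = 2 \<Longrightarrow> pmon a f \<Longrightarrow> hodd f \<Longrightarrow> pmon (2 * a) (hsq f)"

definition pgrowth :: "'k::field itself \<Rightarrow> nat \<Rightarrow> nat" where
  "pgrowth _ n = span_dim {f :: 'k hser. \<exists>k. 1 \<le> k \<and> k \<le> n \<and> pmon k f}"

definition GKdim :: "(nat \<Rightarrow> nat) \<Rightarrow> ereal" where
  "GKdim \<gamma> = limsup (\<lambda>n. ereal (ln (real (\<gamma> n)) / ln (real n)))"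

definition lower_GKdim :: "(nat \<Rightarrow> nat) \<Rightarrow> ereal" where
  "lower_GKdim \<gamma> = liminf (\<lambda>n. ereal (ln (real (\<gamma> n)) / ln (real n)))"

end

theory Submission
  imports Defs "HOL-Library.Product_Lexorder" "HOL-Library.Nat_Bijection"
begin

text \<open>
  Give \<open>V_i\<close> the weight \<open>l^i\<close>, \<open>y_i\<close> the weight \<open>l^i\<close> and \<open>x_i\<close> the weight \<open>-l^i\<close>. Since
  \<open>l^3 = l + 2\<close>, the recursion \<open>V_j = y_j + x_j x_{j+1} V_{j+3}\<close> is homogeneous, and a word of
  positive length in \<open>V_j, V_{j+1}, V_{j+2}\<close> has weight at least \<open>l^j\<close>.

  Upper bound. Let level \<open>j\<close> be the span of the words in \<open>V_j, V_{j+1}, V_{j+2}\<close> and their products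
  with \<open>x_j\<close>. The recursion puts level \<open>j\<close> inside \<open>\<Lambda>(x_j, y_j)\<close> times level \<open>j + 1\<close>, so each step
  multiplies the dimension by at most 4. Weights are bounded below along the way, so after \<open>j\<close> steps
  with \<open>l^j\<close> of the order of \<open>n\<close> only boundedly many words of level \<open>j\<close> can contribute to the
  elements of length \<open>n\<close>. This gives at most \<open>c 4^j\<close> dimensions.

  Lower bound. From \<open>{V_m, V_{m+1}} = -x_m V_{m+3}\<close> and \<open>{V_m, x_m g} = g\<close> for \<open>g\<close> without \<open>x_m, y_m\<close>,
  the element \<open>V_m\<close> needs at most \<open>l^m\<close> letters, and \<open>x^\<alpha> V_{2r+4}\<close> needs no more letters than
  \<open>V_{2r+4}\<close> for every set \<open>\<alpha>\<close> from a fixed set of \<open>2r\<close> indices. Multiplying by subsets of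
  \<open>V_0, \<dots>, V_{2r+3}\<close> gives \<open>16^r\<close> elements of length \<open>O(l^{2r})\<close> whose lowest-degree terms
  \<open>x^\<alpha> y^\<beta> y_{2r+4}\<close> are distinct monomials.

  The associative algebra is treated in the same way with \<open>y_i\<close> replaced by \<open>\<partial>_i\<close> and brackets by
  supercommutators.
\<close>

section \<open>Grassmann algebras\<close>

text \<open>Both estimates count 4^j dimensions at lengths of order l^j, and ln 4 / ln l is the
  exponent. From above, one level splits off 1, x_j, y_j, x_j y_j. From below, each index offers a
  choice of y_i and, up to boundary effects, a choice of x_i. The difficulty above is the negative
  weight of x_j: with all x adjoined, a bound on the weight would bound nothing. Hence level j
  carries the single variable x_j, just enough to absorb the second x in x_{j-1} x_j V_{j+2} coming
  from the level before. Each step then relaxes the weight bound by l^j, and since l > 3/2 these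
  amounts sum to at most 2 l^j. The difficulty below is to get the factors x without extra letters.
  It works because x_m V_{m+3} appears before V_{m+3}: the bracket of V_m and V_{m+1} yields it, and
  another V_m is spent on removing x_m. In characteristic 2 the formal square is not additive;
  elements are therefore split by parity and squares of sums are polarised into brackets.\<close>

definition sg :: "'v::linorder set \<Rightarrow> 'v set \<Rightarrow> 'k::field" where
  "sg A B = (\<Prod>a\<in>A. \<Prod>b\<in>B. if b < a then -1 else 1)"

definition mul :: "('v::linorder set \<Rightarrow> 'k::field) \<Rightarrow> ('v set \<Rightarrow> 'k) \<Rightarrow> 'v set \<Rightarrow> 'k" where
  "mul f g R = (if finite R then \<Sum>A\<in>Pow R. sg A (R - A) * f A * g (R - A) else 0)"

definition der :: "'v::linorder \<Rightarrow> ('v set \<Rightarrow> 'k::field) \<Rightarrow> 'v set \<Rightarrow> 'k" where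
  "der z f R = (if finite R \<and> z \<notin> R then sg {z} R * f (insert z R) else 0)"

definition lm :: "'v::linorder \<Rightarrow> ('v set \<Rightarrow> 'k::field) \<Rightarrow> 'v set \<Rightarrow> 'k" where
  "lm z f R = (if finite R \<and> z \<in> R then sg {z} (R - {z}) * f (R - {z}) else 0)"

text \<open>The parity automorphism. It carries the signs in the rules for odd operators below, so
  that these hold for elements of mixed parity.\<close>

definition gi :: "('v set \<Rightarrow> 'k::field) \<Rightarrow> 'v set \<Rightarrow> 'k" where
  "gi f R = (-1) ^ card R * f R"

definition mono_at :: "'v set \<Rightarrow> 'v set \<Rightarrow> 'k::field" where
  "mono_at S R = (if R = S then 1 else 0)"

text \<open>Not finite support: infinitely many monomials are allowed. Only the values at infinite
  sets, which stand for no monomial, must vanish.\<close>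

definition fin_supp :: "('v set \<Rightarrow> 'k::field) \<Rightarrow> bool" where
  "fin_supp f \<longleftrightarrow> (\<forall>R. infinite R \<longrightarrow> f R = 0)"

section \<open>Signs of reordering monomials\<close>

lemma sg_empty [simp]: "sg {} B = 1" "sg A {} = 1"
  by (simp_all add: sg_def)

lemma sg_cases: "sg A B = (1::'k::field) \<or> sg A B = (-1::'k)"
proof -
  have "(\<Prod>b\<in>B. if b < a then -1 else 1) \<in> {1, -1::'k}" for a
    by (induction B rule: infinite_finite_induct) auto
  hence *: "(\<Prod>b\<in>B. if b < a then -1 else 1) = (1::'k) \<or> (\<Prod>b\<in>B. if b < a then -1 else 1) = (-1::'k)" for a
    by blast
  have "(\<Prod>a\<in>A. \<Prod>b\<in>B. if b < a then -1 else 1) \<in> {1, -1::'k}"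
  proof (induction A rule: infinite_finite_induct)
    case (insert x F)
    then show ?case using *[of x] by auto
  qed auto
  thus ?thesis by (simp add: sg_def)
qed

lemma sg_sq [simp]: "sg A B * sg A B = (1::'k::field)" "sg A B * (sg A B * c) = (c::'k)"
  using sg_cases[of A B, where 'k='k] by auto

lemma sg_nonzero [simp]: "sg A B \<noteq> (0::'k::field)"
  using sg_cases[of A B, where 'k='k] by auto

text \<open>Multiplicativity in each argument is the reason for defining the sign as a product in
  the field: parities of cardinalities need not be compared.\<close>

lemma sg_insert_left: "finite A \<Longrightarrow> a \<notin> A \<Longrightarrow> sg (insert a A) B = sg {a} B * sg A B"
  by (simp add: sg_def)

lemma sg_insert_right: "finite B \<Longrightarrow> b \<notin> B \<Longrightarrow> sg A (insert b B) = sg A {b} * sg A B"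
  by (simp add: sg_def prod.distrib)

lemma sg_union_right:
  "finite A \<Longrightarrow> finite B \<Longrightarrow> A \<inter> B = {} \<Longrightarrow> sg {z} (A \<union> B) = sg {z} A * sg {z} B"
  by (simp add: sg_def prod.union_disjoint)

lemma sg_split_right: "finite R \<Longrightarrow> B \<subseteq> R \<Longrightarrow> sg {z} R = sg {z} B * sg {z} (R - B)"
  by (metis Diff_disjoint Diff_partition finite_Diff finite_subset sg_union_right)

lemma sg_singletons: "z \<noteq> w \<Longrightarrow> sg {z} {w} = - sg {w} {z}"
  by (auto simp: sg_def)

lemma sg_swap:
  "finite B \<Longrightarrow> z \<notin> B \<Longrightarrow> sg B {z} = (-1) ^ card B * (sg {z} B :: 'b::field)"
proof (induction B rule: finite_induct)
  case (insert b B)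
  hence "sg {b} {z} = (- sg {z} {b} :: 'b)" by (intro sg_singletons) auto
  then show ?case using insert
    by (simp add: sg_insert_left[of B b] sg_insert_right[of B b "{z}"])
qed simp

lemma set_cases_elem:
  obtains "infinite R" | "finite R" "z \<notin> R" | R' where "R = insert z R'" "z \<notin> R'" "finite R'"
  by (metis finite_insert mk_disjoint_insert)

lemma der_out: "finite R \<Longrightarrow> z \<notin> R \<Longrightarrow> der z f R = sg {z} R * f (insert z R)"
  and der_in [simp]: "der z f (insert z R) = 0"
  and der_inf [simp]: "infinite R \<Longrightarrow> der z f R = 0"
  and lm_out [simp]: "z \<notin> R \<Longrightarrow> lm z f R = 0"
  and lm_in: "finite R \<Longrightarrow> z \<notin> R \<Longrightarrow> lm z f (insert z R) = sg {z} R * f R"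
  and lm_inf [simp]: "infinite R \<Longrightarrow> lm z f R = 0"
  and mul_inf [simp]: "infinite R \<Longrightarrow> mul f g R = 0"
  by (auto simp: der_def lm_def mul_def)

text \<open>In a product the variable \<open>z\<close> comes from exactly one factor. The Leibniz
  rule and the rules for moving \<open>lm z\<close> follow by comparing these two summands.\<close>

lemma mul_insert:
  assumes "finite R" "z \<notin> R"
  shows "mul f g (insert z R) = (\<Sum>B\<in>Pow R.
      sg B {z} * sg B (R - B) * f B * g (insert z (R - B))
    + sg {z} (R - B) * sg B (R - B) * f (insert z B) * g (R - B))"
proof -
  have inj: "inj_on (insert z) (Pow R)" using assms(2) by (auto simp: inj_on_def)
  have disj: "Pow R \<inter> insert z ` Pow R = {}" using assms(2) by auto
  have 1: "(\<Sum>A\<in>Pow R. sg A (insert z R - A) * f A * g (insert z R - A))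
     = (\<Sum>B\<in>Pow R. sg B {z} * sg B (R - B) * f B * g (insert z (R - B)))"
  proof (rule sum.cong[OF refl])
    fix B assume "B \<in> Pow R"
    hence "insert z R - B = insert z (R - B)" using assms(2) by auto
    thus "sg B (insert z R - B) * f B * g (insert z R - B) =
      sg B {z} * sg B (R - B) * f B * g (insert z (R - B))"
      using assms by (simp add: sg_insert_right[of "R - B" z B])
  qed
  have 2: "(\<Sum>A\<in>insert z ` Pow R. sg A (insert z R - A) * f A * g (insert z R - A))
     = (\<Sum>B\<in>Pow R. sg {z} (R - B) * sg B (R - B) * f (insert z B) * g (R - B))"
  proof (subst sum.reindex[OF inj], rule sum.cong[OF refl], simp only: o_def)
    fix B assume B: "B \<in> Pow R"
    hence "insert z R - insert z B = R - B" using assms(2) by auto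
    moreover have "finite B" "z \<notin> B" using B assms finite_subset by auto
    ultimately show "sg (insert z B) (insert z R - insert z B) * f (insert z B)
        * g (insert z R - insert z B) =
      sg {z} (R - B) * sg B (R - B) * f (insert z B) * g (R - B)"
      by (simp add: sg_insert_left[of B z])
  qed
  show ?thesis using assms 1 2
    by (simp add: mul_def Pow_insert sum.union_disjoint disj sum.distrib)
qed

lemma der_mul: "der z (mul f g) = mul (der z f) g + mul (gi f) (der z g)"
proof
  fix R
  consider "infinite R" | "finite R" "z \<notin> R" | R' where "R = insert z R'" "z \<notin> R'" "finite R'"
    by (rule set_cases_elem)
  then show "der z (mul f g) R = (mul (der z f) g + mul (gi f) (der z g)) R"
  proof cases
    case 2
    have "der z (mul f g) R = (\<Sum>B\<in>Pow R. sg B (R - B) * der z f B * g (R - B)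
       + sg B (R - B) * gi f B * der z g (R - B))"
      unfolding der_out[OF 2] mul_insert[OF 2] sum_distrib_left
    proof (rule sum.cong[OF refl])
      fix B assume B: "B \<in> Pow R"
      hence f: "finite B" "z \<notin> B" "finite (R - B)" "z \<notin> R - B" using 2 finite_subset by auto
      have "B \<subseteq> R" using B by auto
      note s = sg_split_right[OF 2(1) this, of z]
      show "sg {z} R * (sg B {z} * sg B (R - B) * f B * g (insert z (R - B))
          + sg {z} (R - B) * sg B (R - B) * f (insert z B) * g (R - B)) =
        sg B (R - B) * der z f B * g (R - B) + sg B (R - B) * gi f B * der z g (R - B)"
        unfolding s der_out[OF f(1,2)] der_out[OF f(3,4)] sg_swap[OF f(1,2)] gi_def
        by (simp add: algebra_simps)
    qed
    thus ?thesis using 2 by (simp add: mul_def sum.distrib)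
  next
    case (3 R')
    \<comment> \<open>\<open>z\<close> lies in \<open>R\<close>, so the left side is zero here. On
      the right \<open>z\<close> survives in one factor while the other one is differentiated, and
      the two ways of doing this cancel.\<close>
    have "mul (der z f) g R + mul (gi f) (der z g) R = (\<Sum>B\<in>Pow R'. 0)"
      unfolding 3(1) mul_insert[OF 3(3,2)] sum.distrib[symmetric]
    proof (rule sum.cong[OF refl])
      fix B assume B: "B \<in> Pow R'"
      hence f: "finite B" "z \<notin> B" "finite (R' - B)" "z \<notin> R' - B" using 3 finite_subset by auto
      show "sg B {z} * sg B (R' - B) * der z f B * g (insert z (R' - B)) +
          sg {z} (R' - B) * sg B (R' - B) * der z f (insert z B) * g (R' - B) +
         (sg B {z} * sg B (R' - B) * gi f B * der z g (insert z (R' - B)) +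
          sg {z} (R' - B) * sg B (R' - B) * gi f (insert z B) * der z g (R' - B)) = 0"
        using f by (simp add: der_out sg_swap gi_def algebra_simps)
    qed
    thus ?thesis using 3 by simp
  qed simp
qed

lemma lm_mul: "lm z (mul f g) = mul (lm z f) g"
proof
  fix R
  consider "infinite R" | "finite R" "z \<notin> R" | R' where "R = insert z R'" "z \<notin> R'" "finite R'"
    by (rule set_cases_elem)
  then show "lm z (mul f g) R = mul (lm z f) g R"
  proof cases
    case 2
    have "mul (lm z f) g R = (\<Sum>B\<in>Pow R. 0)"
      unfolding mul_def using 2 by (auto intro!: sum.neutral lm_out)
    thus ?thesis using 2 by simp
  next
    case (3 R')
    show ?thesis
      unfolding 3(1) mul_insert[OF 3(3,2)] lm_in[OF 3(3,2)] mul_def[of _ _ R'] using 3(3)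
    proof (simp only: if_True sum_distrib_left, intro sum.cong[OF refl])
      fix B assume B: "B \<in> Pow R'"
      hence f: "finite B" "z \<notin> B" "finite (R' - B)" "z \<notin> R' - B" using 3 finite_subset by auto
      have "B \<subseteq> R'" using B by auto
      note s = sg_split_right[OF 3(3) this, of z]
      show "sg {z} R' * (sg B (R' - B) * f B * g (R' - B)) =
        sg B {z} * sg B (R' - B) * lm z f B * g (insert z (R' - B)) +
         sg {z} (R' - B) * sg B (R' - B) * lm z f (insert z B) * g (R' - B)"
        using f by (simp add: s lm_in algebra_simps)
    qed
  qed simp
qed

lemma mul_lm: "mul f (lm z g) = lm z (mul (gi f) g)"
proof
  fix R
  consider "infinite R" | "finite R" "z \<notin> R" | R' where "R = insert z R'" "z \<notin> R'" "finite R'"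
    by (rule set_cases_elem)
  then show "mul f (lm z g) R = lm z (mul (gi f) g) R"
  proof cases
    case 2
    have "mul f (lm z g) R = (\<Sum>B\<in>Pow R. 0)"
      unfolding mul_def using 2 by (auto intro!: sum.neutral)
    thus ?thesis using 2 by simp
  next
    case (3 R')
    show ?thesis
      unfolding 3(1) mul_insert[OF 3(3,2)] lm_in[OF 3(3,2)] mul_def[of _ _ R'] using 3(3)
    proof (simp only: if_True sum_distrib_left, intro sum.cong[OF refl])
      fix B assume B: "B \<in> Pow R'"
      hence f: "finite B" "z \<notin> B" "finite (R' - B)" "z \<notin> R' - B" using 3 finite_subset by auto
      have "B \<subseteq> R'" using B by auto
      note s = sg_split_right[OF 3(3) this, of z]
      show "sg B {z} * sg B (R' - B) * f B * lm z g (insert z (R' - B)) +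
         sg {z} (R' - B) * sg B (R' - B) * f (insert z B) * lm z g (R' - B)
        = sg {z} R' * (sg B (R' - B) * gi f B * g (R' - B))"
        using f by (simp add: s lm_in sg_swap gi_def algebra_simps)
    qed
  qed simp
qed

lemma lm_lm: "z \<noteq> w \<Longrightarrow> lm z (lm w f) = - lm w (lm z f)"
proof
  fix R assume zw: "z \<noteq> w"
  show "lm z (lm w f) R = (- lm w (lm z f)) R"
  proof (cases "finite R \<and> z \<in> R \<and> w \<in> R")
    case True
    define Q where "Q = R - {z} - {w}"
    have R: "R - {z} = insert w Q" "R - {w} = insert z Q" "R - {w} - {z} = Q"
      "R - {z} - {w} = Q"
      "finite Q" "z \<notin> Q" "w \<notin> Q" using True zw by (auto simp: Q_def)
    show ?thesis using True zw R by (simp add: lm_def sg_insert_right[of Q] sg_singletons[of z w])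
  qed (auto simp: lm_def)
qed

lemma lm_same [simp]: "lm z (lm z f) = 0"
  by (auto simp: lm_def fun_eq_iff)

lemma der_der: "der z (der w f) = - der w (der z f)"
proof
  fix R
  show "der z (der w f) R = (- der w (der z f)) R"
  proof (cases "finite R \<and> z \<notin> R \<and> w \<notin> R \<and> z \<noteq> w")
    case True
    hence "z \<noteq> w" by blast
    with True show ?thesis using sg_singletons[of z w, where 'b='b]
      by (auto simp: der_def sg_insert_right[of R] insert_commute[of z w])
  qed (auto simp: der_def)
qed

lemma der_lm_other: "z \<noteq> w \<Longrightarrow> der z (lm w f) = - lm w (der z f)"
proof
  fix R assume zw: "z \<noteq> w"
  show "der z (lm w f) R = (- lm w (der z f)) R"
  proof (cases "finite R \<and> z \<notin> R \<and> w \<in> R")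
    case True
    define Q where "Q = R - {w}"
    have R: "R = insert w Q" "finite Q" "z \<notin> Q" "w \<notin> Q"
      "insert z (insert w Q) - {w} = insert z Q" using True zw by (auto simp: Q_def)
    have "der z (lm w f) R = sg {z} (insert w Q) * (sg {w} (insert z Q) * f (insert z Q))"
      unfolding R(1) using zw R(2-5) by (simp add: der_def lm_def)
    moreover have "lm w (der z f) R = sg {w} Q * (sg {z} Q * f (insert z Q))"
      unfolding R(1) using zw R(2-4) by (simp add: der_def lm_def)
    ultimately show ?thesis using R(2-4) sg_singletons[OF zw, where 'b='b]
      by (simp add: sg_insert_right[of Q])
  qed (use zw in \<open>auto simp: der_def lm_def\<close>)
qed

text \<open>The relation d_z z + z d_z = 1. It needs \<open>fin_supp\<close> because
  \<open>lm z\<close> and \<open>der z\<close> discard the values at infinite sets.\<close>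

lemma der_lm_same: "fin_supp f \<Longrightarrow> der z (lm z f) = f - lm z (der z f)"
proof
  fix R assume f: "fin_supp f"
  consider "infinite R" | "finite R" "z \<notin> R" | R' where "R = insert z R'" "z \<notin> R'" "finite R'"
    by (rule set_cases_elem)
  then show "der z (lm z f) R = (f - lm z (der z f)) R"
    using f by cases (simp_all add: fin_supp_def der_out lm_in)
qed

lemma gi_gi [simp]: "gi (gi f) = f"
  by (auto simp: gi_def fun_eq_iff simp flip: power_add mult.assoc)

lemma gi_lm: "gi (lm z f) = - lm z (gi f)"
proof
  fix R
  consider "infinite R" | "finite R" "z \<notin> R" | R' where "R = insert z R'" "z \<notin> R'" "finite R'"
    by (rule set_cases_elem)
  then show "gi (lm z f) R = (- lm z (gi f)) R"
    by cases (simp_all add: gi_def lm_in)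
qed

lemma gi_der: "gi (der z f) = - der z (gi f)"
proof
  fix R
  consider "infinite R" | "finite R" "z \<notin> R" | R' where "R = insert z R'" "z \<notin> R'" "finite R'"
    by (rule set_cases_elem)
  then show "gi (der z f) R = (- der z (gi f)) R"
    by cases (simp_all add: gi_def der_out)
qed

lemma lin_simps:
  "der z (f + g) = der z f + der z g" "der z (- f) = - der z f" "der z 0 = 0"
  "der z (f - g) = der z f - der z g"
  "lm z (f + g) = lm z f + lm z g" "lm z (- f) = - lm z f" "lm z 0 = 0"
  "lm z (f - g) = lm z f - lm z g"
  "gi (f + g) = gi f + gi g" "gi (- f) = - gi f" "gi 0 = 0" "gi (f - g) = gi f - gi g"
  "der z (fscale c f) = fscale c (der z f)" "lm z (fscale c f) = fscale c (lm z f)"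
  "gi (fscale c f) = fscale c (gi f)"
  by (auto simp: fun_eq_iff der_def lm_def gi_def fscale_def algebra_simps)

lemma mul_simps:
  "mul (f + g) h = mul f h + mul g h" "mul f (g + h) = mul f g + mul f h"
  "mul (- f) h = - mul f h" "mul f (- h) = - mul f h" "mul 0 h = 0" "mul f 0 = 0"
  "mul (f - g) h = mul f h - mul g h" "mul f (g - h) = mul f g - mul f h"
  "mul (fscale c f) h = fscale c (mul f h)" "mul f (fscale c h) = fscale c (mul f h)"
  by (auto simp: fun_eq_iff mul_def fscale_def algebra_simps sum.distrib sum_negf sum_distrib_left
      sum_subtractf)

lemma mul_one: assumes "fin_supp f" shows "mul (mono_at {}) f = f"
proof
  fix R
  show "mul (mono_at {}) f R = f R"
  proof (cases "finite R")
    case True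
    have "mul (mono_at {}) f R = (\<Sum>A\<in>Pow R. if A = {} then f R else 0)"
      unfolding mul_def if_P[OF True] by (rule sum.cong) (auto simp: mono_at_def)
    also have "\<dots> = f R" using True by (simp add: sum.delta)
    finally show ?thesis .
  qed (use assms in \<open>simp add: fin_supp_def\<close>)
qed

lemma mul_one_right: assumes "fin_supp f" shows "mul f (mono_at {}) = f"
proof
  fix R
  show "mul f (mono_at {}) R = f R"
  proof (cases "finite R")
    case True
    have "mul f (mono_at {}) R = (\<Sum>A\<in>Pow R. if A = R then f R else 0)"
      unfolding mul_def if_P[OF True] by (rule sum.cong) (auto simp: mono_at_def)
    also have "\<dots> = f R" using True by (simp add: sum.delta)
    finally show ?thesis .
  qed (use assms in \<open>simp add: fin_supp_def\<close>)
qed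

section \<open>Characteristic 2, where all signs disappear\<close>

lemma minus_one_char2: "CHAR('k::field) = 2 \<Longrightarrow> (-1::'k) = 1"
  by (metis add.inverse_inverse add_eq_0_iff of_nat_CHAR of_nat_numeral one_add_one)

lemma sg_char2: "CHAR('k::field) = 2 \<Longrightarrow> sg A B = (1::'k)"
  using sg_cases[of A B, where 'k='k] minus_one_char2[where 'k='k] by auto

lemma mul_commute_char2:
  fixes f g :: "'v::linorder set \<Rightarrow> 'k::field"
  assumes "CHAR('k) = 2" shows "mul f g = mul g f"
proof
  fix R
  show "mul f g R = mul g f R"
  proof (cases "finite R")
    case True
    have "(\<Sum>A\<in>Pow R. f A * g (R - A)) = (\<Sum>A\<in>Pow R. g A * f (R - A))"
      by (rule sum.reindex_bij_witness[of _ "\<lambda>A. R - A" "\<lambda>A. R - A"])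
        (auto simp: double_diff)
    thus ?thesis using True by (simp add: mul_def sg_char2[OF assms])
  qed simp
qed

lemma gi_char2: "CHAR('k::field) = 2 \<Longrightarrow> gi f = (f :: 'v set \<Rightarrow> 'k)"
  unfolding gi_def fun_eq_iff minus_one_char2 by simp

lemma sum_fun_apply: "(\<Sum>a\<in>A. F a) x = (\<Sum>a\<in>A. (F a :: 'a \<Rightarrow> 'b::comm_monoid_add) x)"
  by (induction A rule: infinite_finite_induct) auto

lemma lin_sum:
  "lm z (\<Sum>a\<in>A. F a) = (\<Sum>a\<in>A. lm z (F a))"
  "der z (\<Sum>a\<in>A. F a) = (\<Sum>a\<in>A. der z (F a))"
  "gi (\<Sum>a\<in>A. F a) = (\<Sum>a\<in>A. gi (F a))"
  by (induction A rule: infinite_finite_induct) (simp_all add: lin_simps)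

section \<open>The Poisson bracket and the formal square\<close>

text \<open>The lexicographic order puts every x before every y. A finite set of variables is thus
  the ordered monomial x^\<alpha> y^\<beta>, and derivatives in x and in y are instances of the one
  operator \<open>der\<close>.\<close>

type_synonym pvar = "bool \<times> nat"

abbreviation vx :: "nat \<Rightarrow> pvar" where "vx i \<equiv> (False, i)"
abbreviation vy :: "nat \<Rightarrow> pvar" where "vy i \<equiv> (True, i)"

definition conj_var :: "pvar \<Rightarrow> pvar" where
  "conj_var v = (\<not> fst v, snd v)"

lemma conj_var_simps [simp]:
  "conj_var (b, i) = (\<not> b, i)" "conj_var (conj_var v) = v" "conj_var v \<noteq> v" "v \<noteq> conj_var v"
  "snd (conj_var v) = snd v"
  by (auto simp: conj_var_def prod_eq_iff)

lemma conj_var_eq_iff: "conj_var v = w \<longleftrightarrow> v = conj_var w"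
  by auto

text \<open>For \<open>N = 0\<close> this is the condition defining the completion, which does not
  contain x_i alone. Since single x_i are adjoined to subalgebras below, x of index less than
  \<open>N\<close> are left unrestricted.\<close>

definition adm :: "nat \<Rightarrow> (pvar set \<Rightarrow> 'k::field) \<Rightarrow> bool" where
  "adm N f \<longleftrightarrow> (\<forall>R. f R \<noteq> 0 \<longrightarrow> finite R \<and> (\<forall>i. vx i \<in> R \<longrightarrow> i < N \<or> (\<exists>k>i. vy k \<in> R)))"

definition Hs :: "(pvar set \<Rightarrow> 'k::field) set" where
  "Hs = {f. \<exists>N. adm N f}"

text \<open>\<open>gi (der v f)\<close> is the right derivative of \<open>f\<close>.\<close>
definition pt :: "(pvar set \<Rightarrow> 'k::field) \<Rightarrow> (pvar set \<Rightarrow> 'k) \<Rightarrow> pvar \<Rightarrow> pvar set \<Rightarrow> 'k" where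
  "pt f g v = mul (gi (der (conj_var v) f)) (der v g)"

text \<open>Each conjugate pair is met twice, as \<open>v\<close> and as \<open>conj_var v\<close>;
  these are the two halves of the bracket. On \<open>Hs\<close> the sum is finite for every
  coefficient.\<close>

definition br :: "(pvar set \<Rightarrow> 'k::field) \<Rightarrow> (pvar set \<Rightarrow> 'k) \<Rightarrow> pvar set \<Rightarrow> 'k" where
  "br f g R = (\<Sum>v | pt f g v R \<noteq> 0. pt f g v R)"

text \<open>One half of the terms of \<open>br f f\<close>. In characteristic 2 the other half
  repeats it, so that \<open>br f f\<close> itself is zero.\<close>

definition sq :: "(pvar set \<Rightarrow> 'k::field) \<Rightarrow> pvar set \<Rightarrow> 'k" where
  "sq f R = (\<Sum>i | pt f f (vx i) R \<noteq> 0. pt f f (vx i) R)"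

text \<open>A finite sum of operations on whole series. Identities are proved for it and carried
  over to \<open>br\<close> one coefficient at a time, with \<open>n\<close> depending on the
  coefficient.\<close>

definition br_upto :: "nat \<Rightarrow> (pvar set \<Rightarrow> 'k::field) \<Rightarrow> (pvar set \<Rightarrow> 'k) \<Rightarrow> pvar set \<Rightarrow> 'k" where
  "br_upto n f g = (\<Sum>v\<in>UNIV \<times> {..<n}. pt f g v)"

definition sq_upto :: "nat \<Rightarrow> (pvar set \<Rightarrow> 'k::field) \<Rightarrow> pvar set \<Rightarrow> 'k" where
  "sq_upto n f = (\<Sum>i<n. pt f f (vx i))"

section \<open>Supports and admissibility\<close>

lemma mul_nonzeroD:
  assumes "mul f g R \<noteq> 0"
  obtains A where "A \<subseteq> R" "finite R" "f A \<noteq> 0" "g (R - A) \<noteq> 0"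
proof -
  have f: "finite R" using assms by (auto simp: mul_def split: if_splits)
  hence "(\<Sum>A\<in>Pow R. sg A (R - A) * f A * g (R - A)) \<noteq> 0" using assms by (simp add: mul_def)
  then obtain A where "A \<in> Pow R" "sg A (R - A) * f A * g (R - A) \<noteq> 0"
    by (rule sum.not_neutral_contains_not_neutral)
  thus ?thesis using that f by auto
qed

lemma der_nonzeroD: "der z f R \<noteq> 0 \<Longrightarrow> finite R \<and> z \<notin> R \<and> f (insert z R) \<noteq> 0"
  by (auto simp: der_def split: if_splits)

lemma lm_nonzeroD: "lm z f R \<noteq> 0 \<Longrightarrow> finite R \<and> z \<in> R \<and> f (R - {z}) \<noteq> 0"
  by (auto simp: lm_def split: if_splits)

lemma gi_zero_iff [simp]: "gi f R = 0 \<longleftrightarrow> f R = 0"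
  by (simp add: gi_def)

lemma pt_nonzeroD:
  assumes "pt f g v R \<noteq> 0"
  obtains A where "A \<subseteq> R" "finite R" "conj_var v \<notin> A" "v \<notin> R - A"
    "f (insert (conj_var v) A) \<noteq> 0" "g (insert v (R - A)) \<noteq> 0"
  using assms unfolding pt_def
  by (elim mul_nonzeroD) (auto dest!: der_nonzeroD)

lemma admD: "adm N f \<Longrightarrow> f R \<noteq> 0 \<Longrightarrow> finite R"
  "adm N f \<Longrightarrow> f R \<noteq> 0 \<Longrightarrow> vx i \<in> R \<Longrightarrow> i < N \<or> (\<exists>k>i. vy k \<in> R)"
  by (auto simp: adm_def)

lemma adm_mono: "adm N f \<Longrightarrow> N \<le> M \<Longrightarrow> adm M f"
  by (fastforce simp: adm_def)

lemma adm_common: assumes "f \<in> Hs" "g \<in> Hs" obtains N where "adm N f" "adm N g"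
proof -
  obtain n m where "adm n f" "adm m g" using assms unfolding Hs_def by blast
  thus ?thesis using that[of "max n m"] by (meson adm_mono max.cobounded1 max.cobounded2)
qed

text \<open>Contracting at index i removes x_i from one of the factors. Admissibility of that factor
  gives i < N or some y_k with k > i, and this y_k survives because only variables of index i are
  removed.\<close>

lemma pt_index:
  assumes "adm N f" "adm N g" "pt f g v R \<noteq> 0"
  shows "snd v < N \<or> (\<exists>k>snd v. vy k \<in> R)"
proof -
  obtain A where A: "A \<subseteq> R" "f (insert (conj_var v) A) \<noteq> 0" "g (insert v (R - A)) \<noteq> 0"
    using assms(3) by (rule pt_nonzeroD)
  obtain b i where v: "v = (b, i)" by force
  show ?thesis
  proof (cases b)
    case True
    have "i < N \<or> (\<exists>k>i. vy k \<in> insert (conj_var v) A)"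
      by (rule admD(2)[OF assms(1) A(2)]) (simp add: v True)
    then show ?thesis using A(1) by (auto simp: v True)
  next
    case False
    have "i < N \<or> (\<exists>k>i. vy k \<in> insert v (R - A))"
      by (rule admD(2)[OF assms(2) A(3)]) (simp add: v False)
    then show ?thesis using A(1) by (auto simp: v False)
  qed
qed

lemma pt_support:
  assumes "adm N f" "adm N g" "N \<le> n" "\<And>v. v \<in> R \<Longrightarrow> snd v < n"
  shows "{v. pt f g v R \<noteq> 0} \<subseteq> UNIV \<times> {..<n}"
proof
  fix v assume "v \<in> {v. pt f g v R \<noteq> 0}"
  hence "snd v < N \<or> (\<exists>k>snd v. vy k \<in> R)" using pt_index[OF assms(1,2)] by blast
  thus "v \<in> UNIV \<times> {..<n}" using assms(3) assms(4) by (cases v) force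
qed

lemma br_eq_upto:
  assumes "adm N f" "adm N g" "N \<le> n" "\<And>v. v \<in> R \<Longrightarrow> snd v < n"
  shows "br f g R = br_upto n f g R"
  unfolding br_def br_upto_def sum_fun_apply
  by (rule sum.mono_neutral_left) (use pt_support[OF assms] in auto)

lemma sq_eq_upto:
  assumes "adm N f" "N \<le> n" "\<And>v. v \<in> R \<Longrightarrow> snd v < n"
  shows "sq f R = sq_upto n f R"
  unfolding sq_def sq_upto_def sum_fun_apply
  by (rule sum.mono_neutral_left) (use pt_support[OF assms(1,1,2,3)] in auto)

lemma bound_exists:
  assumes "finite (R :: pvar set)"
  obtains n where "n \<ge> N" "\<And>v. v \<in> R \<Longrightarrow> snd v < n"
proof -
  obtain m where "\<forall>i\<in>snd ` R. i < m" using assms finite_nat_set_iff_bounded by blast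
  hence "snd v < max N m" if "v \<in> R" for v using that by (auto simp: less_max_iff_disj)
  thus ?thesis using that[of "max N m"] by (meson max.cobounded1)
qed

lemma adm_0 [simp]: "adm N 0" by (simp add: adm_def)

lemma adm_add: "adm N f \<Longrightarrow> adm N g \<Longrightarrow> adm N (f + g)"
  unfolding adm_def by (metis (no_types, lifting) add_0 plus_fun_apply)

lemma adm_scale: "adm N f \<Longrightarrow> adm N (fscale c f)"
  unfolding adm_def fscale_def by auto

lemma adm_gi: "adm N f \<Longrightarrow> adm N (gi f)"
  unfolding adm_def by simp

lemma adm_mul: assumes "adm N f" "adm N g" shows "adm N (mul f g)"
  unfolding adm_def
proof (intro allI impI conjI)
  fix R i assume "mul f g R \<noteq> 0"
  then obtain A where A: "A \<subseteq> R" "finite R" "f A \<noteq> 0" "g (R - A) \<noteq> 0" by (rule mul_nonzeroD)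
  show "finite R" by fact
  assume "vx i \<in> R"
  then consider "vx i \<in> A" | "vx i \<in> R - A" by blast
  then show "i < N \<or> (\<exists>k>i. vy k \<in> R)"
    using admD(2)[OF assms(1) A(3)] admD(2)[OF assms(2) A(4)] A(1) by cases blast+
qed

text \<open>If the only y above x_i is the variable that gets removed, then i is smaller than its
  index \<open>snd z\<close>; hence the new bound.\<close>

lemma adm_der: assumes "adm N f" shows "adm (max N (Suc (snd z))) (der z f)"
  unfolding adm_def
proof (intro allI impI conjI)
  fix R i assume "der z f R \<noteq> 0"
  hence R: "finite R" "f (insert z R) \<noteq> 0" by (auto dest: der_nonzeroD)
  show "finite R" by fact
  assume "vx i \<in> R"
  hence "i < N \<or> (\<exists>k>i. vy k \<in> insert z R)" using admD(2)[OF assms R(2)] by blast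
  thus "i < max N (Suc (snd z)) \<or> (\<exists>k>i. vy k \<in> R)"
    by (cases z) (auto simp: less_max_iff_disj)
qed

lemma adm_lm: assumes "adm N f" shows "adm (max N (Suc (snd z))) (lm z f)"
  unfolding adm_def
proof (intro allI impI conjI)
  fix R i assume "lm z f R \<noteq> 0"
  hence R: "finite R" "f (R - {z}) \<noteq> 0" by (auto dest: lm_nonzeroD)
  show "finite R" by fact
  assume "vx i \<in> R"
  then consider "z = vx i" | "vx i \<in> R - {z}" by blast
  thus "i < max N (Suc (snd z)) \<or> (\<exists>k>i. vy k \<in> R)"
    by cases (use admD(2)[OF assms R(2), of i] in \<open>auto simp: less_max_iff_disj\<close>)
qed

lemma pt_adm:
  assumes "adm N f" "adm N g" "pt f g v R \<noteq> 0" "vx i \<in> R"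
  shows "i < N \<or> (\<exists>k>i. vy k \<in> R)"
proof -
  obtain A where A: "A \<subseteq> R" "conj_var v \<notin> A" "v \<notin> R - A" "f (insert (conj_var v) A) \<noteq> 0"
      "g (insert v (R - A)) \<noteq> 0"
    using assms(3) by (rule pt_nonzeroD)
  have i: "snd v < N \<or> (\<exists>k>snd v. vy k \<in> R)" by (rule pt_index[OF assms(1-3)])
  consider "vx i \<in> insert (conj_var v) A" | "vx i \<in> insert v (R - A)" using assms(4) by blast
  \<comment> \<open>The y_k above x_i may be the contracted variable itself. Then
    \<open>pt_index\<close> shows that k is below \<open>N\<close> or has a larger y above
    it.\<close>
  then have "i < N \<or> (\<exists>k>i. vy k \<in> R \<or> k = snd v)"
    by cases (use admD(2)[OF assms(1) A(4), of i] admD(2)[OF assms(2) A(5), of i] A(1)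
        in \<open>auto simp: conj_var_def\<close>)
  thus ?thesis using i by (metis order_less_trans)
qed

lemma adm_br: assumes "adm N f" "adm N g" shows "adm N (br f g)"
  unfolding adm_def
proof (intro allI impI)
  fix R assume "br f g R \<noteq> 0"
  then obtain v where "pt f g v R \<noteq> 0"
    unfolding br_def by (auto elim: sum.not_neutral_contains_not_neutral)
  thus "finite R \<and> (\<forall>i. vx i \<in> R \<longrightarrow> i < N \<or> (\<exists>k>i. vy k \<in> R))"
    using pt_adm[OF assms] by (auto elim: pt_nonzeroD)
qed

lemma adm_sq: assumes "adm N f" shows "adm N (sq f)"
  unfolding adm_def
proof (intro allI impI)
  fix R assume "sq f R \<noteq> 0"
  then obtain v where "pt f f v R \<noteq> 0"
    unfolding sq_def by (auto elim: sum.not_neutral_contains_not_neutral)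
  thus "finite R \<and> (\<forall>i. vx i \<in> R \<longrightarrow> i < N \<or> (\<exists>k>i. vy k \<in> R))"
    using pt_adm[OF assms assms] by (auto elim: pt_nonzeroD)
qed

lemma Hs_der: "f \<in> Hs \<Longrightarrow> der z f \<in> Hs"
  and Hs_lm: "f \<in> Hs \<Longrightarrow> lm z f \<in> Hs"
  and Hs_gi: "f \<in> Hs \<Longrightarrow> gi f \<in> Hs"
  and Hs_sq: "f \<in> Hs \<Longrightarrow> sq f \<in> Hs"
  and Hs_scale: "f \<in> Hs \<Longrightarrow> fscale c f \<in> Hs"
  and Hs_0: "0 \<in> Hs"
  by (auto simp: Hs_def intro: adm_der adm_lm adm_gi adm_sq adm_scale)

lemma Hs_add: "f \<in> Hs \<Longrightarrow> g \<in> Hs \<Longrightarrow> f + g \<in> Hs"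
  and Hs_mul: "f \<in> Hs \<Longrightarrow> g \<in> Hs \<Longrightarrow> mul f g \<in> Hs"
  and Hs_br: "f \<in> Hs \<Longrightarrow> g \<in> Hs \<Longrightarrow> br f g \<in> Hs"
  by (erule (1) adm_common, simp only: Hs_def mem_Collect_eq, blast intro: adm_add adm_mul adm_br)+

lemmas Hs_intros = Hs_der Hs_lm Hs_gi Hs_sq Hs_scale Hs_0 Hs_add Hs_mul Hs_br

lemma fin_supp_Hs: "f \<in> Hs \<Longrightarrow> fin_supp f"
  by (auto simp: Hs_def fin_supp_def adm_def)

lemma br_inf [simp]: "infinite R \<Longrightarrow> br f g R = 0"
  and sq_inf [simp]: "infinite R \<Longrightarrow> sq f R = 0"
  and gi_inf: "fin_supp f \<Longrightarrow> infinite R \<Longrightarrow> gi f R = 0"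
  by (simp_all add: br_def sq_def pt_def fin_supp_def)

lemma der_lm: "fin_supp g \<Longrightarrow> der v (lm z g) = (if v = z then g else 0) - lm z (der v g)"
  by (simp add: der_lm_same der_lm_other)

lemma gi_der_gi: "gi (der u (gi f)) = - der u f"
  by (simp add: gi_der lin_simps)

section \<open>Leibniz rules for the bracket\<close>

lemma pt_lm_right:
  assumes "fin_supp g"
  shows "pt f (lm z g) v
    = (if v = z then mul (gi (der (conj_var z) f)) g else 0) + lm z (pt (gi f) g v)"
  unfolding pt_def der_lm[OF assms] gi_der_gi
  by (simp add: mul_simps mul_lm lin_simps)

lemma pt_lm_left:
  assumes "fin_supp g"
  shows "pt (lm z g) h v = (if v = conj_var z then mul (gi g) (der (conj_var z) h) else 0) + lm z (pt g h v)"
  unfolding pt_def der_lm[OF assms] conj_var_eq_iff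
  by (simp add: mul_simps lm_mul lin_simps gi_lm)

lemma pt_der: "der u (pt f g v) = pt (der u f) g v + pt (gi f) (der u g) v"
  unfolding pt_def der_mul gi_der_gi gi_gi
  by (simp add: der_der[of u v] mul_simps gi_der der_der[of u "conj_var v"] lin_simps)

lemma pt_lin:
  "pt (f + g) h v = pt f h v + pt g h v" "pt f (g + h) v = pt f g v + pt f h v"
  "pt (fscale c f) h v = fscale c (pt f h v)" "pt f (fscale c h) v = fscale c (pt f h v)"
  "pt 0 h v = 0" "pt f 0 v = 0"
  by (simp_all add: pt_def lin_simps mul_simps)

lemma fscale_sum: "fscale c (\<Sum>a\<in>A. F a) = (\<Sum>a\<in>A. fscale c (F a))"
  by (induction A rule: infinite_finite_induct) (auto simp: fscale_def fun_eq_iff algebra_simps)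

lemma br_upto_laws:
  "fin_supp g \<Longrightarrow> snd z < n \<Longrightarrow>
    br_upto n f (lm z g) = mul (gi (der (conj_var z) f)) g + lm z (br_upto n (gi f) g)"
  "fin_supp g \<Longrightarrow> snd z < n \<Longrightarrow>
    br_upto n (lm z g) h = mul (gi g) (der (conj_var z) h) + lm z (br_upto n g h)"
  "der u (br_upto n f g) = br_upto n (der u f) g + br_upto n (gi f) (der u g)"
  "br_upto n (f + g) h = br_upto n f h + br_upto n g h"
  "br_upto n f (g + h) = br_upto n f g + br_upto n f h"
  "br_upto n (fscale c f) h = fscale c (br_upto n f h)"
  "br_upto n f (fscale c h) = fscale c (br_upto n f h)"
proof -
  have fin: "finite (UNIV \<times> {..<n} :: pvar set)" by simp
  have mem: "z \<in> UNIV \<times> {..<n}" "conj_var z \<in> UNIV \<times> {..<n}" if "snd z < n" for z :: pvar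
    using that by (cases z; simp)+
  show "br_upto n f (lm z g) = mul (gi (der (conj_var z) f)) g + lm z (br_upto n (gi f) g)"
    if "fin_supp g" "snd z < n" using that mem(1)[of z]
    by (simp add: br_upto_def pt_lm_right sum.distrib lin_sum sum.delta'[OF fin] sum.delta[OF fin]
        del: mem_Sigma_iff)
  show "br_upto n (lm z g) h = mul (gi g) (der (conj_var z) h) + lm z (br_upto n g h)"
    if "fin_supp g" "snd z < n" using that mem(2)[of z]
    by (simp add: br_upto_def pt_lm_left sum.distrib lin_sum sum.delta[OF fin] del: mem_Sigma_iff)
qed (simp_all add: br_upto_def pt_der pt_lin sum.distrib lin_sum fscale_sum)

lemma lm_cong: "(finite R \<Longrightarrow> z \<in> R \<Longrightarrow> f (R - {z}) = g (R - {z})) \<Longrightarrow> lm z f R = lm z g R"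
  by (simp add: lm_def)

lemma der_cong: "(finite R \<Longrightarrow> f (insert z R) = g (insert z R)) \<Longrightarrow> der z f R = der z g R"
  by (simp add: der_def)

lemma br_lm_right:
  assumes "f \<in> Hs" "g \<in> Hs"
  shows "br f (lm z g) = mul (gi (der (conj_var z) f)) g + lm z (br (gi f) g)"
proof
  fix R :: "pvar set"
  obtain N where N: "adm N f" "adm N g" using adm_common[OF assms] .
  show "br f (lm z g) R = (mul (gi (der (conj_var z) f)) g + lm z (br (gi f) g)) R"
  proof (cases "finite R")
    case True
    \<comment> \<open>One \<open>n\<close> beyond this coefficient's variables and beyond the bounds
      of all series involved turns every bracket into a truncation.\<close>
    then obtain n where n: "n \<ge> max N (Suc (snd z))" "\<And>v. v \<in> R \<Longrightarrow> snd v < n"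
      by (rule bound_exists) blast
    have 1: "br f (lm z g) R = br_upto n f (lm z g) R"
      by (rule br_eq_upto[OF adm_mono[OF N(1)] adm_lm[OF N(2)] n]) simp
    have 2: "lm z (br (gi f) g) R = lm z (br_upto n (gi f) g) R"
      by (rule lm_cong, rule br_eq_upto[OF adm_gi[OF N(1)] N(2)]) (use n in auto)
    have "snd z < n" using n by simp
    from br_upto_laws(1)[OF fin_supp_Hs[OF assms(2)] this] 1 2 show ?thesis by simp
  qed simp
qed

lemma br_lm_left:
  assumes "g \<in> Hs" "h \<in> Hs"
  shows "br (lm z g) h = mul (gi g) (der (conj_var z) h) + lm z (br g h)"
proof
  fix R :: "pvar set"
  obtain N where N: "adm N g" "adm N h" using adm_common[OF assms] .
  show "br (lm z g) h R = (mul (gi g) (der (conj_var z) h) + lm z (br g h)) R"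
  proof (cases "finite R")
    case True
    then obtain n where n: "n \<ge> max N (Suc (snd z))" "\<And>v. v \<in> R \<Longrightarrow> snd v < n"
      by (rule bound_exists) blast
    have 1: "br (lm z g) h R = br_upto n (lm z g) h R"
      by (rule br_eq_upto[OF adm_lm[OF N(1)] adm_mono[OF N(2)] n]) simp
    have 2: "lm z (br g h) R = lm z (br_upto n g h) R"
      by (rule lm_cong, rule br_eq_upto[OF N]) (use n in auto)
    have "snd z < n" using n by simp
    from br_upto_laws(2)[OF fin_supp_Hs[OF assms(1)] this] 1 2 show ?thesis by simp
  qed simp
qed

text \<open>Up to sign \<open>der u\<close> is the bracket with the variable conjugate to
  \<open>u\<close>, so this is an instance of the Jacobi identity.\<close>

lemma der_br:
  assumes "f \<in> Hs" "g \<in> Hs"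
  shows "der u (br f g) = br (der u f) g + br (gi f) (der u g)"
proof
  fix R :: "pvar set"
  obtain N where N: "adm N f" "adm N g" using adm_common[OF assms] .
  show "der u (br f g) R = (br (der u f) g + br (gi f) (der u g)) R"
  proof (cases "finite R")
    case True
    then obtain n where n: "n \<ge> max N (Suc (snd u))" "\<And>v. v \<in> R \<Longrightarrow> snd v < n"
      by (rule bound_exists) blast
    have 1: "br (der u f) g R = br_upto n (der u f) g R"
      by (rule br_eq_upto[OF adm_der[OF N(1)] adm_mono[OF N(2)] n]) simp
    have 2: "br (gi f) (der u g) R = br_upto n (gi f) (der u g) R"
      by (rule br_eq_upto[OF adm_mono[OF adm_gi[OF N(1)]] adm_der[OF N(2)] n]) simp
    have 3: "der u (br f g) R = der u (br_upto n f g) R"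
      by (rule der_cong, rule br_eq_upto[OF N]) (use n in auto)
    from br_upto_laws(3) 1 2 3 show ?thesis by (metis plus_fun_apply)
  qed simp
qed

lemma br_bilinear:
  assumes "f \<in> Hs" "g \<in> Hs" "h \<in> Hs"
  shows "br (f + g) h = br f h + br g h" "br h (f + g) = br h f + br h g"
    "br (fscale c f) h = fscale c (br f h)" "br h (fscale c f) = fscale c (br h f)"
proof -
  obtain N1 where N1: "adm N1 f" "adm N1 g" using adm_common[OF assms(1,2)] .
  obtain N2 where "adm N2 h" using assms(3) unfolding Hs_def by blast
  with N1 obtain N where N: "adm N f" "adm N g" "adm N h"
    by (meson adm_mono max.cobounded1 max.cobounded2)
  have *: "br (f + g) h R = (br f h + br g h) R \<and> br h (f + g) R = (br h f + br h g) R \<and>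
      br (fscale c f) h R = fscale c (br f h) R \<and> br h (fscale c f) R = fscale c (br h f) R" for R
  proof (cases "finite R")
    case True
    then obtain n where n: "n \<ge> N" "\<And>v. v \<in> R \<Longrightarrow> snd v < n"
      by (rule bound_exists) blast
    note e = br_eq_upto[OF _ _ n] adm_add adm_scale N
    show ?thesis by (simp add: e br_upto_laws) (simp add: e br_upto_laws fscale_def)
  qed (simp add: fscale_def)
  show "br (f + g) h = br f h + br g h" "br h (f + g) = br h f + br h g"
    "br (fscale c f) h = fscale c (br f h)" "br h (fscale c f) = fscale c (br h f)"
    using * by blast+
qed

lemma br_0 [simp]: "br 0 h = 0" "br h 0 = 0"
  by (simp_all add: br_def fun_eq_iff pt_lin)

lemma sq_0 [simp]: "sq 0 = 0"
  by (simp add: sq_def fun_eq_iff pt_lin)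

interpretation fs: vector_space "fscale :: 'k::field \<Rightarrow> ('a \<Rightarrow> 'k) \<Rightarrow> 'a \<Rightarrow> 'k"
  by (rule vector_space_fscale)

section \<open>The formal square in characteristic 2\<close>

lemma uminus_char2: "CHAR('k::field) = 2 \<Longrightarrow> - f = (f :: 'a \<Rightarrow> 'k)"
  unfolding fun_eq_iff uminus_apply by (metis minus_one_char2 mult_minus1 mult_1)

lemma pt_swap_char2:
  "CHAR('k::field) = 2 \<Longrightarrow> pt f g (conj_var v) = pt g (f :: pvar set \<Rightarrow> 'k) v"
  by (simp add: pt_def gi_char2 mul_commute_char2)

lemma br_upto_split: "br_upto n f g = (\<Sum>i<n. pt f g (vx i)) + (\<Sum>i<n. pt f g (vy i))"
proof -
  have e: "UNIV \<times> {..<n} = vx ` {..<n} \<union> vy ` {..<n}" by (auto simp: UNIV_bool)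
  have "sum (pt f g) (vx ` {..<n} \<union> vy ` {..<n}) = sum (pt f g) (vx ` {..<n}) + sum (pt f g) (vy ` {..<n})"
    by (rule sum.union_disjoint) auto
  thus ?thesis unfolding br_upto_def e by (simp add: sum.reindex inj_on_def)
qed

lemma br_upto_char2:
  assumes "CHAR('k::field) = 2"
  shows "br_upto n f g = (\<Sum>i<n. pt f g (vx i)) + (\<Sum>i<n. pt g (f :: pvar set \<Rightarrow> 'k) (vx i))"
  using pt_swap_char2[OF assms, of f g "vx _"] by (simp add: br_upto_split)

text \<open>The cross terms are the contractions at x_i of (f, g) and of (g, f). In characteristic 2
  the latter equal the contractions at y_i of (f, g), so together they make up the whole
  bracket.\<close>

lemma sq_add:
  fixes f g :: "pvar set \<Rightarrow> 'k::field"
  assumes "CHAR('k) = 2" "f \<in> Hs" "g \<in> Hs"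
  shows "sq (f + g) = sq f + sq g + br f g"
proof
  fix R :: "pvar set"
  obtain N where N: "adm N f" "adm N g" using adm_common[OF assms(2,3)] .
  show "sq (f + g) R = (sq f + sq g + br f g) R"
  proof (cases "finite R")
    case True
    then obtain n where n: "n \<ge> N" "\<And>v. v \<in> R \<Longrightarrow> snd v < n" by (rule bound_exists) blast
    have "sq_upto n (f + g) = sq_upto n f + sq_upto n g + br_upto n f g"
      by (simp add: sq_upto_def pt_lin sum.distrib br_upto_char2[OF assms(1)] algebra_simps)
    thus ?thesis using N n by (simp add: sq_eq_upto[OF _ n] br_eq_upto[OF _ _ n] adm_add)
  qed simp
qed

lemma sq_scale: "sq (fscale c f) = fscale (c * c) (sq f)"
proof (cases "c = 0")
  case True
  thus ?thesis by (simp add: sq_def fun_eq_iff pt_lin)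
next
  case False
  have "pt (fscale c f) (fscale c f) v R = c * c * pt f f v R" for v R
    by (simp add: pt_lin) (simp add: fscale_def)
  thus ?thesis using False by (simp add: sq_def fun_eq_iff fscale_def sum_distrib_left)
qed

lemma mul_lm_lm: "mul (lm z a) (lm z b) = 0"
proof -
  have "mul (lm z a) (lm z b) = lm z (mul a (lm z b))" by (rule lm_mul[symmetric])
  thus ?thesis by (simp add: mul_lm)
qed

lemma sq_lm:
  fixes g :: "pvar set \<Rightarrow> 'k::field"
  assumes "CHAR('k) = 2" "g \<in> Hs"
  shows "sq (lm z g) = lm z (mul g (der (conj_var z) g))"
proof
  fix R :: "pvar set"
  obtain N where N: "adm N g" using assms(2) unfolding Hs_def by blast
  show "sq (lm z g) R = lm z (mul g (der (conj_var z) g)) R"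
  proof (cases "finite R")
    case True
    then obtain n where n: "n \<ge> max N (Suc (snd z))" "\<And>v. v \<in> R \<Longrightarrow> snd v < n"
      by (rule bound_exists) blast
    have ml: "mul a (lm w b) = lm w (mul a b)" for a b :: "pvar set \<Rightarrow> 'k" and w
      by (simp add: mul_lm gi_char2[OF assms(1)])
    \<comment> \<open>Unless one of the two derivatives removes \<open>z\<close>, the product
      contains \<open>z\<close> twice and vanishes. Only the index of \<open>z\<close> is
      left.\<close>
    have "pt (lm z g) (lm z g) (vx i)
      = (if i = snd z then lm z (mul g (der (conj_var z) g)) else 0)" for i
      unfolding pt_def gi_char2[OF assms(1)] der_lm[OF fin_supp_Hs[OF assms(2)]]
      by (cases z; cases "fst z") (auto simp: mul_simps ml lm_mul[symmetric] lin_simps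
          uminus_char2[OF assms(1)] mul_commute_char2[OF assms(1), of "der _ g" g])
    hence "sq_upto n (lm z g) = lm z (mul g (der (conj_var z) g))"
      using n(1) by (simp add: sq_upto_def)
    thus ?thesis using sq_eq_upto[OF adm_lm[OF N] n] by simp
  qed simp
qed

text \<open>The two terms produced by the Leibniz rule for \<open>pt f f\<close> are the two halves
  of the bracket of \<open>der u f\<close> with \<open>f\<close>.\<close>

lemma der_sq:
  fixes f :: "pvar set \<Rightarrow> 'k::field"
  assumes "CHAR('k) = 2" "f \<in> Hs"
  shows "der u (sq f) = br (der u f) f"
proof
  fix R :: "pvar set"
  obtain N where N: "adm N f" using assms(2) unfolding Hs_def by blast
  show "der u (sq f) R = br (der u f) f R"
  proof (cases "finite R")
    case True
    then obtain n where n: "n \<ge> max N (Suc (snd u))" "\<And>v. v \<in> R \<Longrightarrow> snd v < n"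
      by (rule bound_exists) blast
    have 1: "der u (sq f) R = der u (sq_upto n f) R"
      by (rule der_cong, rule sq_eq_upto[OF N]) (use n in auto)
    have 2: "br (der u f) f R = br_upto n (der u f) f R"
      by (rule br_eq_upto[OF adm_der[OF N] adm_mono[OF N] n]) simp
    have "der u (sq_upto n f) = br_upto n (der u f) f"
      by (simp add: sq_upto_def lin_sum pt_der gi_char2[OF assms(1)] sum.distrib
          br_upto_char2[OF assms(1)])
    thus ?thesis using 1 2 by simp
  qed simp
qed

section \<open>Filtered Poisson subalgebras\<close>

definition par :: "bool \<Rightarrow> ('v set \<Rightarrow> 'k::field) \<Rightarrow> 'v set \<Rightarrow> 'k" where
  "par b f R = (if even (card R) = b then f R else 0)"

definition hom :: "bool \<Rightarrow> ('v set \<Rightarrow> 'k::field) \<Rightarrow> bool" where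
  "hom b f \<longleftrightarrow> (\<forall>R. f R \<noteq> 0 \<longrightarrow> even (card R) = b)"

lemma par_lin: "par b (f + g) = par b f + par b g" "par b (fscale c f) = fscale c (par b f)"
  "par b 0 = 0"
  by (auto simp: par_def fun_eq_iff fscale_def)

lemma hom_par: "hom b (par b f)"
  by (auto simp: par_def hom_def)

lemma par_hom: "hom b f \<Longrightarrow> par c f = (if b = c then f else 0)"
  by (auto simp: par_def hom_def fun_eq_iff)

lemma gi_par: "gi f = par True f + fscale (-1) (par False f)"
  by (auto simp: par_def fun_eq_iff fscale_def gi_def)

lemma par_lm: "par b (lm z f) = lm z (par (\<not> b) f)"
proof
  fix R
  consider "infinite R" | "finite R" "z \<notin> R" | R' where "R = insert z R'" "z \<notin> R'" "finite R'"
    by (rule set_cases_elem)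
  then show "par b (lm z f) R = lm z (par (\<not> b) f) R"
    by cases (auto simp: par_def lm_in)
qed

lemma adm_par: "adm N f \<Longrightarrow> adm N (par b f)"
  by (simp add: adm_def par_def)

lemma Hs_par: "f \<in> Hs \<Longrightarrow> par b f \<in> Hs"
  by (auto simp: Hs_def intro: adm_par)

lemma hom_mul: assumes "hom b f" "hom c g" shows "hom (b = c) (mul f g)"
  unfolding hom_def
proof (intro allI impI)
  fix R assume "mul f g R \<noteq> 0"
  then obtain A where A: "A \<subseteq> R" "finite R" "f A \<noteq> 0" "g (R - A) \<noteq> 0" by (rule mul_nonzeroD)
  have "card R = card A + card (R - A)"
    using A by (metis Diff_disjoint Diff_partition card_Un_disjoint finite_Diff finite_subset)
  thus "even (card R) = (b = c)" using assms A(3,4) by (auto simp: hom_def)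
qed

lemma hom_pt: assumes "hom b f" "hom c g" "pt f g v R \<noteq> 0" shows "even (card R) = (b = c)"
proof -
  obtain A where A: "A \<subseteq> R" "finite R" "conj_var v \<notin> A" "v \<notin> R - A"
    "f (insert (conj_var v) A) \<noteq> 0" "g (insert v (R - A)) \<noteq> 0"
    using assms(3) by (rule pt_nonzeroD)
  have "card R = card A + card (R - A)" "finite A"
    using A by (metis Diff_disjoint Diff_partition card_Un_disjoint finite_Diff finite_subset)
      (use A finite_subset in blast)
  moreover have "even (card (insert (conj_var v) A)) = b" "even (card (insert v (R - A))) = c"
    using A(5,6) assms(1,2) by (auto simp: hom_def)
  ultimately show ?thesis using A(2-4) by auto
qed

lemma hom_br: assumes "hom b f" "hom c g" shows "hom (b = c) (br f g)"
  unfolding hom_def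
proof (intro allI impI)
  fix R assume "br f g R \<noteq> 0"
  then obtain v where "pt f g v R \<noteq> 0"
    unfolding br_def by (auto elim: sum.not_neutral_contains_not_neutral)
  thus "even (card R) = (b = c)" by (rule hom_pt[OF assms])
qed

lemma hom_sq: assumes "hom b f" shows "hom True (sq f)"
  unfolding hom_def
proof (intro allI impI)
  fix R assume "sq f R \<noteq> 0"
  then obtain v where "pt f f v R \<noteq> 0"
    unfolding sq_def by (auto elim: sum.not_neutral_contains_not_neutral)
  thus "even (card R) = True" using hom_pt[OF assms assms] by simp
qed

text \<open>A filtration by real, possibly negative weights. Closure under \<open>par\<close> is
  included because \<open>sq\<close> is available for odd elements only, whereas elements of
  \<open>C t\<close> may mix parities.\<close>

locale graded_poisson =
  fixes C :: "real \<Rightarrow> (pvar set \<Rightarrow> 'k::field) set"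
  assumes sub: "fs.subspace (C t)"
    and Hs: "f \<in> C t \<Longrightarrow> f \<in> Hs"
    and par: "f \<in> C t \<Longrightarrow> par b f \<in> C t"
    and mul: "f \<in> C s \<Longrightarrow> g \<in> C t \<Longrightarrow> mul f g \<in> C (s + t)"
    and br: "f \<in> C s \<Longrightarrow> g \<in> C t \<Longrightarrow> br f g \<in> C (s + t)"
    and sq: "CHAR('k) = 2 \<Longrightarrow> f \<in> C t \<Longrightarrow> hom False f \<Longrightarrow> sq f \<in> C (2 * t)"
begin

lemma lin:
  "f \<in> C t \<Longrightarrow> g \<in> C t \<Longrightarrow> f + g \<in> C t" "f \<in> C t \<Longrightarrow> fscale c f \<in> C t" "0 \<in> C t"
  "f \<in> C t \<Longrightarrow> - f \<in> C t" "f \<in> C t \<Longrightarrow> g \<in> C t \<Longrightarrow> f - g \<in> C t"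
  by (rule fs.subspace_add[OF sub] fs.subspace_scale[OF sub] fs.subspace_0[OF sub]
      fs.subspace_neg[OF sub] fs.subspace_diff[OF sub]; assumption)+

lemma gi: "f \<in> C t \<Longrightarrow> gi f \<in> C t"
  unfolding gi_par by (intro lin par)

end

definition adjoin :: "pvar \<Rightarrow> real \<Rightarrow> (real \<Rightarrow> (pvar set \<Rightarrow> 'k::field) set)
    \<Rightarrow> real \<Rightarrow> (pvar set \<Rightarrow> 'k) set" where
  "adjoin z w C t = {f + lm z g | f g. f \<in> C t \<and> g \<in> C (t - w)}"

lemma adjoinI: "f \<in> C t \<Longrightarrow> g \<in> C (t - w) \<Longrightarrow> f + lm z g \<in> adjoin z w C t"
  unfolding adjoin_def by blast

text \<open>As z z = 0 and moving \<open>z\<close> past an element costs only \<open>gi\<close>, the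
  one thing that could leave the set is a contraction of \<open>z\<close> with its conjugate.
  Hypothesis \<open>d\<close> controls it; its shift is \<open>+ w\<close> because the conjugate
  variable has weight \<open>- w\<close>.\<close>

lemma (in graded_poisson) adjoin:
  assumes d: "\<And>f t. f \<in> C t \<Longrightarrow> der (conj_var z) f \<in> C (t + w)"
  shows "graded_poisson (adjoin z w C)"
proof
  fix t
  show "fs.subspace (adjoin z w C t)"
    unfolding fs.subspace_def
  proof (intro conjI ballI allI)
    show "0 \<in> adjoin z w C t"
      unfolding adjoin_def by (rule CollectI, rule exI[of _ 0], rule exI[of _ 0])
        (simp add: lin lin_simps)
  next
    fix a b assume "a \<in> adjoin z w C t" "b \<in> adjoin z w C t"
    then obtain f g f' g' where *: "a = f + lm z g" "b = f' + lm z g'" "f \<in> C t" "g \<in> C (t - w)"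
      "f' \<in> C t" "g' \<in> C (t - w)" unfolding adjoin_def by blast
    have "a + b = (f + f') + lm z (g + g')" by (simp add: * lin_simps algebra_simps)
    thus "a + b \<in> adjoin z w C t" using * by (simp only:) (intro adjoinI lin)
  next
    fix c a assume "a \<in> adjoin z w C t"
    then obtain f g where *: "a = f + lm z g" "f \<in> C t" "g \<in> C (t - w)"
      unfolding adjoin_def by blast
    have "fscale c a = fscale c f + lm z (fscale c g)"
      by (simp add: * lin_simps fs.scale_right_distrib)
    thus "fscale c a \<in> adjoin z w C t" using * by (simp only:) (intro adjoinI lin)
  qed
next
  fix a t assume "a \<in> adjoin z w C t"
  then obtain f g where *: "a = f + lm z g" "f \<in> C t" "g \<in> C (t - w)"
    unfolding adjoin_def by blast
  show "a \<in> Hs" unfolding * using * Hs by (intro Hs_intros) blast+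
  show "par b a \<in> adjoin z w C t" for b
  proof -
    have "par b a = par b f + lm z (par (\<not> b) g)" by (simp add: * par_lin par_lm)
    thus ?thesis unfolding adjoin_def using * par by blast
  qed
  assume c2: "CHAR('k) = 2" and h: "hom False a"
  \<comment> \<open>\<open>a\<close> is odd, so only the odd part of \<open>f\<close> and the even
    part of \<open>g\<close> contribute. With these \<open>sq\<close> can be applied to the first
    summand.\<close>
  define f1 where "f1 = par False f"
  define g1 where "g1 = par True g"
  have m: "f1 \<in> C t" "g1 \<in> C (t - w)" "hom False f1" using * par hom_par by (auto simp: f1_def g1_def)
  have "a = par False a" using par_hom[OF h] by simp
  hence a: "a = f1 + lm z g1" by (simp add: * par_lin par_lm f1_def g1_def)
  note H = Hs[OF m(1)] Hs[OF m(2)]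
  have "sq a = sq f1 + lm z (mul g1 (der (conj_var z) g1))
      + (mul (gi (der (conj_var z) f1)) g1 + lm z (br (gi f1) g1))"
    unfolding a sq_add[OF c2 H(1) Hs_lm[OF H(2)]] sq_lm[OF c2 H(2)] br_lm_right[OF H] ..
  also have "\<dots> = (sq f1 + mul (gi (der (conj_var z) f1)) g1)
      + lm z (mul g1 (der (conj_var z) g1) + br (gi f1) g1)" by (simp add: lin_simps algebra_simps)
  finally have e: "sq a = \<dots>" .
  have "sq f1 \<in> C (2 * t)" using sq[OF c2 m(1,3)] .
  moreover have "mul (gi (der (conj_var z) f1)) g1 \<in> C (2 * t)"
    using mul[OF gi[OF d[OF m(1)]] m(2)] by simp
  moreover have "mul g1 (der (conj_var z) g1) \<in> C (2 * t - w)"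
    using mul[OF m(2) d[OF m(2)]] by (simp add: algebra_simps)
  moreover have "br (gi f1) g1 \<in> C (2 * t - w)"
    using br[OF gi[OF m(1)] m(2)] by (simp add: algebra_simps)
  ultimately show "sq a \<in> adjoin z w C (2 * t)"
    unfolding e by (intro adjoinI lin)
next
  fix a b s t assume "a \<in> adjoin z w C s" "b \<in> adjoin z w C t"
  then obtain f g f' g' where *: "a = f + lm z g" "b = f' + lm z g'" "f \<in> C s" "g \<in> C (s - w)"
    "f' \<in> C t" "g' \<in> C (t - w)" unfolding adjoin_def by blast
  note H = *(3-6)[THEN Hs]
  have "mul a b = mul f f' + lm z (mul g f' + mul (gi f) g')"
    unfolding *(1,2) mul_simps(1,2) mul_lm_lm mul_lm[of f] by (simp add: lin_simps lm_mul)
  moreover have "mul f f' \<in> C (s + t)" using mul * by blast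
  moreover have "mul g f' \<in> C (s + t - w)" using mul[OF *(4,5)] by (simp add: algebra_simps)
  moreover have "mul (gi f) g' \<in> C (s + t - w)"
    using mul[OF gi[OF *(3)] *(6)] by (simp add: algebra_simps)
  ultimately show "mul a b \<in> adjoin z w C (s + t)" by (simp only:) (intro adjoinI lin)
  have "br a b = br f f' + br f (lm z g') + (br (lm z g) f' + br (lm z g) (lm z g'))"
    unfolding * using H by (simp add: br_bilinear Hs_lm Hs_add)
  moreover have "br (lm z g) (lm z g') = lm z (mul (gi (der (conj_var z) g)) g' - mul g (der (conj_var z) g'))"
    unfolding br_lm_left[OF H(2) Hs_lm[OF H(4)]] br_lm_right[OF H(2,4)] der_lm[OF fin_supp_Hs[OF H(4)]]
    by (simp add: mul_lm mul_simps lin_simps)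
  moreover have "br f (lm z g') = mul (gi (der (conj_var z) f)) g' + lm z (br (gi f) g')"
    using H by (simp add: br_lm_right)
  moreover have "br (lm z g) f' = mul (gi g) (der (conj_var z) f') + lm z (br g f')"
    using H by (simp add: br_lm_left)
  ultimately have e: "br a b = (br f f' + mul (gi (der (conj_var z) f)) g' + mul (gi g) (der (conj_var z) f'))
     + lm z (br (gi f) g' + br g f' + mul (gi (der (conj_var z) g)) g' - mul g (der (conj_var z) g'))"
    by (simp add: lin_simps algebra_simps)
  have "br f f' \<in> C (s + t)" using br * by blast
  moreover have "mul (gi (der (conj_var z) f)) g' \<in> C (s + t)"
    using mul[OF gi[OF d[OF *(3)]] *(6)] by (simp add: algebra_simps)
  moreover have "mul (gi g) (der (conj_var z) f') \<in> C (s + t)"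
    using mul[OF gi[OF *(4)] d[OF *(5)]] by (simp add: algebra_simps)
  moreover have "br (gi f) g' \<in> C (s + t - w)" using br[OF gi[OF *(3)] *(6)] by (simp add: algebra_simps)
  moreover have "br g f' \<in> C (s + t - w)" using br[OF *(4,5)] by (simp add: algebra_simps)
  moreover have "mul (gi (der (conj_var z) g)) g' \<in> C (s + t - w)"
    using mul[OF gi[OF d[OF *(4)]] *(6)] by (simp add: algebra_simps)
  moreover have "mul g (der (conj_var z) g') \<in> C (s + t - w)"
    using mul[OF *(4) d[OF *(6)]] by (simp add: algebra_simps)
  ultimately show "br a b \<in> adjoin z w C (s + t)"
    unfolding e by (intro adjoinI lin)
qed

section \<open>Weighted words\<close>

declare plus_fun_apply [simp del] zero_fun_apply [simp del] uminus_apply [simp del]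
  minus_apply [simp del]

inductive pword :: "((pvar set \<Rightarrow> 'k::field) \<times> real) set \<Rightarrow> real \<Rightarrow> (pvar set \<Rightarrow> 'k) \<Rightarrow> bool"
  for G where
  gen: "(f, t) \<in> G \<Longrightarrow> pword G t f"
| mul: "pword G s f \<Longrightarrow> pword G t g \<Longrightarrow> pword G (s + t) (mul f g)"
| br: "pword G s f \<Longrightarrow> pword G t g \<Longrightarrow> pword G (s + t) (br f g)"
| sq: "CHAR('k) = 2 \<Longrightarrow> pword G t f \<Longrightarrow> hom False f \<Longrightarrow> pword G (2 * t) (sq f)"

definition pspan :: "((pvar set \<Rightarrow> 'k::field) \<times> real) set \<Rightarrow> real \<Rightarrow> (pvar set \<Rightarrow> 'k) set" where
  "pspan G t = fs.span {f. \<exists>s\<le>t. pword G s f}"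

text \<open>Generators of definite parity make every word homogeneous; this is what makes spans of
  words closed under \<open>par\<close>.\<close>

definition good_gens :: "((pvar set \<Rightarrow> 'k::field) \<times> real) set \<Rightarrow> bool" where
  "good_gens G \<longleftrightarrow> (\<forall>(f, t)\<in>G. f \<in> Hs \<and> (\<exists>b. hom b f))"

lemma pword_hom:
  assumes "good_gens G" "pword G t f" shows "f \<in> Hs" "\<exists>b. hom b f"
proof -
  from assms(2) have "f \<in> Hs \<and> (\<exists>b. hom b f)"
  proof induction
    case (gen f t)
    then show ?case using assms(1) by (auto simp: good_gens_def)
  qed (blast intro: Hs_intros hom_mul hom_br hom_sq)+
  thus "f \<in> Hs" "\<exists>b. hom b f" by auto
qed

lemma pword_pspan: "pword G s f \<Longrightarrow> s \<le> t \<Longrightarrow> f \<in> pspan G t"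
  unfolding pspan_def by (rule fs.span_base) blast

lemma pspan_mono: "s \<le> t \<Longrightarrow> pspan G s \<subseteq> pspan G t"
  unfolding pspan_def by (rule fs.span_mono) (auto intro: order_trans)

lemma pspan_sub: "fs.subspace (pspan G t)"
  unfolding pspan_def by simp

lemmas pspan_lin = fs.subspace_add[OF pspan_sub] fs.subspace_scale[OF pspan_sub]
  fs.subspace_0[OF pspan_sub] fs.subspace_neg[OF pspan_sub] fs.subspace_diff[OF pspan_sub]

lemma pspan_induct [consumes 1, case_names 0 add scale word]:
  assumes "f \<in> pspan G t" "P 0" "\<And>f g. P f \<Longrightarrow> P g \<Longrightarrow> P (f + g)" "\<And>c f. P f \<Longrightarrow> P (fscale c f)"
    "\<And>s f. s \<le> t \<Longrightarrow> pword G s f \<Longrightarrow> P f"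
  shows "P f"
proof (rule fs.span_induct[of f "{f. \<exists>s\<le>t. pword G s f}" P])
  show "fs.subspace (Collect P)" unfolding fs.subspace_def using assms(2-4) by blast
qed (use assms(1,5) in \<open>auto simp: pspan_def\<close>)

lemma graded_poisson_pspan:
  fixes G :: "((pvar set \<Rightarrow> 'k::field) \<times> real) set"
  assumes G: "good_gens G"
  shows "graded_poisson (pspan G)"
proof
  show "fs.subspace (pspan G t)" for t by (rule pspan_sub)
  show H: "f \<in> Hs" if "f \<in> pspan G t" for f t
    using that by (induction rule: pspan_induct) (rule Hs_intros pword_hom[OF G]; assumption)+
  show par: "par b f \<in> pspan G t" if "f \<in> pspan G t" for b f t
    using that
  proof (induction rule: pspan_induct)
    case (word s f)
    with pword_hom(2)[OF G word(2)] show ?case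
      by (auto simp: par_hom pspan_lin intro: pword_pspan)
  qed (auto simp: par_lin pspan_lin)
  show "mul f g \<in> pspan G (s + t)" if "f \<in> pspan G s" "g \<in> pspan G t" for f g s t
    using that(1)
  proof (induction rule: pspan_induct)
    case (word s' f)
    show ?case using that(2)
    proof (induction rule: pspan_induct)
      case (word t' g)
      show ?case by (rule pword_pspan[OF pword.mul[OF \<open>pword G s' f\<close> word(2)]])
          (use word(1) \<open>s' \<le> s\<close> in simp)
    qed (auto simp: mul_simps pspan_lin)
  qed (auto simp: mul_simps pspan_lin)
  show br: "br f g \<in> pspan G (s + t)" if "f \<in> pspan G s" "g \<in> pspan G t" for f g s t
  proof -
    have "f \<in> Hs \<and> br f g \<in> pspan G (s + t)" using that(1)
    proof (induction rule: pspan_induct)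
      case (word s' f)
      have f: "f \<in> Hs" by (rule pword_hom[OF G word(2)])
      have "g \<in> Hs \<and> br f g \<in> pspan G (s + t)" using that(2)
      proof (induction rule: pspan_induct)
        case (word t' g)
        have "br f g \<in> pspan G (s + t)"
          by (rule pword_pspan[OF pword.br[OF \<open>pword G s' f\<close> word(2)]])
            (use word(1) \<open>s' \<le> s\<close> in simp)
        thus ?case using pword_hom[OF G word(2)] by simp
      qed (use f in \<open>auto simp: br_bilinear pspan_lin intro: Hs_intros\<close>)
      thus ?case using f by simp
    qed (use H[OF that(2)] in \<open>auto simp: br_bilinear pspan_lin intro: Hs_intros\<close>)
    thus ?thesis ..
  qed
  show "sq f \<in> pspan G (2 * t)" if c2: "CHAR('k) = 2" and f: "f \<in> pspan G t" "hom False f" for f t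
  proof -
    \<comment> \<open>Since \<open>sq\<close> is not additive, the induction runs over odd parts and
      polarises. Membership of \<open>f\<close> is carried along to place the mixed bracket.\<close>
    from f(1) have "f \<in> pspan G t \<and> sq (par False f) \<in> pspan G (2 * t)"
    proof (induction rule: pspan_induct)
      case (add f g)
      then have m: "par False f \<in> pspan G t" "par False g \<in> pspan G t" using par by auto
      have "br (par False f) (par False g) \<in> pspan G (2 * t)" using br[OF m] by simp
      then show ?case using add H[OF m(1)] H[OF m(2)] by (simp add: par_lin sq_add[OF c2] pspan_lin)
    next
      case (word s f)
      obtain b where b: "hom b f" using pword_hom(2)[OF G word(2)] by blast
      have "sq f \<in> pspan G (2 * t)" if "b = False"
        by (rule pword_pspan[OF pword.sq[OF c2 word(2)]]) (use b that word(1) in auto)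
      then show ?case using word b by (auto simp: par_hom pspan_lin intro: pword_pspan)
    qed (auto simp: par_lin pspan_lin sq_scale)
    thus ?thesis using par_hom[OF f(2), of False] by simp
  qed
qed

lemma (in graded_poisson) pword_mem:
  assumes "pword G t f" "\<And>g s. (g, s) \<in> G \<Longrightarrow> g \<in> C s" shows "f \<in> C t"
  using assms(1) by induction (auto intro: assms(2) mul br sq)

lemma (in graded_poisson) pspan_mem:
  assumes "f \<in> pspan G t" "\<And>g s. (g, s) \<in> G \<Longrightarrow> g \<in> C s" "\<And>s t. s \<le> t \<Longrightarrow> C s \<subseteq> C t"
  shows "f \<in> C t"
  using assms(1)
proof (induction rule: pspan_induct)
  case (word s f)
  then show ?case using pword_mem[OF word(2) assms(2)] assms(3) by blast
qed (rule lin; assumption)+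

section \<open>Derivations on spans of words\<close>

lemma par_der: "par b (der z f) = der z (par (\<not> b) f)"
proof
  fix R
  consider "infinite R" | "finite R" "z \<notin> R" | R' where "R = insert z R'" "z \<notin> R'" "finite R'"
    by (rule set_cases_elem)
  then show "par b (der z f) R = der z (par (\<not> b) f) R"
    by cases (auto simp: par_def der_out)
qed

text \<open>The kernel of a derivation is closed under all operations, with any weight. Hence a
  variable absent from the generators is absent from every word.\<close>

lemma graded_poisson_const: "graded_poisson (\<lambda>t. {f \<in> Hs. der u f = 0})"
proof
  fix f :: "pvar set \<Rightarrow> 'a" and b assume "f \<in> {f \<in> Hs. der u f = 0}"
  thus "par b f \<in> {f \<in> Hs. der u f = 0}"
    using par_der[of "\<not> b" u f] by (auto simp: par_lin intro: Hs_par)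
qed (auto simp: fs.subspace_def lin_simps der_mul mul_simps der_br der_sq intro: Hs_intros)

lemma der_pspan_zero:
  assumes "f \<in> pspan G t" "good_gens G" "\<And>g s. (g, s) \<in> G \<Longrightarrow> der u g = 0"
  shows "der u f = 0"
  using graded_poisson.pspan_mem[OF graded_poisson_const assms(1), of u] assms(2,3)
  by (fastforce simp: good_gens_def)

text \<open>The Leibniz rules for products, brackets and squares propagate the weight loss
  \<open>w\<close> from the generators to all words.\<close>

lemma der_pspan:
  assumes G: "good_gens G" and g: "\<And>g s. (g, s) \<in> G \<Longrightarrow> der u g \<in> pspan G (s - w)"
    and f: "f \<in> pspan G t"
  shows "der u f \<in> pspan G (t - w)"
proof -
  interpret graded_poisson "pspan G" by (rule graded_poisson_pspan[OF G])
  note mul_C = mul and br_C = br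
  have *: "der u f \<in> pspan G (t - w)" if "pword G t f" for t f
    using that
  proof induction
    case (mul s f t g)
    note m = mul.hyps[THEN pword_pspan, OF order_refl]
    have "mul (der u f) g \<in> pspan G (s + t - w)"
      using mul_C[OF mul.IH(1) m(2)] by (simp add: algebra_simps)
    moreover have "mul (gi f) (der u g) \<in> pspan G (s + t - w)"
      using mul_C[OF gi[OF m(1)] mul.IH(2)] by (simp add: algebra_simps)
    ultimately show ?case by (simp add: der_mul lin)
  next
    case (br s f t g)
    note m = br.hyps[THEN pword_pspan, OF order_refl]
    have "br (der u f) g \<in> pspan G (s + t - w)"
      using br_C[OF br.IH(1) m(2)] by (simp add: algebra_simps)
    moreover have "br (gi f) (der u g) \<in> pspan G (s + t - w)"
      using br_C[OF gi[OF m(1)] br.IH(2)] by (simp add: algebra_simps)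
    ultimately show ?case by (simp add: der_br Hs[OF m(1)] Hs[OF m(2)] lin)
  next
    case (sq t f)
    note m = pword_pspan[OF sq(2) order_refl]
    have "br (der u f) f \<in> pspan G (2 * t - w)"
      using br_C[OF sq.IH m] by (simp add: algebra_simps)
    thus ?case by (simp add: der_sq[OF sq(1) Hs[OF m]])
  qed (rule g)
  show ?thesis using f
  proof (induction rule: pspan_induct)
    case (word s f)
    then show ?case using *[OF word(2)] pspan_mono[of "s - w" "t - w" G] by auto
  qed (auto simp: lin_simps lin)
qed

text \<open>Every word weighs at least \<mu>, so a composite word of weight at most (k + 1) \<mu> is
  built from words of weight at most k \<mu>. The bound is uniform in the generators and in \<mu>,
  which lets one constant serve all levels.\<close>

lemma pword_count:
  "\<exists>c. \<forall>(G :: ((pvar set \<Rightarrow> 'k::field) \<times> real) set) \<mu>. finite G \<longrightarrow> card G \<le> 3 \<longrightarrow> 0 < \<mu>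
     \<longrightarrow> (\<forall>(f, s)\<in>G. \<mu> \<le> s)
     \<longrightarrow> finite {f. \<exists>s\<le>real k * \<mu>. pword G s f} \<and> card {f. \<exists>s\<le>real k * \<mu>. pword G s f} \<le> c"
proof (induction k)
  case 0
  have "\<not> pword G s f" if "0 < \<mu>" "\<forall>(f, s)\<in>G. \<mu> \<le> s" "s \<le> 0" for G and \<mu> s :: real and f :: "pvar set \<Rightarrow> 'k"
  proof
    assume "pword G s f"
    hence "s > 0" by induction (use that in force)+
    thus False using that by simp
  qed
  hence e: "{f :: pvar set \<Rightarrow> 'k. \<exists>s\<le>0. pword G s f} = {}" if "0 < \<mu>" "\<forall>(f, s)\<in>G. \<mu> \<le> s"
    for \<mu> and G using that by blast
  show ?case
  proof (intro exI[of _ 0] allI impI)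
    fix G :: "((pvar set \<Rightarrow> 'k) \<times> real) set" and \<mu> :: real
    assume "0 < \<mu>" "\<forall>(f, s)\<in>G. \<mu> \<le> s"
    from e[OF this] show "finite {f. \<exists>s\<le>real 0 * \<mu>. pword G s f} \<and>
        card {f. \<exists>s\<le>real 0 * \<mu>. pword G s f} \<le> 0"
      by (simp only: of_nat_0 mult_zero_left) simp
  qed
next
  case (Suc k)
  then obtain c where c: "\<And>(G :: ((pvar set \<Rightarrow> 'k) \<times> real) set) \<mu>. finite G \<Longrightarrow> card G \<le> 3 \<Longrightarrow> 0 < \<mu>
     \<Longrightarrow> (\<forall>(f, s)\<in>G. \<mu> \<le> s)
     \<Longrightarrow> finite {f. \<exists>s\<le>real k * \<mu>. pword G s f} \<and> card {f. \<exists>s\<le>real k * \<mu>. pword G s f} \<le> c" by blast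
  show ?case
  proof (rule exI[of _ "3 + (c * c + (c * c + c))"], intro allI impI)
    fix G :: "((pvar set \<Rightarrow> 'k) \<times> real) set" and \<mu> :: real
    assume G: "finite G" "card G \<le> 3" "0 < \<mu>" "\<forall>(f, s)\<in>G. \<mu> \<le> s"
    define W where "W = {f. \<exists>s\<le>real k * \<mu>. pword G s f}"
    have W: "finite W" "card W \<le> c" using c[OF G] by (auto simp: W_def)
    have low: "\<mu> \<le> s" if "pword G s f" for s f
      using that by induction (use G(3,4) in force)+
    let ?T = "fst ` G \<union> ((\<lambda>(f, g). mul f g) ` (W \<times> W) \<union> ((\<lambda>(f, g). br f g) ` (W \<times> W) \<union> sq ` W))"
    have WI: "f \<in> W" if "pword G s f" "s + \<mu> \<le> real (Suc k) * \<mu>" for s f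
      using that unfolding W_def by (auto simp: algebra_simps intro!: exI[of _ s])
    have T: "f \<in> ?T" if s: "s \<le> real (Suc k) * \<mu>" and f: "pword G s f" for f s
      using f
    proof cases
      case gen
      hence "f \<in> fst ` G" by (rule image_eqI[of _ _ "(f, s)", rotated]) simp
      then show ?thesis by (rule UnI1)
    next
      case (mul s1 f1 t1 g1)
      have "(f1, g1) \<in> W \<times> W"
        using WI[OF mul(3)] WI[OF mul(4)] low[OF mul(3)] low[OF mul(4)] s mul(1) by auto
      hence "f \<in> (\<lambda>(f, g). mul f g) ` (W \<times> W)"
        by (rule image_eqI[rotated]) (simp add: mul(2))
      then show ?thesis by (intro UnI2 UnI1)
    next
      case (br s1 f1 t1 g1)
      have "(f1, g1) \<in> W \<times> W"
        using WI[OF br(3)] WI[OF br(4)] low[OF br(3)] low[OF br(4)] s br(1) by auto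
      hence "f \<in> (\<lambda>(f, g). br f g) ` (W \<times> W)"
        by (rule image_eqI[rotated]) (simp add: br(2))
      then show ?thesis by (intro UnI2 UnI1)
    next
      case (sq t1 f1)
      have "f1 \<in> W" using WI[OF sq(4)] low[OF sq(4)] s sq(1) by auto
      then show ?thesis unfolding sq(2) by (intro UnI2 imageI)
    qed
    have sub: "{f. \<exists>s\<le>real (Suc k) * \<mu>. pword G s f} \<subseteq> ?T"
      using T by (intro subsetI) (elim CollectE exE conjE)
    have fT: "finite ?T" using W G by simp
    have c1: "card (fst ` G) \<le> 3" using card_image_le[OF G(1), of fst] G(2) by linarith
    have WW: "card (W \<times> W) \<le> c * c" using W by (simp add: card_cartesian_product mult_le_mono)
    have c2: "card ((\<lambda>(f, g). mul f g) ` (W \<times> W)) \<le> c * c"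
      "card ((\<lambda>(f, g). br f g) ` (W \<times> W)) \<le> c * c" "card (sq ` W) \<le> c"
      using card_image_le[of "W \<times> W" "\<lambda>(f, g). mul f g"] card_image_le[of "W \<times> W" "\<lambda>(f, g). br f g"]
       card_image_le[of W sq] W WW by fastforce+
    have "card ?T \<le> 3 + (c * c + (c * c + c))"
      by (intro order_trans[OF card_Un_le] add_mono c1 c2)
    thus "finite {f. \<exists>s\<le>real (Suc k) * \<mu>. pword G s f} \<and>
       card {f. \<exists>s\<le>real (Suc k) * \<mu>. pword G s f} \<le> 3 + (c * c + (c * c + c))"
      using sub fT by (meson card_mono finite_subset order_trans)
  qed
qed

lemma der_one [simp]: "der v (mono_at {}) = 0"
  by (auto simp: der_def mono_at_def fun_eq_iff zero_fun_apply)

lemma br_one [simp]: "br (mono_at {}) f = 0" "br f (mono_at {}) = 0"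
  by (simp_all add: br_def pt_def lin_simps mul_simps fun_eq_iff zero_fun_apply)

text \<open>The unit has weight 0 and so violates the hypotheses of \<open>pword_count\<close>. It
  is harmless: products with 1 change nothing, brackets with 1 vanish, and 1 is even, hence never
  squared.\<close>

lemma pword_unit:
  assumes "pword (insert (mono_at {}, 0) G) t f" "good_gens G"
  shows "f = 0 \<or> (f = mono_at {} \<and> t = 0) \<or> pword G t f"
  using assms(1)
proof induction
  case (mul s f t g)
  have "h \<in> Hs" if "pword G r h" for r h using pword_hom[OF assms(2) that] by simp
  moreover have "fin_supp (mono_at {} :: pvar set \<Rightarrow> 'a)" by (auto simp: fin_supp_def mono_at_def)
  ultimately show ?case using mul.IH
    by (elim disjE) (auto simp: mul_simps mul_one mul_one_right fin_supp_Hs intro: pword.mul)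
next
  case (sq t f)
  have "f \<noteq> mono_at {}" using sq(3) by (auto simp: hom_def mono_at_def dest: spec[of _ "{}"])
  then show ?case using sq by (auto intro: pword.sq)
qed (auto intro: pword.intros)

section \<open>The elements \<open>V_i\<close> and the levels\<close>

definition Vg :: "nat \<Rightarrow> pvar set \<Rightarrow> 'k::field" where
  "Vg i R = (if \<exists>k. R = vx ` pairset i k \<union> {vy (i + 3 * k)} then 1 else 0)"

lemma pairset_0 [simp]: "pairset i 0 = {}"
  by (simp add: pairset_def)

lemma pairset_Suc: "pairset i (Suc k) = {i, Suc i} \<union> pairset (i + 3) k"
proof -
  have e: "(\<exists>n<Suc k. P n) \<longleftrightarrow> P 0 \<or> (\<exists>n<k. P (Suc n))" for P
    by (metis Suc_mono less_Suc_eq_0_disj zero_less_Suc)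
  show ?thesis
    by (rule set_eqI) (simp add: pairset_def conj_commute[of _ "_ < _"] e algebra_simps, blast)
qed

lemma pairset_less: "a \<in> pairset i k \<Longrightarrow> i \<le> a \<and> a < i + 3 * k"
  by (auto simp: pairset_def)

lemma finite_pairset [simp]: "finite (pairset i k)"
  by (simp add: pairset_def)

lemma sg_one: "(\<And>b. b \<in> B \<Longrightarrow> z < b) \<Longrightarrow> sg {z} B = 1"
  unfolding sg_def by (intro prod.neutral ballI) (metis less_asym' singletonD)

text \<open>The term k = 0 is y_i. In the others x_i and x_{i+1} are the two smallest variables, so
  splitting them off produces no sign.\<close>

lemma Vg_rec:
  "(Vg i :: pvar set \<Rightarrow> 'k::field) = lm (vy i) (mono_at {}) + lm (vx i) (lm (vx (Suc i)) (Vg (i + 3)))"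
proof
  fix R :: "pvar set"
  have if_or: "(A \<longleftrightarrow> B \<or> D) \<Longrightarrow> (B \<Longrightarrow> \<not> D)
    \<Longrightarrow> (if A then 1 else 0) = (if B then 1 else 0) + (if D then 1 else (0::'k))" for A B D
    by auto
  have P: "vx a \<notin> vx ` pairset (i + 3) k \<union> {vy (i + 3 + 3 * k)}" if "a < i + 3" for a k
    using that pairset_less[of a "i + 3" k] by auto
  have gt: "vx a < b" if "b \<in> vx ` pairset (i + 3) k \<union> {vy (i + 3 + 3 * k)}" "a < i + 3" for a k b
    using that pairset_less[of _ "i + 3" k] by force
  have 1: "lm (vy i) (mono_at {}) R = (if R = {vy i} then 1 else (0::'k))"
    by (auto simp: lm_def mono_at_def)
  have 2: "lm (vx i) (lm (vx (Suc i)) (Vg (i + 3))) R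
    = (if \<exists>k. R = vx ` pairset i (Suc k) \<union> {vy (i + 3 * Suc k)} then 1 else (0::'k))"
  proof (cases "\<exists>k. R = vx ` pairset i (Suc k) \<union> {vy (i + 3 * Suc k)}")
    case True
    then obtain k where k: "R = vx ` pairset i (Suc k) \<union> {vy (i + 3 * Suc k)}" by blast
    let ?V = "Vg (i + 3) :: pvar set \<Rightarrow> 'k"
    let ?Q = "vx ` pairset (i + 3) k \<union> {vy (i + 3 + 3 * k)}"
    have R: "R = insert (vx i) (insert (vx (Suc i)) ?Q)" unfolding k pairset_Suc by auto
    have n: "vx i \<notin> insert (vx (Suc i)) ?Q" "vx (Suc i) \<notin> ?Q" using P by auto
    have "vx i < b" if "b \<in> insert (vx (Suc i)) ?Q" for b
    proof (cases "b = vx (Suc i)")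
      case False
      hence "b \<in> ?Q" using that by blast
      from gt[OF this] show ?thesis by simp
    qed simp
    moreover have "vx (Suc i) < b" if "b \<in> ?Q" for b using gt[OF that] by simp
    ultimately have s: "sg {vx i} (insert (vx (Suc i)) ?Q) = (1::'k)" "sg {vx (Suc i)} ?Q = (1::'k)"
      by (simp_all only: sg_one)
    have "Vg (i + 3) ?Q = (1::'k)" unfolding Vg_def by auto
    moreover have "lm (vx i) (lm (vx (Suc i)) (?V)) R
        = sg {vx i} (insert (vx (Suc i)) ?Q) * lm (vx (Suc i)) (?V) (insert (vx (Suc i)) ?Q)"
      unfolding R by (rule lm_in[OF _ n(1)]) simp
    moreover have "lm (vx (Suc i)) (?V) (insert (vx (Suc i)) ?Q)
        = sg {vx (Suc i)} ?Q * ?V ?Q" by (rule lm_in[OF _ n(2)]) simp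
    ultimately have "lm (vx i) (lm (vx (Suc i)) (Vg (i + 3))) R = (1::'k)"
      by (simp only: s mult_1)
    thus ?thesis using True by simp
  next
    case False
    have "lm (vx i) (lm (vx (Suc i)) (Vg (i + 3))) R = (0::'k)"
    proof (rule ccontr)
      assume a: "lm (vx i) (lm (vx (Suc i)) (Vg (i + 3))) R \<noteq> (0::'k)"
      hence "vx i \<in> R" "vx (Suc i) \<in> R" and v: "Vg (i + 3) (R - {vx i} - {vx (Suc i)}) \<noteq> (0::'k)"
        by (auto dest!: lm_nonzeroD)
      moreover from v obtain k where "R - {vx i} - {vx (Suc i)} = vx ` pairset (i + 3) k \<union> {vy (i + 3 + 3 * k)}"
        unfolding Vg_def by (auto split: if_splits)
      ultimately have "R = insert (vx i) (insert (vx (Suc i)) (vx ` pairset (i + 3) k \<union> {vy (i + 3 + 3 * k)}))"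
        by blast
      also have "\<dots> = vx ` pairset i (Suc k) \<union> {vy (i + 3 * Suc k)}" unfolding pairset_Suc by auto
      finally show False using False by blast
    qed
    thus ?thesis using False by simp
  qed
  have e: "(\<exists>k. P k) \<longleftrightarrow> P 0 \<or> (\<exists>k. P (Suc k))" for P :: "nat \<Rightarrow> bool"
    by (metis not0_implies_Suc)
  have "(\<exists>k. R = vx ` pairset i k \<union> {vy (i + 3 * k)})
    \<longleftrightarrow> R = {vy i} \<or> (\<exists>k. R = vx ` pairset i (Suc k) \<union> {vy (i + 3 * Suc k)})"
    using e[of "\<lambda>k. R = vx ` pairset i k \<union> {vy (i + 3 * k)}"] by simp
  moreover have "{vy i} \<noteq> vx ` pairset i (Suc k) \<union> {vy (i + 3 * Suc k)}" for k
    unfolding pairset_Suc by blast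
  hence "\<not> (\<exists>k. R = vx ` pairset i (Suc k) \<union> {vy (i + 3 * Suc k)})" if "R = {vy i}"
    unfolding that by blast
  ultimately show "(Vg i :: pvar set \<Rightarrow> 'k) R = (lm (vy i) (mono_at {}) + lm (vx i) (lm (vx (Suc i)) (Vg (i + 3)))) R"
    unfolding plus_fun_apply 1 2 Vg_def[of i] by (rule if_or)
qed

lemma Vg_support: "Vg i R \<noteq> (0::'k::field) \<Longrightarrow> \<exists>k. R = vx ` pairset i k \<union> {vy (i + 3 * k)}"
  by (auto simp: Vg_def split: if_splits)

lemma card_pairset: "even (card (pairset i k))"
proof (induction k arbitrary: i)
  case (Suc k)
  have "i \<notin> pairset (i + 3) k" "Suc i \<notin> pairset (i + 3) k"
    using pairset_less[of _ "i + 3" k] by force+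
  thus ?case using Suc[of "i + 3"] by (simp add: pairset_Suc)
qed simp

lemma hom_Vg: "hom False (Vg i)"
  unfolding hom_def
proof (intro allI impI)
  fix R assume "Vg i R \<noteq> (0::'a)"
  then obtain k where "R = vx ` pairset i k \<union> {vy (i + 3 * k)}" using Vg_support by blast
  moreover have "card (vx ` pairset i k \<union> {vy (i + 3 * k)}) = Suc (card (pairset i k))"
    by (subst Un_commute, simp, subst card_insert_disjoint)
      (auto simp: card_image inj_on_def)
  ultimately show "even (card R) = False" using card_pairset[of i k] by simp
qed

lemma Hs_Vg: "Vg i \<in> Hs"
proof -
  have "adm 0 (Vg i :: pvar set \<Rightarrow> 'a)"
    unfolding adm_def by (auto dest!: Vg_support dest: pairset_less)
  thus ?thesis unfolding Hs_def by blast
qed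

lemma Hs_one: "mono_at {} \<in> Hs"
  by (auto simp: Hs_def adm_def mono_at_def)

lemma hom_one: "hom True (mono_at {})"
  by (auto simp: hom_def mono_at_def)

lemma der_Vg_zero: assumes "j < i" shows "der (b, j) (Vg i :: pvar set \<Rightarrow> 'k::field) = 0"
proof
  fix R
  show "der (b, j) (Vg i :: pvar set \<Rightarrow> 'k) R = 0 R"
  proof (rule ccontr)
    assume "der (b, j) (Vg i :: pvar set \<Rightarrow> 'k) R \<noteq> 0 R"
    hence "Vg i (insert (b, j) R) \<noteq> (0::'k)" using der_nonzeroD[of "(b, j)" "Vg i :: pvar set \<Rightarrow> 'k" R] by (simp add: zero_fun_apply)
    then obtain k where "insert (b, j) R = vx ` pairset i k \<union> {vy (i + 3 * k)}"
      using Vg_support by blast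
    hence "(b, j) \<in> vx ` pairset i k \<union> {vy (i + 3 * k)}" by blast
    thus False using assms pairset_less[of j i k] by auto
  qed
qed

lemma adjoin_base: "f \<in> C t \<Longrightarrow> 0 \<in> C (t - w) \<Longrightarrow> f \<in> adjoin z w C t"
  using adjoinI[of f C t 0 w z] by (simp add: lin_simps)

lemma adjoin_lm: "0 \<in> C t \<Longrightarrow> g \<in> C (t - w) \<Longrightarrow> lm z g \<in> adjoin z w C t"
  using adjoinI[of 0 C t g w z] by simp

lemma adjoinE:
  assumes "f \<in> adjoin z w C t"
  obtains g h where "f = g + lm z h" "g \<in> C t" "h \<in> C (t - w)"
  using assms unfolding adjoin_def by blast

text \<open>Only the first summand of \<open>Vg_rec\<close> contains y_j; in the tail the smallest y
  has index j + 3.\<close>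

lemma der_Vg_self: "der (vy j) (Vg j) = mono_at {}"
proof -
  have f: "fin_supp (mono_at {} :: pvar set \<Rightarrow> 'a)" by (rule fin_supp_Hs[OF Hs_one])
  show ?thesis
    by (subst Vg_rec) (simp add: lin_simps der_lm_same[OF f] der_lm_other der_Vg_zero)
qed

lemma adjoin_mono: "(\<And>s t. s \<le> t \<Longrightarrow> C s \<subseteq> C t) \<Longrightarrow> s \<le> t \<Longrightarrow> adjoin z w C s \<subseteq> adjoin z w C t"
  unfolding adjoin_def by (smt (verit) Collect_mono subset_iff)

section \<open>The root l, weights and levels\<close>

locale cubic_root =
  fixes l :: real assumes cubic: "l ^ 3 - l - 2 = 0"
begin

lemma cube: "l ^ 3 = l + 2" using cubic by simp

text \<open>The bound 3/2 is what \<open>sum_pow\<close> asks for: there 3 * l ^ j \<le> 2 * l * l ^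
  j closes the induction.\<close>

lemma l_gt: "l > 3 / 2"
proof (rule ccontr)
  assume "\<not> l > 3 / 2"
  moreover have "l ^ 2 + 3 / 2 * l + 5 / 4 > 0"
  proof -
    have "l ^ 2 + 3 / 2 * l + 5 / 4 = (l + 3 / 4) ^ 2 + 11 / 16" by (simp add: power2_eq_square algebra_simps)
    thus ?thesis using zero_le_power2[of "l + 3 / 4"] by linarith
  qed
  ultimately have "(l - 3 / 2) * (l ^ 2 + 3 / 2 * l + 5 / 4) \<le> 0" by (simp add: mult_nonpos_nonneg)
  \<comment> \<open>Division of the cubic by l - 3/2; the remainder -1/8 is its value at
    3/2.\<close>
  moreover have "l ^ 3 - l - 2 = (l - 3 / 2) * (l ^ 2 + 3 / 2 * l + 5 / 4) - 1 / 8"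
    by (simp add: power2_eq_square power3_eq_cube field_simps)
  ultimately show False using cubic by linarith
qed

lemma l_pos [simp]: "l > 0" "l \<ge> 0" "l > 1" "l \<noteq> 0" using l_gt by auto

lemma pow_3: "l ^ (j + 3) = l ^ Suc j + 2 * l ^ j"
  using cube by (simp add: power_add algebra_simps)

lemma sum_pow: "(\<Sum>m<j. l ^ m) \<le> 2 * l ^ j"
proof (induction j)
  case (Suc j)
  have "3 * l ^ j \<le> 2 * l * l ^ j" using l_gt by (intro mult_right_mono) auto
  thus ?case using Suc unfolding sum.lessThan_Suc power_Suc by linarith
qed simp

definition gens :: "nat \<Rightarrow> ((pvar set \<Rightarrow> 'k::field) \<times> real) set" where
  "gens j = insert (mono_at {}, 0) ((\<lambda>i. (Vg i, l ^ i)) ` {j, Suc j, j + 2})"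

lemma good_gens: "good_gens (gens j)" "good_gens ((\<lambda>i. (Vg i, l ^ i)) ` A)"
  by (auto simp: good_gens_def gens_def intro: Hs_one Hs_Vg hom_one hom_Vg)

text \<open>\<open>x_j\<close> has weight \<open>-l^j\<close>; thus \<open>x_j x_{j+1} V_{j+3}\<close> has the weight
  \<open>l^{j+3} - l^{j+1} - l^j = l^j\<close> of \<open>V_j\<close>.\<close>
definition level :: "nat \<Rightarrow> real \<Rightarrow> (pvar set \<Rightarrow> 'k::field) set" where
  "level j = adjoin (vx j) (- (l ^ j)) (pspan (gens j))"

text \<open>The order matters for \<open>adjoin\<close>. Level j + 1 does not involve index j, so
  the derivative required for y_j is zero; after that the derivative required for x_j just reads off
  the coefficient of y_j.\<close>

definition ext_level :: "nat \<Rightarrow> real \<Rightarrow> (pvar set \<Rightarrow> 'k::field) set" where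
  "ext_level j = adjoin (vx j) (- (l ^ j)) (adjoin (vy j) (l ^ j) (level (Suc j)))"

lemma level_mono: "s \<le> t \<Longrightarrow> level j s \<subseteq> level j t"
  unfolding level_def by (rule adjoin_mono[OF pspan_mono])

lemma ext_level_mono: "s \<le> t \<Longrightarrow> ext_level j s \<subseteq> ext_level j t"
  unfolding ext_level_def by (intro adjoin_mono level_mono)

lemma one_pspan: "0 \<le> t \<Longrightarrow> mono_at {} \<in> pspan (gens j) t"
  by (rule pword_pspan[OF pword.gen]) (auto simp: gens_def)

lemma Vg_pspan: "i \<in> {j, Suc j, j + 2} \<Longrightarrow> Vg i \<in> pspan (gens j) (l ^ i)"
  by (rule pword_pspan[OF pword.gen order_refl], unfold gens_def, rule insertI2, rule imageI)

lemma gensE: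
  assumes "(g, s) \<in> gens j"
  obtains "g = mono_at {}" "s = 0" | "g = Vg j" "s = l ^ j"
    | i where "i \<in> {Suc j, j + 2}" "g = Vg i" "s = l ^ i"
  using assms unfolding gens_def by blast

lemma der_gens:
  assumes "f \<in> pspan (gens j) t" shows "der (vy j) f \<in> pspan (gens j) (t - l ^ j)"
proof (rule der_pspan[OF good_gens(1) _ assms])
  fix g :: "pvar set \<Rightarrow> 'a" and s assume "(g, s) \<in> gens j"
  thus "der (vy j) g \<in> pspan (gens j) (s - l ^ j)"
    by (cases rule: gensE) (auto simp: pspan_lin der_Vg_self der_Vg_zero one_pspan)
qed

lemma level_poisson: "graded_poisson (level j)"
proof -
  interpret graded_poisson "pspan (gens j)" by (rule graded_poisson_pspan[OF good_gens(1)])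
  show ?thesis unfolding level_def by (rule adjoin) (use der_gens in auto)
qed

lemma der_level_zero: assumes "f \<in> level (Suc j) t" shows "der (b, j) f = 0"
proof -
  obtain g h where f: "f = g + lm (vx (Suc j)) h" and g: "g \<in> pspan (gens (Suc j)) t"
    and h: "h \<in> pspan (gens (Suc j)) (t - - (l ^ Suc j))"
    using assms unfolding level_def adjoin_def by blast
  have z: "der (b, j) g' = 0" if "(g', s) \<in> gens (Suc j)" for g' :: "pvar set \<Rightarrow> 'a" and s
    using that by (auto simp: gens_def der_Vg_zero)
  show ?thesis unfolding f
    by (simp add: lin_simps der_lm_other der_pspan_zero[OF g good_gens(1) z] der_pspan_zero[OF h good_gens(1) z])
qed

lemma ext_level_poisson: "graded_poisson (ext_level j)"
proof -
  interpret L: graded_poisson "level (Suc j)" by (rule level_poisson)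
  have 1: "graded_poisson (adjoin (vy j) (l ^ j) (level (Suc j)))"
    by (rule L.adjoin) (simp add: der_level_zero L.lin)
  then interpret M: graded_poisson "adjoin (vy j) (l ^ j) (level (Suc j))" .
  show ?thesis unfolding ext_level_def
  proof (rule M.adjoin)
    fix f :: "pvar set \<Rightarrow> 'a" and t
    assume "f \<in> adjoin (vy j) (l ^ j) (level (Suc j)) t"
    then obtain g h where f: "f = g + lm (vy j) h" "g \<in> level (Suc j) t" "h \<in> level (Suc j) (t - l ^ j)"
      unfolding adjoin_def by blast
    have "der (conj_var (vx j)) f = h + lm (vy j) 0"
      using f(2,3) by (simp add: f(1) lin_simps der_level_zero der_lm fin_supp_Hs[OF L.Hs])
    also have "\<dots> \<in> adjoin (vy j) (l ^ j) (level (Suc j)) (t + - (l ^ j))"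
      by (rule adjoinI) (use f(3) L.lin in auto)
    finally show "der (conj_var (vx j)) f \<in> adjoin (vy j) (l ^ j) (level (Suc j)) (t + - (l ^ j))" .
  qed
qed

lemma pspan_level: "f \<in> pspan (gens j) t \<Longrightarrow> f \<in> level j t"
  unfolding level_def by (rule adjoin_base[OF _ pspan_lin(3)])

lemma level_ext: assumes f: "f \<in> level (Suc j) t" shows "f \<in> ext_level j t"
proof -
  interpret L: graded_poisson "level (Suc j)" by (rule level_poisson)
  show ?thesis unfolding ext_level_def by (intro adjoin_base f L.lin)
qed

lemma gens_ext_level: assumes "(g, s) \<in> gens j" shows "g \<in> ext_level j s"
proof -
  interpret L: graded_poisson "level (Suc j)" by (rule level_poisson)
  from assms show ?thesis
  proof (cases rule: gensE)
    case 1
    then show ?thesis by (auto intro: level_ext pspan_level one_pspan)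
  next
    case 2
    \<comment> \<open>Here x_{j+1}, the variable carried by level j + 1, is needed: it absorbs the
      second factor of x_j x_{j+1} V_{j+3}.\<close>
    have "lm (vx (Suc j)) (Vg (j + 3)) \<in> level (Suc j) (l ^ (j + 3) - l ^ Suc j)"
      unfolding level_def by (rule adjoin_lm[OF pspan_lin(3)]) (use Vg_pspan[of "j + 3" "Suc j"] in simp)
    also have "l ^ (j + 3) - l ^ Suc j = l ^ j - - (l ^ j)" using pow_3[of j] by simp
    finally have m: "lm (vx (Suc j)) (Vg (j + 3)) \<in> level (Suc j) (l ^ j - - (l ^ j))" .
    have "mono_at {} \<in> level (Suc j) (l ^ j - l ^ j)" by (simp add: pspan_level one_pspan)
    thus ?thesis unfolding 2 ext_level_def
      by (subst Vg_rec) (intro adjoinI adjoin_lm adjoin_base m L.lin)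
  next
    case (3 i)
    then show ?thesis by (auto intro!: level_ext pspan_level Vg_pspan)
  qed
qed

text \<open>The subalgebra \<open>ext_level j\<close> contains the generators of level j, hence all
  their words. The uniform bound \<open>t + l ^ j\<close> covers the coefficients of x_j, which
  weigh more because x_j has negative weight.\<close>

lemma level_step:
  assumes "f \<in> level j t"
  obtains f0 f1 f2 f3 where "f0 \<in> level (Suc j) (t + l ^ j)" "f1 \<in> level (Suc j) (t + l ^ j)"
    "f2 \<in> level (Suc j) (t + l ^ j)" "f3 \<in> level (Suc j) (t + l ^ j)"
    "f = f0 + lm (vx j) f1 + lm (vy j) f2 + lm (vx j) (lm (vy j) f3)"
proof -
  interpret L: graded_poisson "level (Suc j)" by (rule level_poisson)
  interpret E: graded_poisson "ext_level j" by (rule ext_level_poisson)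
  have p: "g \<in> ext_level j s" if "g \<in> pspan (gens j) s" for g :: "pvar set \<Rightarrow> 'a" and s
    by (rule E.pspan_mem[OF that gens_ext_level ext_level_mono])
  have dec: "\<exists>a0\<in>level (Suc j) s. \<exists>a1\<in>level (Suc j) (s + l ^ j). \<exists>a2\<in>level (Suc j) s. \<exists>a3\<in>level (Suc j) s.
      g = a0 + lm (vy j) a2 + lm (vx j) (a1 + lm (vy j) a3)"
    if g: "g \<in> ext_level j s" for g :: "pvar set \<Rightarrow> 'a" and s
  proof -
    obtain p q where "g = p + lm (vx j) q" "p \<in> adjoin (vy j) (l ^ j) (level (Suc j)) s"
      "q \<in> adjoin (vy j) (l ^ j) (level (Suc j)) (s - - (l ^ j))"
      using g unfolding ext_level_def by (rule adjoinE)
    then obtain a0 a1 a2 a3 where a: "g = (a0 + lm (vy j) a2) + lm (vx j) (a1 + lm (vy j) a3)"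
      "a0 \<in> level (Suc j) s" "a2 \<in> level (Suc j) (s - l ^ j)"
      "a1 \<in> level (Suc j) (s - - (l ^ j))" "a3 \<in> level (Suc j) (s - - (l ^ j) - l ^ j)"
      by (elim adjoinE) blast
    have "a2 \<in> level (Suc j) s" using a(3) level_mono[of "s - l ^ j" s] by auto
    moreover have "s - - (l ^ j) = s + l ^ j" "s - - (l ^ j) - l ^ j = s" by simp_all
    ultimately show ?thesis using a by metis
  qed
  obtain g h where f: "f = g + lm (vx j) h" "g \<in> pspan (gens j) t" "h \<in> pspan (gens j) (t + l ^ j)"
    using assms unfolding level_def by (elim adjoinE) simp
  obtain a0 a1 a2 a3 where a: "a0 \<in> level (Suc j) t" "a1 \<in> level (Suc j) (t + l ^ j)"
    "a2 \<in> level (Suc j) t" "a3 \<in> level (Suc j) t" "g = a0 + lm (vy j) a2 + lm (vx j) (a1 + lm (vy j) a3)"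
    using dec[OF p[OF f(2)]] by blast
  obtain b0 b1 b2 b3 where b: "b0 \<in> level (Suc j) (t + l ^ j)" "b2 \<in> level (Suc j) (t + l ^ j)"
     "h = b0 + lm (vy j) b2 + lm (vx j) (b1 + lm (vy j) b3)"
    using dec[OF p[OF f(3)]] by blast
  have m: "a0 \<in> level (Suc j) (t + l ^ j)" "a2 \<in> level (Suc j) (t + l ^ j)" "a3 \<in> level (Suc j) (t + l ^ j)"
    using a level_mono[of t "t + l ^ j" "Suc j"] by auto
  \<comment> \<open>In x_j h every part of \<open>h\<close> containing x_j dies, so
    \<open>b1\<close> and \<open>b3\<close> drop out. Keeping \<open>b1\<close> would have forced
    the bound up to \<open>t + 2 * l ^ j\<close>.\<close>
  have "f = a0 + lm (vx j) (a1 + b0) + lm (vy j) a2 + lm (vx j) (lm (vy j) (a3 + b2))"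
    unfolding f(1) a(5) b(3) by (simp add: lin_simps algebra_simps)
  thus ?thesis by (rule that[OF m(1) L.lin(1)[OF a(2) b(1)] m(2) L.lin(1)[OF m(3) b(2)]])
qed

end

section \<open>The upper bound for the Poisson superalgebra\<close>

lemma (in vector_space) span_image_additive:
  assumes X: "\<And>x y. X (x + y) = X x + X y" "\<And>c x. X (scale c x) = scale c (X x)"
    and x: "x \<in> span W"
  shows "X x \<in> span (X ` W)"
proof (rule span_induct[OF x])
  have 0: "X 0 = 0" using X(2)[of 0 0] by simp
  show "subspace {x. X x \<in> span (X ` W)}"
    unfolding subspace_def by (auto simp: X 0 span_zero span_add span_scale)
qed (simp add: span_base)

text \<open>Abstract, since both algebras use it. Unwinding j levels adds l^0 + ... + l^(j-1) \<le>
  2 l^j to the initial t \<le> l^j; hence the factor 3 in \<open>fin\<close>.\<close>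

lemma (in vector_space) span_iterate:
  fixes B :: "nat \<Rightarrow> real \<Rightarrow> 'b set" and X Y :: "nat \<Rightarrow> 'b \<Rightarrow> 'b" and l :: real
  assumes X: "\<And>j x y. X j (x + y) = X j x + X j y" "\<And>j c x. X j (scale c x) = scale c (X j x)"
    and Y: "\<And>j x y. Y j (x + y) = Y j x + Y j y" "\<And>j c x. Y j (scale c x) = scale c (Y j x)"
    and step: "\<And>j t f. f \<in> B j t \<Longrightarrow> \<exists>f0\<in>B (Suc j) (t + l ^ j). \<exists>f1\<in>B (Suc j) (t + l ^ j).
      \<exists>f2\<in>B (Suc j) (t + l ^ j). \<exists>f3\<in>B (Suc j) (t + l ^ j). f = f0 + X j f1 + Y j f2 + X j (Y j f3)"
    and fin: "\<And>j t. t \<le> 3 * l ^ j \<Longrightarrow> \<exists>W. finite W \<and> card W \<le> c \<and> B j t \<subseteq> span W"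
    and geo: "\<And>j. (\<Sum>m<j. l ^ m) \<le> 2 * l ^ j"
    and t: "t \<le> l ^ j"
  shows "\<exists>W. finite W \<and> card W \<le> 4 ^ j * c \<and> B 0 t \<subseteq> span W"
proof -
  \<comment> \<open>Induction on the number of remaining levels, with the start \<open>i\<close>
    free; the hypothesis says that the accumulated weight bound fits the final level i + k.\<close>
  have main: "t + (\<Sum>m=i..<i + k. l ^ m) \<le> 3 * l ^ (i + k)
    \<Longrightarrow> \<exists>W. finite W \<and> card W \<le> 4 ^ k * c \<and> B i t \<subseteq> span W" for i k t
  proof (induction k arbitrary: i t)
    case 0
    then show ?case using fin[of t i] by simp
  next
    case (Suc k)
    have "(\<Sum>m=i..<i + Suc k. l ^ m) = l ^ i + (\<Sum>m=Suc i..<Suc i + k. l ^ m)"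
      using sum.atLeast_Suc_lessThan[of i "i + Suc k" "\<lambda>m. l ^ m"] by simp
    hence "t + l ^ i + (\<Sum>m=Suc i..<Suc i + k. l ^ m) \<le> 3 * l ^ (Suc i + k)"
      using Suc.prems by simp
    from Suc.IH[OF this] obtain W where W: "finite W" "card W \<le> 4 ^ k * c"
      "B (Suc i) (t + l ^ i) \<subseteq> span W" by blast
    let ?W = "W \<union> (X i ` W \<union> (Y i ` W \<union> X i ` Y i ` W))"
    have c: "card (X i ` W) \<le> 4 ^ k * c" "card (Y i ` W) \<le> 4 ^ k * c" "card (X i ` Y i ` W) \<le> 4 ^ k * c"
      using card_image_le[OF W(1)] card_image_le[OF finite_imageI[OF W(1)], of "X i" "Y i"] W(2)
      by (meson order_trans)+
    have "card ?W \<le> 4 ^ k * c + (4 ^ k * c + (4 ^ k * c + 4 ^ k * c))"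
      by (intro order_trans[OF card_Un_le] add_mono W c)
    moreover have "B i t \<subseteq> span ?W"
    proof
      fix f assume "f \<in> B i t"
      then obtain f0 f1 f2 f3 where f: "f0 \<in> span W" "f1 \<in> span W" "f2 \<in> span W" "f3 \<in> span W"
        "f = f0 + X i f1 + Y i f2 + X i (Y i f3)" using step W(3) by blast
      have "f0 \<in> span ?W" using f(1) span_mono[of W ?W] by blast
      moreover have "X i f1 \<in> span ?W"
        using span_image_additive[of "X i", OF X f(2)] span_mono[of "X i ` W" ?W] by blast
      moreover have "Y i f2 \<in> span ?W"
        using span_image_additive[of "Y i", OF Y f(3)] span_mono[of "Y i ` W" ?W] by blast
      moreover have "X i (Y i f3) \<in> span ?W"
        using span_image_additive[of "X i", OF X span_image_additive[of "Y i", OF Y f(4)]]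
          span_mono[of "X i ` Y i ` W" ?W] by blast
      ultimately show "f \<in> span ?W" unfolding f(5) by (intro span_add)
    qed
    ultimately show ?case using W(1) by (intro exI[of _ ?W]) simp
  qed
  have "t + (\<Sum>m=0..<0 + j. l ^ m) \<le> 3 * l ^ (0 + j)"
    using geo[of j] t by (simp add: lessThan_atLeast0)
  from main[OF this] show ?thesis by simp
qed

context cubic_root
begin

lemma level_finite:
  "\<exists>c. \<forall>j t. t \<le> 3 * l ^ j \<longrightarrow> (\<exists>W. finite W \<and> card W \<le> c \<and> (level j t :: (pvar set \<Rightarrow> 'k::field) set) \<subseteq> fs.span W)"
proof -
  \<comment> \<open>4 = 3 + 1: an element of weight at most \<open>3 * l ^ j\<close> is g + x_j h,
    where \<open>h\<close> may weigh \<open>l ^ j\<close> more.\<close>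
  obtain c where c: "\<And>(G :: ((pvar set \<Rightarrow> 'k::field) \<times> real) set) \<mu>. finite G \<Longrightarrow> card G \<le> 3 \<Longrightarrow> 0 < \<mu>
     \<Longrightarrow> (\<forall>(f, s)\<in>G. \<mu> \<le> s)
     \<Longrightarrow> finite {f. \<exists>s\<le>real 4 * \<mu>. pword G s f} \<and> card {f. \<exists>s\<le>real 4 * \<mu>. pword G s f} \<le> c"
    using pword_count[of 4] by blast
  show ?thesis
  \<comment> \<open>\<open>Suc\<close> accounts for the unit, the doubling for the multiples of
    x_j.\<close>
  proof (rule exI[of _ "Suc c + Suc c"], intro allI impI)
    fix j t assume t: "t \<le> 3 * l ^ j"
    define G :: "((pvar set \<Rightarrow> 'k) \<times> real) set" where "G = (\<lambda>i. (Vg i, l ^ i)) ` {j, Suc j, j + 2}"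
    define W where "W = insert (mono_at {}) {f. \<exists>s\<le>real 4 * l ^ j. pword G s f}"
    have "card G \<le> card {j, Suc j, j + 2}" unfolding G_def by (rule card_image_le) simp
    hence "finite G" "card G \<le> 3" by (simp_all add: G_def)
    moreover have "l ^ j \<le> l ^ i" if "j \<le> i" for i
      using that by (intro power_increasing) (simp_all add: less_imp_le)
    hence "\<forall>(f, s)\<in>G. l ^ j \<le> s" unfolding G_def by (auto simp del: power_Suc)
    ultimately have "finite {f. \<exists>s\<le>real 4 * l ^ j. pword G s f}"
        "card {f. \<exists>s\<le>real 4 * l ^ j. pword G s f} \<le> c" using c[of G "l ^ j"] by auto
    hence W: "finite W" "card W \<le> Suc c" unfolding W_def by (auto simp: card_insert_if)
    have good: "good_gens G" unfolding G_def by (rule good_gens)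
    have p: "pspan (gens j) s \<subseteq> fs.span W" if s: "s \<le> 4 * l ^ j" for s
    proof
      fix f :: "pvar set \<Rightarrow> 'k" assume "f \<in> pspan (gens j) s"
      then show "f \<in> fs.span W"
      proof (induction rule: pspan_induct)
        case (word r f)
        hence "pword (insert (mono_at {}, 0) G) r f" by (simp only: gens_def G_def)
        from pword_unit[OF this good] consider "f = 0" | "f = mono_at {}" | "pword G r f" by blast
        then show ?case
        proof cases
          case 3
          hence "f \<in> W" unfolding W_def using word(1) s by auto
          thus ?thesis by (rule fs.span_base)
        qed (simp_all add: fs.span_zero W_def fs.span_base)
      qed (auto intro: fs.span_zero fs.span_add fs.span_scale)
    qed
    have "card (W \<union> lm (vx j) ` W) \<le> Suc c + Suc c"
      using card_image_le[OF W(1), of "lm (vx j)"] W(2) by (intro order_trans[OF card_Un_le] add_mono) auto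
    moreover have "(level j t :: (pvar set \<Rightarrow> 'k) set) \<subseteq> fs.span (W \<union> lm (vx j) ` W)"
    proof
      fix f :: "pvar set \<Rightarrow> 'k" assume "f \<in> level j t"
      then obtain g h where f: "f = g + lm (vx j) h" "g \<in> pspan (gens j) t" "h \<in> pspan (gens j) (t - - (l ^ j))"
        unfolding level_def by (rule adjoinE)
      have "l ^ j \<ge> 0" by simp
      hence "t \<le> 4 * l ^ j" "t - - (l ^ j) \<le> 4 * l ^ j" using t by linarith+
      hence "g \<in> fs.span W" "h \<in> fs.span W" using f p by blast+
      moreover from this(2) have "lm (vx j) h \<in> fs.span (lm (vx j) ` W)"
        by (rule fs.span_image_additive[rotated 2]) (simp_all add: lin_simps)
      ultimately show "f \<in> fs.span (W \<union> lm (vx j) ` W)" unfolding f(1)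
        by (meson fs.span_add fs.span_mono in_mono sup_ge1 sup_ge2)
    qed
    ultimately show "\<exists>W. finite W \<and> card W \<le> Suc c + Suc c \<and> (level j t :: (pvar set \<Rightarrow> 'k) set) \<subseteq> fs.span W"
      using W(1) by (intro exI[of _ "W \<union> lm (vx j) ` W"]) simp
  qed
qed

lemma pspan_upper:
  "\<exists>c. \<forall>j t. t \<le> l ^ j \<longrightarrow> (\<exists>W. finite W \<and> card W \<le> 4 ^ j * c
    \<and> (pspan (gens 0) t :: (pvar set \<Rightarrow> 'k::field) set) \<subseteq> fs.span W)"
proof -
  obtain c where c: "\<And>j t. t \<le> 3 * l ^ j \<Longrightarrow> \<exists>W. finite W \<and> card W \<le> c
      \<and> (level j t :: (pvar set \<Rightarrow> 'k) set) \<subseteq> fs.span W"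
    using level_finite by blast
  have "\<exists>W. finite W \<and> card W \<le> 4 ^ j * c \<and> (level 0 t :: (pvar set \<Rightarrow> 'k) set) \<subseteq> fs.span W"
    if "t \<le> l ^ j" for j t
  proof (rule fs.span_iterate[of "\<lambda>j. lm (vx j)" "\<lambda>j. lm (vy j)" level])
    fix j t and f :: "pvar set \<Rightarrow> 'k" assume "f \<in> level j t"
    then obtain f0 f1 f2 f3 where *: "f0 \<in> level (Suc j) (t + l ^ j)" "f1 \<in> level (Suc j) (t + l ^ j)"
      "f2 \<in> level (Suc j) (t + l ^ j)" "f3 \<in> level (Suc j) (t + l ^ j)"
      "f = f0 + lm (vx j) f1 + lm (vy j) f2 + lm (vx j) (lm (vy j) f3)" by (rule level_step)
    thus "\<exists>f0\<in>level (Suc j) (t + l ^ j). \<exists>f1\<in>level (Suc j) (t + l ^ j). \<exists>f2\<in>level (Suc j) (t + l ^ j).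
      \<exists>f3\<in>level (Suc j) (t + l ^ j). f = f0 + lm (vx j) f1 + lm (vy j) f2 + lm (vx j) (lm (vy j) f3)"
      by blast
  qed (simp_all add: lin_simps c sum_pow that)
  moreover have "(pspan (gens 0) t :: (pvar set \<Rightarrow> 'k) set) \<subseteq> level 0 t" for t
    using pspan_level by blast
  ultimately show ?thesis by (meson order_trans)
qed

end

section \<open>The lower bound for the Poisson superalgebra\<close>

text \<open>The finite set \<open>W\<close> guarantees finite dimension; without it
  \<open>dim\<close> could be the default value 0 for an infinite basis.\<close>

lemma (in vector_space) card_le_dim:
  assumes "finite W" "S \<subseteq> span W" "independent B" "B \<subseteq> span S"
  shows "card B \<le> dim S"
proof -
  obtain C where C: "C \<subseteq> S" "independent C" "S \<subseteq> span C" "card C = dim S"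
    using basis_exists by blast
  have "finite C" using independent_span_bound[OF assms(1) C(2)] C(1) assms(2) by blast
  moreover have "B \<subseteq> span C" using assms(4) C(3) span_mono[OF C(3)] by (auto simp: span_span)
  ultimately show ?thesis using independent_span_bound[OF _ assms(3)] C(4) by metis
qed

text \<open>In a linear dependency take the index k of least rank that occurs. At \<open>p k\<close>
  all other occurring functions vanish, since a nonzero value would give a smaller rank.\<close>

lemma triangular_independent:
  fixes F :: "'i \<Rightarrow> 'a \<Rightarrow> 'k::field" and rk :: "'i \<Rightarrow> int"
  assumes I: "finite I" and diag: "\<And>i. i \<in> I \<Longrightarrow> F i (p i) \<noteq> 0"
    and tri: "\<And>i j. i \<in> I \<Longrightarrow> j \<in> I \<Longrightarrow> F i (p j) \<noteq> 0 \<Longrightarrow> i \<noteq> j \<Longrightarrow> rk i < rk j"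
  shows "inj_on F I" "fs.independent (F ` I)"
proof -
  show inj: "inj_on F I"
  proof (rule inj_onI, rule ccontr)
    fix i j assume ij: "i \<in> I" "j \<in> I" "F i = F j" "i \<noteq> j"
    have "rk i < rk j" using tri[of i j] diag[of j] ij by auto
    moreover have "rk j < rk i" using tri[of j i] diag[of i] ij by auto
    ultimately show False by simp
  qed
  show "fs.independent (F ` I)"
  proof
    assume "fs.dependent (F ` I)"
    then obtain u where u: "\<exists>v\<in>F ` I. u v \<noteq> 0" "(\<Sum>v\<in>F ` I. fscale (u v) v) = 0"
      using fs.dependent_finite[OF finite_imageI[OF I]] by blast
    define J where "J = {i \<in> I. u (F i) \<noteq> 0}"
    have J: "finite J" "J \<noteq> {}" using I u(1) by (auto simp: J_def)
    then obtain k where k: "k \<in> J" "\<And>i. i \<in> J \<Longrightarrow> rk k \<le> rk i"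
      by (metis arg_min_if_finite(1) arg_min_least)
    have "(\<Sum>i\<in>I. fscale (u (F i)) (F i)) = 0" using u(2) by (simp add: sum.reindex[OF inj])
    hence "0 = (\<Sum>i\<in>I. fscale (u (F i)) (F i)) (p k)" by (simp add: zero_fun_apply)
    also have "\<dots> = (\<Sum>i\<in>I. u (F i) * F i (p k))" by (simp add: sum_fun_apply fscale_def)
    also have "\<dots> = (\<Sum>i\<in>I. if i = k then u (F k) * F k (p k) else 0)"
    proof (rule sum.cong[OF refl])
      fix i assume i: "i \<in> I"
      have "u (F i) * F i (p k) = 0" if "i \<noteq> k"
        using tri[OF i _ _ that] k i by (fastforce simp: J_def)
      thus "u (F i) * F i (p k) = (if i = k then u (F k) * F k (p k) else 0)" by auto
    qed
    also have "\<dots> = u (F k) * F k (p k)" using I k(1) by (simp add: J_def)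
    finally show False using k(1) diag by (simp add: J_def)
  qed
qed

text \<open>The recursion counts the letters in \<open>V_{m+3} = -{V_m, {V_m, V_{m+1}}}\<close>.\<close>
fun glen :: "nat \<Rightarrow> nat" where
  "glen n = (if n < 3 then 1 else glen (n - 2) + 2 * glen (n - 3))"

declare glen.simps [simp del]

lemma glen_small: "n < 3 \<Longrightarrow> glen n = 1" by (simp add: glen.simps)

lemma glen_rec: "glen (n + 3) = glen (Suc n) + 2 * glen n" by (subst glen.simps) simp

text \<open>By \<open>pow_3\<close> the powers of l obey the recursion of \<open>glen\<close>, and
  they start no lower.\<close>

lemma (in cubic_root) glen_le: "real (glen n) \<le> l ^ n"
proof (induction n rule: less_induct)
  case (less n)
  show ?case
  proof (cases "n < 3")
    case True
    then show ?thesis using one_le_power[OF less_imp_le[OF l_pos(3)], of n] by (simp add: glen_small)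
  next
    case False
    then obtain m where m: "n = m + 3" by (metis add.commute le_Suc_ex not_less)
    show ?thesis unfolding m glen_rec pow_3 using less[of "Suc m"] less[of m] m by simp
  qed
qed

text \<open>\<open>x^\<alpha> V_{2r+4}\<close> with \<open>\<alpha> \<subseteq> qset r\<close> takes no more letters than \<open>V_{2r+4}\<close>.\<close>
definition qset :: "nat \<Rightarrow> nat set" where
  "qset r = (\<lambda>s. 2 * s) ` {..<r} \<union> (\<lambda>s. 2 * s + 3) ` {..<r}"

definition clm :: "bool \<Rightarrow> 'v::linorder \<Rightarrow> ('v set \<Rightarrow> 'k::field) \<Rightarrow> 'v set \<Rightarrow> 'k" where
  "clm b z f = (if b then lm z f else f)"

text \<open>\<open>x\<close> embeds indices into variables, so that one operator serves both
  algebras: with \<open>vx\<close> for the Poisson case and the identity for \<Lambda>. The factors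
  stand in the order in which \<open>qop_mem\<close> produces them.\<close>

fun qop :: "(nat \<Rightarrow> 'v::linorder) \<Rightarrow> nat \<Rightarrow> nat set \<Rightarrow> ('v set \<Rightarrow> 'k::field) \<Rightarrow> 'v set \<Rightarrow> 'k" where
  "qop x 0 \<alpha> f = f"
| "qop x (Suc r) \<alpha> f = clm (2 * r + 3 \<in> \<alpha>) (x (2 * r + 3)) (clm (2 * r \<in> \<alpha>) (x (2 * r)) (qop x r \<alpha> f))"

lemma qset_Suc: "qset (Suc r) = insert (2 * r + 3) (insert (2 * r) (qset r))"
  by (auto simp: qset_def lessThan_Suc)

lemma qset_0 [simp]: "qset 0 = {}" by (simp add: qset_def)

lemma finite_qset [simp]: "finite (qset r)" by (simp add: qset_def)

lemma qset_fresh: "2 * r \<notin> qset r" "2 * r + 3 \<notin> qset r"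
  by (auto simp: qset_def) presburger+

lemma qset_less: "i \<in> qset r \<Longrightarrow> i < 2 * r + 2"
  by (auto simp: qset_def)

lemma card_qset: "card (qset r) = 2 * r"
proof (induction r)
  case (Suc r)
  then show ?case using qset_fresh[of r] by (simp add: qset_Suc)
qed simp

text \<open>There are 4r + 4 binary choices; 4r of them are enough, the rest would only improve a
  constant.\<close>

lemma qop_index_card: "16 ^ r \<le> card (Pow (qset r) \<times> Pow {..<2 * r + 4})"
proof -
  have "(16::nat) ^ r = 2 ^ (2 * r) * 2 ^ (2 * r)"
    by (simp add: power_mult power_mult_distrib[symmetric])
  also have "\<dots> \<le> 2 ^ (2 * r) * 2 ^ (2 * r + 4)" by simp
  also have "\<dots> = card (Pow (qset r) \<times> Pow {..<2 * r + 4})"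
    by (simp add: card_cartesian_product card_Pow card_qset)
  finally show ?thesis .
qed

text \<open>\<open>b\<close> is the component of degree \<open>d\<close> of \<open>a\<close>, and \<open>a\<close> has no components of lower degree;
  \<open>b = 0\<close> and \<open>d < 0\<close> are allowed.\<close>
definition lead :: "int \<Rightarrow> ('v set \<Rightarrow> 'k::field) \<Rightarrow> ('v set \<Rightarrow> 'k) \<Rightarrow> bool" where
  "lead d a b \<longleftrightarrow> (\<forall>R. finite R \<longrightarrow> int (card R) \<le> d \<longrightarrow> a R = b R)
     \<and> (\<forall>R. b R \<noteq> 0 \<longrightarrow> finite R \<and> int (card R) = d)"

lemma lead_zero: "lead d a b \<Longrightarrow> finite R \<Longrightarrow> int (card R) < d \<Longrightarrow> a R = 0"
  unfolding lead_def by (metis less_imp_le less_irrefl)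

lemma lead_lm: assumes "lead d a b" shows "lead (d + 1) (lm z a) (lm z b)"
proof -
  have "int (card (R - {z})) \<le> d" if "finite R" "z \<in> R" "int (card R) \<le> d + 1" for R
    using that(3) card.remove[OF that(1,2)] by linarith
  hence "lm z a R = lm z b R" if "finite R" "int (card R) \<le> d + 1" for R
    using assms that by (intro lm_cong) (auto simp: lead_def)
  moreover have "int (card R) = d + 1" if "lm z b R \<noteq> 0" for R
  proof -
    have R: "finite R" "z \<in> R" "b (R - {z}) \<noteq> 0" using lm_nonzeroD[OF that] by auto
    hence "int (card (R - {z})) = d" using assms unfolding lead_def by blast
    moreover have "card R = Suc (card (R - {z}))" by (rule card.remove[OF R(1,2)])
    ultimately show ?thesis by linarith
  qed
  ultimately show ?thesis unfolding lead_def by (blast dest: lm_nonzeroD)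
qed

lemma lead_add_high:
  assumes "lead d a b" "\<And>R. finite R \<Longrightarrow> int (card R) \<le> d \<Longrightarrow> h R = 0"
  shows "lead d (a + h) b"
  using assms unfolding lead_def by (simp add: plus_fun_apply)

text \<open>The scalar stays unspecified, so signs need not be computed.\<close>

definition pure :: "'v set \<Rightarrow> ('v set \<Rightarrow> 'k::field) \<Rightarrow> bool" where
  "pure S f \<longleftrightarrow> (\<exists>c. c \<noteq> 0 \<and> f = fscale c (mono_at S))"

lemma pure_lm:
  assumes "pure S f" "finite S" "z \<notin> S" shows "pure (insert z S) (lm z f)"
proof -
  obtain c where c: "c \<noteq> 0" "f = fscale c (mono_at S)" using assms(1) by (auto simp: pure_def)
  have "lm z f = fscale (c * sg {z} S) (mono_at (insert z S))"
    using assms(2,3) by (auto simp: c(2) lm_def fscale_def mono_at_def fun_eq_iff)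
  thus ?thesis unfolding pure_def using c(1) by (intro exI[of _ "c * sg {z} S"]) simp
qed

lemma pure_nonzero: "pure S f \<Longrightarrow> f R \<noteq> 0 \<longleftrightarrow> R = S"
  by (auto simp: pure_def fscale_def mono_at_def split: if_splits)

lemma pure_qop:
  assumes "pure S f" "finite S" "x ` qset r \<inter> S = {}" "inj x" "\<alpha> \<subseteq> qset n" "r \<le> n"
  shows "pure (x ` (\<alpha> \<inter> qset r) \<union> S) (qop x r \<alpha> f)"
  using assms(3,6)
proof (induction r)
  case (Suc r)
  let ?T = "x ` (\<alpha> \<inter> qset r) \<union> S"
  have IH: "pure ?T (qop x r \<alpha> f)" using Suc by (simp add: qset_Suc)
  have fT: "finite ?T" using assms(2) by simp
  have n1: "x (2 * r) \<notin> ?T" "x (2 * r + 3) \<notin> insert (x (2 * r)) ?T"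
    using Suc.prems qset_fresh[of r] by (auto simp: qset_Suc inj_eq[OF assms(4)])
  have 1: "pure (if 2 * r \<in> \<alpha> then insert (x (2 * r)) ?T else ?T) (clm (2 * r \<in> \<alpha>) (x (2 * r)) (qop x r \<alpha> f))"
    using pure_lm[OF IH fT n1(1)] IH by (simp add: clm_def)
  have "pure (if 2 * r + 3 \<in> \<alpha> then insert (x (2 * r + 3)) (if 2 * r \<in> \<alpha> then insert (x (2 * r)) ?T else ?T)
      else (if 2 * r \<in> \<alpha> then insert (x (2 * r)) ?T else ?T)) (qop x (Suc r) \<alpha> f)"
    using pure_lm[OF 1, of "x (2 * r + 3)"] 1 n1 fT by (auto simp: clm_def)
  moreover have "(if 2 * r + 3 \<in> \<alpha> then insert (x (2 * r + 3)) (if 2 * r \<in> \<alpha> then insert (x (2 * r)) ?T else ?T)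
      else (if 2 * r \<in> \<alpha> then insert (x (2 * r)) ?T else ?T)) = x ` (\<alpha> \<inter> qset (Suc r)) \<union> S"
    by (auto simp: qset_Suc)
  ultimately show ?case by simp
qed (use assms(1) in simp)

lemma lead_qop:
  fixes x :: "nat \<Rightarrow> 'v::linorder" and a b :: "'v set \<Rightarrow> 'k::field"
  assumes "lead d a b"
  shows "lead (d + int (card (\<alpha> \<inter> qset r))) (qop x r \<alpha> a) (qop x r \<alpha> b)"
proof (induction r)
  case (Suc r)
  have c: "lead (e + (if B then 1 else 0)) (clm B z f) (clm B z g)" if "lead e f g" for e B and z :: 'v and f g :: "'v set \<Rightarrow> 'k"
    using lead_lm[OF that] that by (simp add: clm_def)
  have "int (card (\<alpha> \<inter> qset (Suc r))) = int (card (\<alpha> \<inter> qset r)) + (if 2 * r \<in> \<alpha> then 1 else 0) + (if 2 * r + 3 \<in> \<alpha> then 1 else 0)"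
  proof -
    have "2 * r \<notin> \<alpha> \<inter> qset r" "2 * r + 3 \<notin> insert (2 * r) (\<alpha> \<inter> qset r)" "2 * r + 3 \<notin> \<alpha> \<inter> qset r"
      using qset_fresh[of r] by auto
    thus ?thesis by (simp add: qset_Suc Int_insert_right)
  qed
  moreover have "lead (d + int (card (\<alpha> \<inter> qset r)) + (if 2 * r \<in> \<alpha> then 1 else 0) + (if 2 * r + 3 \<in> \<alpha> then 1 else 0))
     (qop x (Suc r) \<alpha> a) (qop x (Suc r) \<alpha> b)"
    unfolding qop.simps by (intro c Suc)
  ultimately show ?case by (simp add: algebra_simps)
qed (use assms in simp)

section \<open>Brackets of the elements V_i\<close>

lemma gi_hom: assumes "hom False f" shows "gi f = - f"
proof
  fix R
  show "gi f R = (- f) R"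
    using assms by (cases "f R = 0") (simp_all add: gi_def hom_def uminus_apply)
qed

lemma gi_one [simp]: "gi (mono_at {}) = mono_at {}"
  by (auto simp: gi_def mono_at_def fun_eq_iff)

lemmas fin_supp_Vg = fin_supp_Hs[OF Hs_Vg]

lemma br_lm_left_free:
  "g \<in> Hs \<Longrightarrow> h \<in> Hs \<Longrightarrow> der (conj_var z) h = 0 \<Longrightarrow> br (lm z g) h = lm z (br g h)"
  by (simp add: br_lm_left mul_simps)

lemma br_lm_right_free:
  "f \<in> Hs \<Longrightarrow> g \<in> Hs \<Longrightarrow> der (conj_var z) f = 0 \<Longrightarrow> br f (lm z g) = lm z (br (gi f) g)"
  by (simp add: br_lm_right mul_simps lin_simps)

text \<open>Bracketing with y_m is the derivative in x_m, and since \<open>h\<close> is free of y_m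
  the factor x_m of the tail of V_m is never contracted.\<close>

lemma br_Vg_left:
  assumes "h \<in> Hs" "der (vy m) h = 0"
  shows "br (Vg m) h = der (vx m) h + lm (vx m) (br (lm (vx (Suc m)) (Vg (m + 3))) h)"
proof -
  have "br (lm (vy m) (mono_at {})) h = der (vx m) h"
    using br_lm_left[OF Hs_one assms(1), of "vy m"]
    by (simp add: mul_one fin_supp_Hs[OF Hs_der[OF assms(1)]] lin_simps)
  moreover have "br (lm (vx m) (lm (vx (Suc m)) (Vg (m + 3)))) h
    = lm (vx m) (br (lm (vx (Suc m)) (Vg (m + 3))) h)"
    by (rule br_lm_left_free) (use assms in \<open>auto intro: Hs_intros Hs_Vg\<close>)
  ultimately show ?thesis
    by (subst Vg_rec) (simp add: br_bilinear Hs_lm Hs_Vg Hs_one assms(1))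
qed

text \<open>V_{m+1} is free of x_m, so only x_m {x_{m+1} V_{m+3}, V_{m+1}} remains. Contracting
  x_{m+1} with y_{m+1} gives -V_{m+3}; the other term vanishes because {V_{m+3}, V_{m+1}} is itself
  a multiple of x_{m+1}.\<close>

lemma br_Vg_Vg:
  "br (Vg m :: pvar set \<Rightarrow> 'k::field) (Vg (Suc m)) = - lm (vx m) (Vg (m + 3))"
proof -
  let ?W = "Vg (m + 3) :: pvar set \<Rightarrow> 'k" and ?h = "Vg (Suc m) :: pvar set \<Rightarrow> 'k"
  have "br (lm (vx (Suc m)) ?W) ?h = mul (gi ?W) (der (vy (Suc m)) ?h) + lm (vx (Suc m)) (br ?W ?h)"
    using br_lm_left[OF Hs_Vg Hs_Vg, of "vx (Suc m)"] by simp
  also have "mul (gi ?W) (der (vy (Suc m)) ?h) = - ?W"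
    by (simp add: der_Vg_self gi_hom[OF hom_Vg] mul_simps mul_one_right fin_supp_Vg)
  also have "lm (vx (Suc m)) (br ?W ?h) = 0"
  proof -
    have "br ?W (lm (vy (Suc m)) (mono_at {})) = 0"
      by (subst br_lm_right_free) (auto simp: Hs_Vg Hs_one der_Vg_zero lin_simps)
    moreover have "br ?W (lm (vx (Suc m)) k) = lm (vx (Suc m)) (br (gi ?W) k)" if "k \<in> Hs" for k
      by (rule br_lm_right_free) (auto simp: Hs_Vg that der_Vg_zero)
    ultimately have "br ?W ?h = lm (vx (Suc m)) (br (gi ?W) (lm (vx (Suc (Suc m))) (Vg (Suc m + 3))))"
      by (subst Vg_rec[of "Suc m"]) (simp add: br_bilinear Hs_lm Hs_Vg Hs_one)
    thus ?thesis by simp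
  qed
  finally show ?thesis
    by (subst br_Vg_left) (auto simp: Hs_Vg der_Vg_zero lin_simps)
qed

text \<open>The y_m in V_m removes x_m, while the tail of V_m contributes a second factor x_m and
  hence nothing.\<close>

lemma br_Vg_lm:
  assumes "g \<in> Hs" "der (vx m) g = 0" "der (vy m) g = 0"
  shows "br (Vg m) (lm (vx m) g) = g"
proof -
  have d: "der (vy m) (lm (vx m) g) = 0" by (simp add: der_lm_other assms lin_simps)
  have d': "der (vx m) (lm (vx m) g) = g" by (simp add: der_lm_same fin_supp_Hs assms lin_simps)
  have "br (lm (vx (Suc m)) (Vg (m + 3))) (lm (vx m) g)
    = lm (vx m) (br (gi (lm (vx (Suc m)) (Vg (m + 3)))) g)"
    by (rule br_lm_right_free)
      (auto simp: assms Hs_lm Hs_Vg der_lm_other der_Vg_zero lin_simps)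
  thus ?thesis by (subst br_Vg_left) (auto simp: assms Hs_lm d d')
qed

lemma clm_lin: "clm b z (fscale c f) = fscale c (clm b z f)" "clm b z (- f) = - clm b z f"
  by (simp_all add: clm_def lin_simps)

lemma qop_lin: "qop x r \<alpha> (fscale c f) = fscale c (qop x r \<alpha> f)" "qop x r \<alpha> (- f) = - qop x r \<alpha> f"
  by (induction r) (simp_all add: clm_lin)

lemma clm_lm: "z \<noteq> w \<Longrightarrow> clm b z (lm w f) = lm w (clm b z f) \<or> clm b z (lm w f) = - lm w (clm b z f)"
  using lm_lm[of z w f] by (auto simp: clm_def)

lemma qop_lm:
  assumes "inj x" "2 * r + 2 \<le> m"
  shows "qop x r \<alpha> (lm (x m) f) = lm (x m) (qop x r \<alpha> f) \<or> qop x r \<alpha> (lm (x m) f) = - lm (x m) (qop x r \<alpha> f)"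
  using assms(2)
proof (induction r)
  case (Suc r)
  have n: "x (2 * r) \<noteq> x m" "x (2 * r + 3) \<noteq> x m" using Suc.prems by (auto simp: inj_eq[OF assms(1)])
  have IH: "qop x r \<alpha> (lm (x m) f) = lm (x m) (qop x r \<alpha> f) \<or> qop x r \<alpha> (lm (x m) f) = - lm (x m) (qop x r \<alpha> f)"
    using Suc by simp
  show ?case
    unfolding qop.simps using IH clm_lm[OF n(1), of "2 * r \<in> \<alpha>" "qop x r \<alpha> f"]
      clm_lm[OF n(2), of "2 * r + 3 \<in> \<alpha>" "clm (2 * r \<in> \<alpha>) (x (2 * r)) (qop x r \<alpha> f)"]
    by (auto simp: clm_lin)
qed simp

lemma der_clm: "z \<noteq> w \<Longrightarrow> der z f = 0 \<Longrightarrow> der z (clm b w f) = 0"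
  by (simp add: clm_def der_lm_other lin_simps)

lemma der_qop: "(\<And>i. i \<in> qset r \<Longrightarrow> z \<noteq> x i) \<Longrightarrow> der z f = 0 \<Longrightarrow> der z (qop x r \<alpha> f) = 0"
  by (induction r) (auto simp: qset_Suc intro!: der_clm)

lemma Hs_clm: "f \<in> Hs \<Longrightarrow> clm b z f \<in> Hs"
  by (simp add: clm_def Hs_lm)

lemma Hs_qop: "f \<in> Hs \<Longrightarrow> qop x r \<alpha> f \<in> Hs"
  by (induction r) (simp_all add: Hs_clm)

lemma uminus_eq_fscale: "- f = fscale (-1) f"
  by (simp add: fscale_def fun_eq_iff uminus_apply)

lemma br_uminus: "f \<in> Hs \<Longrightarrow> h \<in> Hs \<Longrightarrow> br (- f) h = - br f h"
  using br_bilinear(3)[of f 0 h "-1"] by (simp only: Hs_0 uminus_eq_fscale)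

section \<open>Words with few letters\<close>

definition gens1 :: "((pvar set \<Rightarrow> 'k::field) \<times> real) set" where
  "gens1 = (\<lambda>i. (Vg i, 1)) ` {..<3}"

lemma good_gens1: "good_gens gens1"
  by (auto simp: good_gens_def gens1_def intro: Hs_Vg hom_Vg)

interpretation P1: graded_poisson "pspan gens1"
  by (rule graded_poisson_pspan[OF good_gens1])

abbreviation M1 :: "'k::field itself \<Rightarrow> real \<Rightarrow> (pvar set \<Rightarrow> 'k) set" where
  "M1 T \<equiv> pspan gens1"

lemma lm_Vg_mem:
  assumes "Vg m \<in> M1 TYPE('k::field) (real (glen m))" "Vg (Suc m) \<in> M1 TYPE('k::field) (real (glen (Suc m)))"
  shows "lm (vx m) (Vg (m + 3)) \<in> M1 TYPE('k::field) (real (glen m + glen (Suc m)))"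
proof -
  have "lm (vx m) (Vg (m + 3)) = - br (Vg m) (Vg (Suc m))" by (simp add: br_Vg_Vg)
  also have "\<dots> \<in> M1 TYPE('k::field) (real (glen m) + real (glen (Suc m)))"
    by (intro P1.lin P1.br assms)
  finally show ?thesis by simp
qed

lemma Vg_mem: "Vg i \<in> M1 TYPE('k::field) (real (glen i))"
proof (induction i rule: less_induct)
  case (less i)
  show ?case
  proof (cases "i < 3")
    case True
    then show ?thesis by (intro pword_pspan[OF pword.gen]) (auto simp: gens1_def glen_small)
  next
    case False
    then obtain m where m: "i = m + 3" by (metis add.commute le_Suc_ex not_less)
    have v: "Vg m \<in> M1 TYPE('k::field) (real (glen m))" "Vg (Suc m) \<in> M1 TYPE('k::field) (real (glen (Suc m)))"
      using less[of m] less[of "Suc m"] m by auto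
    have "Vg (m + 3) = br (Vg m) (lm (vx m) (Vg (m + 3)))"
      by (rule br_Vg_lm[symmetric]) (auto simp: Hs_Vg der_Vg_zero)
    also have "\<dots> \<in> M1 TYPE('k::field) (real (glen m) + real (glen m + glen (Suc m)))"
      by (intro P1.br v lm_Vg_mem)
    finally show ?thesis unfolding m glen_rec by (simp add: algebra_simps)
  qed
qed

text \<open>Identities involving optional factors x are kept up to sign only, which suffices because
  they are used for membership in subspaces.\<close>

lemma br_clm:
  assumes "f \<in> Hs" "k \<in> Hs" "hom False f" "der (vy i) f = 0"
  shows "br f (clm b (vx i) k) = clm b (vx i) (br f k) \<or> br f (clm b (vx i) k) = - clm b (vx i) (br f k)"
  using br_lm_right_free[OF assms(1,2), of "vx i"] assms
  by (auto simp: clm_def gi_hom br_uminus lin_simps)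

lemma br_qop:
  assumes "f \<in> Hs" "k \<in> Hs" "hom False f" "\<And>i. i \<in> qset r \<Longrightarrow> der (vy i) f = 0"
  shows "br f (qop vx r \<alpha> k) = qop vx r \<alpha> (br f k) \<or> br f (qop vx r \<alpha> k) = - qop vx r \<alpha> (br f k)"
  using assms(4)
proof (induction r)
  case (Suc r)
  have IH: "br f (qop vx r \<alpha> k) = qop vx r \<alpha> (br f k) \<or> br f (qop vx r \<alpha> k) = - qop vx r \<alpha> (br f k)"
    using Suc by (simp add: qset_Suc)
  have d: "der (vy (2 * r)) f = 0" "der (vy (2 * r + 3)) f = 0" using Suc.prems by (simp_all add: qset_Suc)
  let ?Q = "qop vx r \<alpha> k"
  have Q: "?Q \<in> Hs" by (rule Hs_qop[OF assms(2)])
  show ?case unfolding qop.simps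
    using IH br_clm[OF assms(1) Q assms(3) d(1), of "2 * r \<in> \<alpha>"]
      br_clm[OF assms(1) Hs_clm[OF Q] assms(3) d(2), of "2 * r + 3 \<in> \<alpha>" "2 * r \<in> \<alpha>" "vx (2 * r)"]
    by (auto simp: clm_lin)
qed simp

text \<open>Put m = 2r + 3. Bracketing V_m, with x_{2r} in front if wanted, with x^\<alpha> V_{m+1}
  gives V_{m+3} with x_m, x_{2r} and x^\<alpha> in front; bracketing with V_m removes x_m. Each step
  thus makes the two variables x_{2r} and x_{2r+3} optional, which is the origin of
  \<open>qset\<close>.\<close>

lemma qop_mem: "qop vx r \<alpha> (Vg (2 * r + 4)) \<in> M1 TYPE('k::field) (real (glen (2 * r + 4)))"
proof (induction r)
  case 0
  then show ?case using Vg_mem[of 4] by simp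
next
  case (Suc r)
  define m where "m = 2 * r + 3"
  define b where "b \<longleftrightarrow> 2 * r \<in> \<alpha>"
  have m: "2 * r + 4 = Suc m" "2 * Suc r + 4 = m + 3" by (auto simp: m_def)
  let ?g = "qop vx r \<alpha> (Vg (Suc m)) :: pvar set \<Rightarrow> 'k"
  define h0 where "h0 = (clm b (vx (2 * r)) (qop vx r \<alpha> (Vg (m + 3))) :: pvar set \<Rightarrow> 'k)"
  have g: "?g \<in> M1 TYPE('k::field) (real (glen (Suc m)))" using Suc by (simp only: m)
  \<comment> \<open>The bracket of V_{2r} and V_{2r+1} gives x_{2r} V_m with fewer letters than V_m
    is allowed.\<close>
  have "real (glen (2 * r) + glen (Suc (2 * r))) \<le> real (glen m)" unfolding m_def glen_rec by simp
  hence "lm (vx (2 * r)) (Vg m) \<in> M1 TYPE('k::field) (real (glen m))"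
    using lm_Vg_mem[OF Vg_mem[of "2 * r"] Vg_mem] pspan_mono unfolding m_def by blast
  hence e: "clm b (vx (2 * r)) (Vg m) \<in> M1 TYPE('k::field) (real (glen m))"
    by (simp add: clm_def Vg_mem)
  have gH: "?g \<in> Hs" by (rule Hs_qop[OF Hs_Vg])
  have "der (vy (2 * r)) ?g = 0" by (rule der_qop) (auto simp: der_Vg_zero m_def)
  hence 1: "br (clm b (vx (2 * r)) (Vg m)) ?g = clm b (vx (2 * r)) (br (Vg m) ?g)"
    using br_lm_left_free[OF Hs_Vg gH, of "vx (2 * r)"] by (simp add: clm_def)
  have "der (vy i) (Vg m :: pvar set \<Rightarrow> 'k) = 0" if "i \<in> qset r" for i
    using qset_less[OF that] by (intro der_Vg_zero) (simp add: m_def)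
  hence "br (Vg m) ?g = qop vx r \<alpha> (br (Vg m) (Vg (Suc m)))
      \<or> br (Vg m) ?g = - qop vx r \<alpha> (br (Vg m) (Vg (Suc m)))"
    by (rule br_qop[OF Hs_Vg Hs_Vg hom_Vg])
  hence 2: "br (Vg m) ?g = qop vx r \<alpha> (lm (vx m) (Vg (m + 3))) \<or> br (Vg m) ?g = - qop vx r \<alpha> (lm (vx m) (Vg (m + 3)))"
    by (auto simp: br_Vg_Vg qop_lin)
  have 3: "qop vx r \<alpha> (lm (vx m) (Vg (m + 3) :: pvar set \<Rightarrow> 'k)) = lm (vx m) (qop vx r \<alpha> (Vg (m + 3))) \<or>
      qop vx r \<alpha> (lm (vx m) (Vg (m + 3) :: pvar set \<Rightarrow> 'k)) = - lm (vx m) (qop vx r \<alpha> (Vg (m + 3)))"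
    by (rule qop_lm) (auto simp: inj_on_def m_def)
  have 4: "clm b (vx (2 * r)) (lm (vx m) k) = lm (vx m) (clm b (vx (2 * r)) k) \<or>
      clm b (vx (2 * r)) (lm (vx m) k) = - lm (vx m) (clm b (vx (2 * r)) k)" for k :: "pvar set \<Rightarrow> 'k"
    by (rule clm_lm) (simp add: m_def)
  have "br (clm b (vx (2 * r)) (Vg m)) ?g = lm (vx m) h0 \<or> br (clm b (vx (2 * r)) (Vg m)) ?g = - lm (vx m) h0"
    using 2 3 4[of "qop vx r \<alpha> (Vg (m + 3))"] unfolding 1 h0_def
    by (elim disjE) (simp_all add: clm_lin)
  moreover have "br (clm b (vx (2 * r)) (Vg m)) ?g \<in> M1 TYPE('k::field) (real (glen m) + real (glen (Suc m)))"
    by (rule P1.br[OF e g])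
  ultimately have h1: "lm (vx m) h0 \<in> M1 TYPE('k::field) (real (glen m) + real (glen (Suc m)))"
    using P1.lin(4) by fastforce
  \<comment> \<open>Removing x_m costs one more V_m and brings the count to 2 glen m + glen (m + 1)
    = glen (m + 3).\<close>
  have "h0 = br (Vg m) (lm (vx m) h0)"
    unfolding h0_def using qset_less[of m r]
    by (intro br_Vg_lm[symmetric] Hs_clm Hs_qop Hs_Vg der_clm der_qop der_Vg_zero) (auto simp: m_def)
  also have "\<dots> \<in> M1 TYPE('k::field) (real (glen m) + (real (glen m) + real (glen (Suc m))))"
    by (rule P1.br[OF Vg_mem h1])
  finally have h: "h0 \<in> M1 TYPE('k::field) (real (glen (m + 3)))" by (simp add: glen_rec algebra_simps)
  have "real (glen m) + real (glen (Suc m)) \<le> real (glen (m + 3))" by (simp add: glen_rec)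
  hence "lm (vx m) h0 \<in> M1 TYPE('k::field) (real (glen (m + 3)))" using h1 pspan_mono by blast
  with h have "clm (m \<in> \<alpha>) (vx m) h0 \<in> M1 TYPE('k::field) (real (glen (m + 3)))" by (simp add: clm_def)
  thus ?case unfolding m(2) qop.simps by (simp only: h0_def b_def m_def)
qed

section \<open>Lowest-degree parts of products\<close>

definition low :: "int \<Rightarrow> ('v set \<Rightarrow> 'k::field) \<Rightarrow> bool" where
  "low d f \<longleftrightarrow> (\<forall>R. finite R \<longrightarrow> int (card R) < d \<longrightarrow> f R = 0)"

lemma low_lead: "lead d a b \<Longrightarrow> low d a"
  unfolding low_def using lead_zero by blast

lemma low_lm: assumes "low d f" shows "low (d + 1) (lm z f)"
  unfolding low_def
proof (intro allI impI, rule ccontr)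
  fix R assume R: "finite R" "int (card R) < d + 1" "lm z f R \<noteq> 0"
  hence "z \<in> R" "f (R - {z}) \<noteq> 0" using lm_nonzeroD[OF R(3)] by auto
  moreover have "int (card (R - {z})) < d" using R(2) card.remove[OF R(1) \<open>z \<in> R\<close>] by linarith
  ultimately show False using assms R(1) by (auto simp: low_def)
qed

lemma low_mul: assumes "low d a" shows "low d (mul f a)"
  unfolding low_def
proof (intro allI impI, rule ccontr)
  fix R assume R: "finite R" "int (card R) < d" "mul f a R \<noteq> 0"
  then obtain A where "A \<subseteq> R" "a (R - A) \<noteq> 0" by (auto elim: mul_nonzeroD)
  moreover have "card (R - A) \<le> card R" using R(1) by (rule card_mono) blast
  ultimately show False using assms R(1,2) by (auto simp: low_def)
qed

lemma lead_add_low: "lead d a b \<Longrightarrow> low (d + 1) h \<Longrightarrow> lead d (a + h) b"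
  by (erule lead_add_high) (auto simp: low_def)

text \<open>V_n contributes y_n; its tail begins with two factors x and so lands in strictly higher
  degree.\<close>

lemma lead_mul_Vg:
  assumes "lead d a b" "fin_supp a" shows "lead (d + 1) (mul (Vg n) a) (lm (vy n) b)"
proof -
  have "mul (Vg n) a = lm (vy n) a + lm (vx n) (lm (vx (Suc n)) (mul (Vg (n + 3)) a))"
    by (subst Vg_rec) (simp add: mul_simps lm_mul[symmetric] mul_one[OF assms(2)])
  moreover have "low (d + 1 + 1) (lm (vx n) (lm (vx (Suc n)) (mul (Vg (n + 3)) a)))"
    by (intro low_lm low_mul low_lead[OF assms(1)])
  ultimately show ?thesis using lead_add_low[OF lead_lm[OF assms(1)]] by metis
qed

fun prv :: "nat \<Rightarrow> nat set \<Rightarrow> (pvar set \<Rightarrow> 'k::field) \<Rightarrow> pvar set \<Rightarrow> 'k" where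
  "prv 0 \<beta> f = f"
| "prv (Suc n) \<beta> f = (if n \<in> \<beta> then mul (Vg n) (prv n \<beta> f) else prv n \<beta> f)"

fun plm :: "nat \<Rightarrow> nat set \<Rightarrow> (pvar set \<Rightarrow> 'k::field) \<Rightarrow> pvar set \<Rightarrow> 'k" where
  "plm 0 \<beta> f = f"
| "plm (Suc n) \<beta> f = clm (n \<in> \<beta>) (vy n) (plm n \<beta> f)"

lemma Hs_prv: "f \<in> Hs \<Longrightarrow> prv n \<beta> f \<in> Hs"
  by (induction n) (auto intro: Hs_mul Hs_Vg)

lemma Int_lessThan_Suc:
  "\<beta> \<inter> {..<Suc n} = (if n \<in> \<beta> then insert n (\<beta> \<inter> {..<n}) else \<beta> \<inter> {..<n})"
  by (auto simp: lessThan_Suc)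

lemma lead_prv:
  assumes "lead d a b" "a \<in> Hs"
  shows "lead (d + int (card (\<beta> \<inter> {..<n}))) (prv n \<beta> a) (plm n \<beta> b)"
proof (induction n)
  case (Suc n)
  show ?case using lead_mul_Vg[OF Suc fin_supp_Hs[OF Hs_prv[OF assms(2)]], of n] Suc
    by (simp add: Int_lessThan_Suc clm_def algebra_simps)
qed (use assms in simp)

lemma pure_plm:
  assumes "pure S b" "finite S" "S \<inter> vy ` {..<n} = {}"
  shows "pure (vy ` (\<beta> \<inter> {..<n}) \<union> S) (plm n \<beta> b)"
  using assms(3)
proof (induction n)
  case (Suc n)
  have IH: "pure (vy ` (\<beta> \<inter> {..<n}) \<union> S) (plm n \<beta> b)" using Suc by (auto simp: lessThan_Suc)
  moreover have "vy n \<notin> vy ` (\<beta> \<inter> {..<n}) \<union> S" using Suc.prems by (auto simp: lessThan_Suc)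
  ultimately show ?case using pure_lm[OF IH, of "vy n"] assms(2)
    by (simp add: clm_def Int_lessThan_Suc)
qed (use assms in simp)

lemma prv_mem:
  assumes "f \<in> M1 TYPE('k::field) t"
  shows "prv n \<beta> f \<in> M1 TYPE('k) (t + (\<Sum>i<n. real (glen i)))"
proof (induction n)
  case (Suc n)
  have "mul (Vg n) (prv n \<beta> f) \<in> M1 TYPE('k) (real (glen n) + (t + (\<Sum>i<n. real (glen i))))"
    by (rule P1.mul[OF Vg_mem Suc])
  moreover have "prv n \<beta> f \<in> M1 TYPE('k) (real (glen n) + (t + (\<Sum>i<n. real (glen i))))"
    by (rule subsetD[OF pspan_mono Suc]) simp
  ultimately show ?case by (simp add: algebra_simps)
qed (use assms in simp)

lemma lead_Vg: "lead 1 (Vg m) (lm (vy m) (mono_at {}))"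
proof -
  have 0: "lead 0 (mono_at {} :: pvar set \<Rightarrow> 'a) (mono_at {})"
    by (auto simp: lead_def mono_at_def split: if_splits)
  have "low (0 + 1 + 1) (lm (vx m) (lm (vx (Suc m)) (Vg (m + 3) :: pvar set \<Rightarrow> 'a)))"
    by (intro low_lm) (simp add: low_def)
  hence "low (1 + 1) (lm (vx m) (lm (vx (Suc m)) (Vg (m + 3) :: pvar set \<Rightarrow> 'a)))" by simp
  from lead_add_low[OF _ this] lead_lm[OF 0, of "vy m"] show ?thesis
    by (subst Vg_rec) simp
qed

lemma (in cubic_root) pspan_lower:
  "\<exists>B. fs.independent B \<and> 16 ^ r \<le> card B \<and> B \<subseteq> M1 TYPE('k::field) (2 * l ^ 5 * l ^ (2 * r))"
proof -
  let ?m = "2 * r + 4"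
  define I where "I = Pow (qset r) \<times> Pow {..<?m}"
  define F :: "nat set \<times> nat set \<Rightarrow> pvar set \<Rightarrow> 'k"
    where "F = (\<lambda>(\<alpha>, \<beta>). prv ?m \<beta> (qop vx r \<alpha> (Vg ?m)))"
  define L :: "nat set \<times> nat set \<Rightarrow> pvar set \<Rightarrow> 'k"
    where "L = (\<lambda>(\<alpha>, \<beta>). plm ?m \<beta> (qop vx r \<alpha> (lm (vy ?m) (mono_at {}))))"
  define T where "T = (\<lambda>(\<alpha>, \<beta>). vy ` \<beta> \<union> (vx ` \<alpha> \<union> {vy ?m}))"
  \<comment> \<open>The degree of the leading monomial x^\<alpha> y^\<beta> y_{2r+4}.\<close>
  define rk where "rk = (\<lambda>(\<alpha>, \<beta>). 1 + int (card (\<alpha> \<inter> qset r)) + int (card (\<beta> \<inter> {..<?m})))"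
  have I: "finite I" "16 ^ r \<le> card I" using qop_index_card[of r] by (auto simp: I_def)
  have lead: "lead (rk i) (F i) (L i)" for i
    unfolding rk_def F_def L_def
    by (cases i) (auto intro!: lead_prv lead_qop lead_Vg Hs_qop Hs_Vg)
  have pure: "pure (T i) (L i)" if i: "i \<in> I" for i
  proof -
    obtain \<alpha> \<beta> where ab: "i = (\<alpha>, \<beta>)" "\<alpha> \<subseteq> qset r" "\<beta> \<subseteq> {..<?m}" using i by (auto simp: I_def)
    have "pure {} (mono_at {} :: pvar set \<Rightarrow> 'k)"
      unfolding pure_def by (intro exI[of _ 1]) (simp add: fscale_def fun_eq_iff)
    hence "pure {vy ?m} (lm (vy ?m) (mono_at {} :: pvar set \<Rightarrow> 'k))" using pure_lm by fastforce
    hence "pure (vx ` (\<alpha> \<inter> qset r) \<union> {vy ?m}) (qop vx r \<alpha> (lm (vy ?m) (mono_at {} :: pvar set \<Rightarrow> 'k)))"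
      by (rule pure_qop[OF _ _ _ _ ab(2) order_refl]) (auto simp: inj_on_def)
    hence "pure (vy ` (\<beta> \<inter> {..<?m}) \<union> (vx ` (\<alpha> \<inter> qset r) \<union> {vy ?m}))
       (plm ?m \<beta> (qop vx r \<alpha> (lm (vy ?m) (mono_at {} :: pvar set \<Rightarrow> 'k))))"
      by (rule pure_plm) (auto intro: finite_subset)
    thus ?thesis using ab by (simp add: T_def L_def Int_absorb2)
  qed
  have injT: "i = j" if "T i = T j" "i \<in> I" "j \<in> I" for i j
  proof -
    have "{a. vx a \<in> T (\<alpha>, \<beta>)} = \<alpha>" "{a. vy a \<in> T (\<alpha>, \<beta>)} - {?m} = \<beta>" if "(\<alpha>, \<beta>) \<in> I" for \<alpha> \<beta>
      using that by (auto simp: T_def I_def)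
    thus ?thesis using that by (metis surj_pair)
  qed
  have cT: "finite (T i)" "int (card (T i)) = rk i" if "i \<in> I" for i
    using lead[of i] pure_nonzero[OF pure[OF that], of "T i"] by (auto simp: lead_def)
  have diag: "F i (T i) \<noteq> 0" if "i \<in> I" for i
    using lead[of i] cT[OF that] pure_nonzero[OF pure[OF that], of "T i"] by (simp add: lead_def)
  \<comment> \<open>In degrees up to \<open>rk i\<close> only the leading part of \<open>F i\<close>
    is visible, and that is a single monomial.\<close>
  have tri: "rk i < rk j" if "i \<in> I" "j \<in> I" "F i (T j) \<noteq> 0" "i \<noteq> j" for i j
  proof (rule ccontr)
    assume "\<not> rk i < rk j"
    hence "F i (T j) = L i (T j)" using lead[of i] cT[OF that(2)] by (simp add: lead_def)
    hence "T j = T i" using pure_nonzero[OF pure[OF that(1)], of "T j"] that(3) by simp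
    thus False using injT[OF _ that(2,1)] that(4) by simp
  qed
  note ind = triangular_independent[of I F T rk, OF I(1) diag tri]
  have mem: "F i \<in> M1 TYPE('k) (2 * l ^ 5 * l ^ (2 * r))" for i
  proof -
    obtain \<alpha> \<beta> where i: "i = (\<alpha>, \<beta>)" by force
    have "F i \<in> M1 TYPE('k) (real (glen ?m) + (\<Sum>i<?m. real (glen i)))"
      unfolding i F_def by (simp only: prod.case) (rule prv_mem[OF qop_mem])
    \<comment> \<open>The letters are at most those of V_0, ..., V_{2r+4} taken once each. Then
      \<open>sum_pow\<close> gives 2 l^(2r+5), whence the constant 2 l^5.\<close>
    moreover have "real (glen ?m) + (\<Sum>i<?m. real (glen i)) \<le> (\<Sum>i<Suc ?m. l ^ i)"
      using glen_le[of ?m] sum_mono[of "{..<?m}" "\<lambda>i. real (glen i)" "\<lambda>i. l ^ i", OF glen_le]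
      unfolding sum.lessThan_Suc by linarith
    moreover have "\<dots> \<le> 2 * l ^ 5 * l ^ (2 * r)"
      using sum_pow[of "Suc ?m"] by (simp add: power_add numeral_eq_Suc algebra_simps)
    ultimately show ?thesis using pspan_mono by (meson in_mono order_trans)
  qed
  show ?thesis
    using ind card_image[OF ind(1)] I(2) mem by (intro exI[of _ "F ` I"]) auto
qed

section \<open>Coefficients with respect to \<open>x^\<alpha> y^\<beta>\<close>\<close>

lemma sg_card:
  assumes "finite A" "finite B"
  shows "sg A B = (-1) ^ card {(a, b). a \<in> A \<and> b \<in> B \<and> b < a}"
proof -
  have "sg A B = (\<Prod>(a, b)\<in>A \<times> B. if b < a then -1 else (1::'b))"
    unfolding sg_def by (rule prod.cartesian_product)
  also have "\<dots> = (\<Prod>p\<in>A \<times> B. if snd p < fst p then -1 else 1)"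
    by (rule prod.cong) auto
  also have "\<dots> = (-1) ^ card (A \<times> B \<inter> {p. snd p < fst p})"
    using assms by (simp add: prod.If_cases)
  also have "A \<times> B \<inter> {p. snd p < fst p} = {(a, b). a \<in> A \<and> b \<in> B \<and> b < a}" by auto
  finally show ?thesis .
qed

lemma sg_inv_count: "finite A \<Longrightarrow> finite B \<Longrightarrow> sg A B = (-1) ^ inv_count A B"
  by (simp add: sg_card inv_count_def)

lemma sg_single: "finite B \<Longrightarrow> sg {z} B = (-1) ^ card {b \<in> B. b < z}"
proof -
  assume "finite B"
  moreover have "{(a, b). a \<in> {z} \<and> b \<in> B \<and> b < a} = Pair z ` {b \<in> B. b < z}" by auto
  moreover have "card (Pair z ` {b \<in> B. b < z}) = card {b \<in> B. b < z}"
    by (rule card_image) (auto simp: inj_on_def)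
  ultimately show ?thesis by (simp add: sg_card)
qed

section \<open>Pairs of index sets as sets of variables\<close>

definition enc :: "nat set \<times> nat set \<Rightarrow> pvar set" where
  "enc m = vx ` fst m \<union> vy ` snd m"

definition dec :: "pvar set \<Rightarrow> nat set \<times> nat set" where
  "dec S = ({i. vx i \<in> S}, {i. vy i \<in> S})"

lemma dec_enc [simp]: "dec (enc m) = m"
  by (auto simp: dec_def enc_def prod_eq_iff)

lemma enc_dec [simp]: "enc (dec S) = S"
proof (rule set_eqI)
  fix v show "v \<in> enc (dec S) \<longleftrightarrow> v \<in> S" by (cases v; cases "fst v") (auto simp: dec_def enc_def)
qed

lemma enc_mem [simp]: "vx i \<in> enc (\<alpha>, \<beta>) \<longleftrightarrow> i \<in> \<alpha>" "vy i \<in> enc (\<alpha>, \<beta>) \<longleftrightarrow> i \<in> \<beta>"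
  by (auto simp: enc_def)

lemma finite_enc [simp]: "finite (enc (\<alpha>, \<beta>)) \<longleftrightarrow> finite \<alpha> \<and> finite \<beta>"
  by (auto simp: enc_def inj_on_def dest!: finite_imageD)

lemma card_enc: "finite \<alpha> \<Longrightarrow> finite \<beta> \<Longrightarrow> card (enc (\<alpha>, \<beta>)) = card \<alpha> + card \<beta>"
  unfolding enc_def by (subst card_Un_disjoint) (auto simp: card_image inj_on_def)

lemma enc_inj: "enc m = enc m' \<longleftrightarrow> m = m'"
  by (metis dec_enc)

lemma enc_insert: "insert (vx i) (enc (\<alpha>, \<beta>)) = enc (insert i \<alpha>, \<beta>)"
  "insert (vy i) (enc (\<alpha>, \<beta>)) = enc (\<alpha>, insert i \<beta>)"
  by (auto simp: enc_def)

lemma enc_diff: "enc (\<rho>, \<sigma>) - enc (\<alpha>, \<beta>) = enc (\<rho> - \<alpha>, \<sigma> - \<beta>)"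
  by (auto simp: enc_def)

definition Phi :: "'k hser \<Rightarrow> pvar set \<Rightarrow> 'k::field" where
  "Phi f S = f (dec S)"

definition Psi :: "(pvar set \<Rightarrow> 'k::field) \<Rightarrow> 'k hser" where
  "Psi F m = F (enc m)"

lemma Phi_Psi [simp]: "Phi (Psi F) = F" and Psi_Phi [simp]: "Psi (Phi f) = f"
  by (simp_all add: Phi_def Psi_def fun_eq_iff)

lemma Phi_enc: "Phi f (enc m) = f m"
  by (simp add: Phi_def)

lemma Phi_eqI: "(\<And>\<alpha> \<beta>. f (\<alpha>, \<beta>) = F (enc (\<alpha>, \<beta>))) \<Longrightarrow> Phi f = F"
proof
  fix S assume *: "\<And>\<alpha> \<beta>. f (\<alpha>, \<beta>) = F (enc (\<alpha>, \<beta>))"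
  have "Phi f S = f (fst (dec S), snd (dec S))" by (simp add: Phi_def)
  also have "\<dots> = F S" unfolding * by simp
  finally show "Phi f S = F S" .
qed

text \<open>Inversions occur among the x, among the y, and between every y on the left and every x
  on the right; the last kind gives the product of cardinalities.\<close>

lemma sg_enc:
  assumes "finite \<alpha>" "finite \<beta>" "finite \<gamma>" "finite \<delta>"
  shows "sg (enc (\<alpha>, \<beta>)) (enc (\<gamma>, \<delta>)) = (-1) ^ (card \<beta> * card \<gamma> + inv_count \<alpha> \<gamma> + inv_count \<beta> \<delta>)"
proof -
  let ?A = "{(a, b). a \<in> \<alpha> \<and> b \<in> \<gamma> \<and> b < a}" and ?B = "{(a, b). a \<in> \<beta> \<and> b \<in> \<delta> \<and> b < a}"
  let ?f = "\<lambda>(a, b). (vx a, vx b)" and ?g = "\<lambda>(a, b). (vy a, vy b)" and ?h = "\<lambda>(a, b). (vy a, vx b)"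
  have fin: "finite ?A" "finite ?B"
    by (rule finite_subset[of _ "\<alpha> \<times> \<gamma>"], use assms in auto)
       (rule finite_subset[of _ "\<beta> \<times> \<delta>"], use assms in auto)
  have e: "{(a, b). a \<in> enc (\<alpha>, \<beta>) \<and> b \<in> enc (\<gamma>, \<delta>) \<and> b < a} = ?h ` (\<beta> \<times> \<gamma>) \<union> (?f ` ?A \<union> ?g ` ?B)"
    by (auto simp: enc_def image_iff)
  have c: "card (?h ` (\<beta> \<times> \<gamma>)) = card \<beta> * card \<gamma>" "card (?f ` ?A) = inv_count \<alpha> \<gamma>"
    "card (?g ` ?B) = inv_count \<beta> \<delta>"
    unfolding inv_count_def card_cartesian_product[symmetric] by (rule card_image, force simp: inj_on_def)+
  have "card (?h ` (\<beta> \<times> \<gamma>) \<union> (?f ` ?A \<union> ?g ` ?B)) = card \<beta> * card \<gamma> + (inv_count \<alpha> \<gamma> + inv_count \<beta> \<delta>)"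
  proof -
    have f: "finite (?h ` (\<beta> \<times> \<gamma>))" "finite (?f ` ?A)" "finite (?g ` ?B)" using fin assms by auto
    have d: "?h ` (\<beta> \<times> \<gamma>) \<inter> (?f ` ?A \<union> ?g ` ?B) = {}" "?f ` ?A \<inter> ?g ` ?B = {}" by auto
    show ?thesis unfolding card_Un_disjoint[OF f(1) finite_UnI[OF f(2,3)] d(1)]
      card_Un_disjoint[OF f(2,3) d(2)] c ..
  qed
  thus ?thesis using assms by (simp add: sg_card e add.assoc)
qed

lemma Phi_hmul: "Phi (hmul f g) = mul (Phi f) (Phi g)"
proof (rule Phi_eqI)
  fix \<rho> \<sigma> :: "nat set"
  show "hmul f g (\<rho>, \<sigma>) = mul (Phi f) (Phi g) (enc (\<rho>, \<sigma>))"
  proof (cases "finite \<rho> \<and> finite \<sigma>")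
    case True
    have fs: "finite \<alpha>" "finite \<beta>" "finite (\<rho> - \<alpha>)" "finite (\<sigma> - \<beta>)" if "\<alpha> \<subseteq> \<rho>" "\<beta> \<subseteq> \<sigma>" for \<alpha> \<beta>
      using True that finite_subset by auto
    have "hmul f g (\<rho>, \<sigma>) = (\<Sum>(\<alpha>, \<beta>)\<in>Pow \<rho> \<times> Pow \<sigma>.
        (-1) ^ (card \<beta> * card (\<rho> - \<alpha>) + inv_count \<alpha> (\<rho> - \<alpha>) + inv_count \<beta> (\<sigma> - \<beta>))
        * f (\<alpha>, \<beta>) * g (\<rho> - \<alpha>, \<sigma> - \<beta>))"
      using True by (simp add: hmul_def sum.cartesian_product)
    also have "\<dots> = (\<Sum>A\<in>Pow (enc (\<rho>, \<sigma>)). sg A (enc (\<rho>, \<sigma>) - A) * Phi f A * Phi g (enc (\<rho>, \<sigma>) - A))"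
    proof (rule sum.reindex_bij_witness[of _ dec enc])
      fix p assume "p \<in> Pow \<rho> \<times> Pow \<sigma>"
      then obtain \<alpha> \<beta> where p: "p = (\<alpha>, \<beta>)" "\<alpha> \<subseteq> \<rho>" "\<beta> \<subseteq> \<sigma>" by auto
      show "dec (enc p) = p" by simp
      show "enc p \<in> Pow (enc (\<rho>, \<sigma>))" using p by (auto simp: enc_def)
      show "sg (enc p) (enc (\<rho>, \<sigma>) - enc p) * Phi f (enc p) * Phi g (enc (\<rho>, \<sigma>) - enc p) =
         (case p of (\<alpha>, \<beta>) \<Rightarrow> (-1) ^ (card \<beta> * card (\<rho> - \<alpha>) + inv_count \<alpha> (\<rho> - \<alpha>) + inv_count \<beta> (\<sigma> - \<beta>))
        * f (\<alpha>, \<beta>) * g (\<rho> - \<alpha>, \<sigma> - \<beta>))"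
        unfolding p(1) enc_diff Phi_enc sg_enc[OF fs[OF p(2,3)]] by simp
    next
      fix A assume "A \<in> Pow (enc (\<rho>, \<sigma>))"
      hence "v \<in> enc (\<rho>, \<sigma>)" if "v \<in> A" for v using that by blast
      hence "i \<in> \<rho>" if "vx i \<in> A" for i using that enc_mem(1) by blast
      moreover have "i \<in> \<sigma>" if "vy i \<in> A" for i
        using that \<open>A \<in> Pow (enc (\<rho>, \<sigma>))\<close> enc_mem(2) by blast
      ultimately show "dec A \<in> Pow \<rho> \<times> Pow \<sigma>" by (auto simp: dec_def)
      show "enc (dec A) = A" by simp
    qed
    finally show ?thesis using True by (simp add: mul_def)
  qed (auto simp: hmul_def mul_def)
qed

lemma Phi_Vser: "Phi (Vser i) = Vg i"
proof (rule Phi_eqI)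
  fix \<alpha> \<beta>
  have "enc (\<alpha>, \<beta>) = vx ` pairset i k \<union> {vy (i + 3 * k)} \<longleftrightarrow> \<alpha> = pairset i k \<and> \<beta> = {i + 3 * k}" for k
    using enc_inj[of "(\<alpha>, \<beta>)" "(pairset i k, {i + 3 * k})"] by (simp add: enc_def)
  thus "Vser i (\<alpha>, \<beta>) = Vg i (enc (\<alpha>, \<beta>))" by (simp add: Vser_def Vg_def)
qed

lemma sg_vx: "finite \<alpha> \<Longrightarrow> finite \<beta> \<Longrightarrow> sg {vx i} (enc (\<alpha>, \<beta>)) = (-1) ^ card {a \<in> \<alpha>. a < i}"
proof -
  assume f: "finite \<alpha>" "finite \<beta>"
  have "{b \<in> enc (\<alpha>, \<beta>). b < vx i} = vx ` {a \<in> \<alpha>. a < i}" by (auto simp: enc_def)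
  moreover have "card (vx ` {a \<in> \<alpha>. a < i}) = card {a \<in> \<alpha>. a < i}"
    by (rule card_image) (auto simp: inj_on_def)
  ultimately show ?thesis using f by (simp add: sg_single)
qed

lemma sg_vy: "finite \<alpha> \<Longrightarrow> finite \<beta> \<Longrightarrow> sg {vy i} (enc (\<alpha>, \<beta>)) = (-1) ^ (card \<alpha> + card {b \<in> \<beta>. b < i})"
proof -
  assume f: "finite \<alpha>" "finite \<beta>"
  have "{b \<in> enc (\<alpha>, \<beta>). b < vy i} = enc (\<alpha>, {b \<in> \<beta>. b < i})" by (auto simp: enc_def)
  thus ?thesis using f by (simp add: sg_single card_enc)
qed

lemma card_split: "finite \<beta> \<Longrightarrow> i \<notin> \<beta> \<Longrightarrow> card \<beta> = card {b \<in> \<beta>. b < i} + card {b \<in> \<beta>. i < (b::nat)}"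
proof -
  assume b: "finite \<beta>" "i \<notin> \<beta>"
  have "b < i \<or> i < b" if "b \<in> \<beta>" for b using that b(2) by (metis linorder_neqE_nat)
  hence "\<beta> = {b \<in> \<beta>. b < i} \<union> {b \<in> \<beta>. i < b}" by blast
  moreover have "card ({b \<in> \<beta>. b < i} \<union> {b \<in> \<beta>. i < b}) = card {b \<in> \<beta>. b < i} + card {b \<in> \<beta>. i < b}"
    using b(1) by (intro card_Un_disjoint) auto
  ultimately show ?thesis by metis
qed

text \<open>A right derivative takes the variable out at the other end. Compared with the left
  derivative it has passed all remaining variables, which is the effect of \<open>gi\<close>. The
  hypothesis bridges a difference in conventions: \<open>der\<close> tests for finiteness, the given
  derivatives do not.\<close>

lemma Phi_derivs:
  assumes "fin_supp (Phi f)"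
  shows "Phi (ldx i f) = der (vx i) (Phi f)" "Phi (ldy i f) = der (vy i) (Phi f)"
    "Phi (rdx i f) = gi (der (vx i) (Phi f))" "Phi (rdy i f) = gi (der (vy i) (Phi f))"
proof -
  have z: "f (\<alpha>, \<beta>) = 0" if "\<not> (finite \<alpha> \<and> finite \<beta>)" for \<alpha> \<beta>
    using assms that unfolding fin_supp_def by (metis Phi_enc finite_enc)
  have inf: "der z (Phi f) (enc (\<alpha>, \<beta>)) = 0" if "\<not> (finite \<alpha> \<and> finite \<beta>)" for z \<alpha> \<beta>
    using that by (intro der_inf) simp
  have dx: "der (vx i) (Phi f) (enc (\<alpha>, \<beta>))
      = (if i \<notin> \<alpha> then (-1) ^ card {a \<in> \<alpha>. a < i} * f (insert i \<alpha>, \<beta>) else 0)" if "finite \<alpha>" "finite \<beta>" for \<alpha> \<beta>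
    using that by (simp add: der_def sg_vx enc_insert Phi_enc)
  have dy: "der (vy i) (Phi f) (enc (\<alpha>, \<beta>))
      = (if i \<notin> \<beta> then (-1) ^ (card \<alpha> + card {b \<in> \<beta>. b < i}) * f (\<alpha>, insert i \<beta>) else 0)" if "finite \<alpha>" "finite \<beta>" for \<alpha> \<beta>
    using that by (simp add: der_def sg_vy enc_insert Phi_enc)
  have m1: "(-1::'a) ^ n * ((-1) ^ n * c) = c" for n c by (simp flip: mult.assoc power_add)
  show "Phi (ldx i f) = der (vx i) (Phi f)"
  proof (rule Phi_eqI)
    fix \<alpha> \<beta> show "ldx i f (\<alpha>, \<beta>) = der (vx i) (Phi f) (enc (\<alpha>, \<beta>))"
      by (cases "finite \<alpha> \<and> finite \<beta>") (auto simp: ldx_def dx inf z)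
  qed
  show "Phi (ldy i f) = der (vy i) (Phi f)"
  proof (rule Phi_eqI)
    fix \<alpha> \<beta> show "ldy i f (\<alpha>, \<beta>) = der (vy i) (Phi f) (enc (\<alpha>, \<beta>))"
      by (cases "finite \<alpha> \<and> finite \<beta>") (auto simp: ldy_def dy inf z)
  qed
  show "Phi (rdx i f) = gi (der (vx i) (Phi f))"
  proof (rule Phi_eqI)
    fix \<alpha> \<beta> show "rdx i f (\<alpha>, \<beta>) = gi (der (vx i) (Phi f)) (enc (\<alpha>, \<beta>))"
    proof (cases "finite \<alpha> \<and> finite \<beta> \<and> i \<notin> \<alpha>")
      case True
      thus ?thesis using card_split[of \<alpha> i]
        by (simp add: rdx_def gi_def dx card_enc power_add m1 mult.assoc mult.left_commute)
    qed (auto simp: rdx_def gi_def der_def z)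
  qed
  show "Phi (rdy i f) = gi (der (vy i) (Phi f))"
  proof (rule Phi_eqI)
    fix \<alpha> \<beta> show "rdy i f (\<alpha>, \<beta>) = gi (der (vy i) (Phi f)) (enc (\<alpha>, \<beta>))"
    proof (cases "finite \<alpha> \<and> finite \<beta> \<and> i \<notin> \<beta>")
      case True
      thus ?thesis using card_split[of \<beta> i]
        by (simp add: rdy_def gi_def dy card_enc power_add m1 mult.assoc mult.left_commute)
    qed (auto simp: rdy_def gi_def der_def z)
  qed
qed

lemma Phi_plus: "Phi (f + g) = Phi f + Phi g"
  by (simp add: Phi_def fun_eq_iff plus_fun_apply)

lemma Phi_bterm:
  assumes "fin_supp (Phi f)" "fin_supp (Phi g)"
  shows "Phi (bterm f g i) = pt (Phi f) (Phi g) (vx i) + pt (Phi f) (Phi g) (vy i)"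
  unfolding bterm_def Phi_plus Phi_hmul Phi_derivs[OF assms(1)] Phi_derivs[OF assms(2)] pt_def by simp

lemma bterm_enc:
  assumes "fin_supp (Phi f)" "fin_supp (Phi g)"
  shows "bterm f g i m = pt (Phi f) (Phi g) (vx i) (enc m) + pt (Phi f) (Phi g) (vy i) (enc m)"
  using fun_cong[OF Phi_bterm[OF assms, of i], of "enc m"] by (simp add: Phi_enc plus_fun_apply)

lemma Phi_hbr:
  assumes "Phi f \<in> Hs" "Phi g \<in> Hs"
  shows "Phi (hbr f g) = br (Phi f) (Phi g)"
proof (rule Phi_eqI)
  fix \<rho> \<sigma> :: "nat set"
  let ?S = "enc (\<rho>, \<sigma>)"
  note b = bterm_enc[OF fin_supp_Hs[OF assms(1)] fin_supp_Hs[OF assms(2)], of _ "(\<rho>, \<sigma>)"]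
  show "hbr f g (\<rho>, \<sigma>) = br (Phi f) (Phi g) ?S"
  proof (cases "finite ?S")
    case True
    obtain N where N: "adm N (Phi f)" "adm N (Phi g)" using adm_common[OF assms] .
    obtain n where n: "n \<ge> N" "\<And>v. v \<in> ?S \<Longrightarrow> snd v < n" using bound_exists[OF True, of N] by blast
    have z: "pt (Phi f) (Phi g) v ?S = 0" if "\<not> snd v < n" for v
      using pt_support[OF N n] that by (cases v) fastforce
    \<comment> \<open>\<open>hbr\<close> groups the two conjugate terms of index i, which may
      cancel, so the index sets of the two sums differ. Below \<open>n\<close> both are the same
      finite sum.\<close>
    have "hbr f g (\<rho>, \<sigma>) = (\<Sum>i<n. bterm f g i (\<rho>, \<sigma>))"
      unfolding hbr_def by (rule sum.mono_neutral_left) (use z in \<open>auto simp: b intro: ccontr\<close>)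
    also have "\<dots> = br_upto n (Phi f) (Phi g) ?S"
      by (simp add: b br_upto_split sum.distrib plus_fun_apply sum_fun_apply)
    finally show ?thesis using br_eq_upto[OF N n] by simp
  next
    case False
    have "bterm f g i (\<rho>, \<sigma>) = 0" for i using False by (simp add: b pt_def)
    thus ?thesis using False by (simp add: hbr_def)
  qed
qed

lemma hodd_iff: assumes "fin_supp (Phi f)" shows "hodd f \<longleftrightarrow> hom False (Phi f)"
proof -
  have z: "finite \<alpha> \<and> finite \<beta>" if "f (\<alpha>, \<beta>) \<noteq> 0" for \<alpha> \<beta>
    using assms that unfolding fin_supp_def by (metis Phi_enc finite_enc)
  have "hom False (Phi f) \<longleftrightarrow> (\<forall>m. f m \<noteq> 0 \<longrightarrow> odd (card (enc m)))"
    unfolding hom_def by (metis Phi_enc enc_dec)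
  also have "\<dots> \<longleftrightarrow> hodd f"
    unfolding hodd_def using z by (auto simp: card_enc)
  finally show ?thesis ..
qed

lemma scode_inj: "finite A \<Longrightarrow> finite B \<Longrightarrow> scode A = scode B \<Longrightarrow> A = B"
  using inj_on_set_encode unfolding inj_on_def scode_def set_encode_def by simp

definition before :: "pvar set \<Rightarrow> pvar set \<Rightarrow> bool" where
  "before P Q \<longleftrightarrow> mless (dec P) (dec Q)"

text \<open>\<open>scode\<close> reads a finite set as a binary number and is injective only on
  finite sets.\<close>

lemma before_total: assumes "finite P" "finite Q"
  shows "before P Q \<or> before Q P \<longleftrightarrow> P \<noteq> Q" "\<not> (before P Q \<and> before Q P)"
proof -
  have f: "finite (fst (dec P))" "finite (snd (dec P))" "finite (fst (dec Q))" "finite (snd (dec Q))"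
    using assms finite_enc[of "fst (dec P)" "snd (dec P)"] finite_enc[of "fst (dec Q)" "snd (dec Q)"] by auto
  have "P = Q" if "scode (fst (dec P)) = scode (fst (dec Q))" "scode (snd (dec P)) = scode (snd (dec Q))"
    using scode_inj[OF f(1,3) that(1)] scode_inj[OF f(2,4) that(2)] by (metis enc_dec prod_eqI)
  thus "before P Q \<or> before Q P \<longleftrightarrow> P \<noteq> Q" unfolding before_def mless_def by (metis nat_neq_iff)
  show "\<not> (before P Q \<and> before Q P)" unfolding before_def mless_def by auto
qed

definition comp_at :: "(pvar set \<Rightarrow> 'k::field) \<Rightarrow> pvar set \<Rightarrow> pvar set \<Rightarrow> 'k" where
  "comp_at F P = fscale (F P) (mono_at P)"

lemma comp_at_nonzero: "comp_at F P R \<noteq> 0 \<Longrightarrow> R = P \<and> F P \<noteq> 0"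
  by (auto simp: comp_at_def fscale_def mono_at_def split: if_splits)

lemma adm_comp_at: "adm N F \<Longrightarrow> adm N (comp_at F P)"
  unfolding adm_def using comp_at_nonzero by metis

lemma pt_sum_left: "pt (\<Sum>a\<in>A. u a) h v = (\<Sum>a\<in>A. pt (u a) h v)"
  and pt_sum_right: "pt h (\<Sum>a\<in>A. u a) v = (\<Sum>a\<in>A. pt h (u a) v)"
  by (induction A rule: infinite_finite_induct; simp add: pt_lin)+

text \<open>In characteristic 2 the formal square has the closed form
  \<open>\<Sum>_i (\<partial>f/\<partial>y_i)(\<partial>f/\<partial>x_i)\<close>: the two halves of every bracket \<open>{m, m'}\<close> with \<open>m < m'\<close>
  become the terms of this double sum off the diagonal, and the diagonal terms vanish for odd \<open>f\<close>.\<close>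
lemma Phi_hsq:
  fixes f :: "'k::field hser"
  assumes c2: "CHAR('k) = 2" and H: "Phi f \<in> Hs" and odd: "hom False (Phi f)"
  shows "Phi (hsq f) = sq (Phi f)"
proof (rule Phi_eqI)
  fix \<rho> \<sigma> :: "nat set"
  define S where "S = enc (\<rho>, \<sigma>)"
  define F where "F = Phi f"
  obtain N where N: "adm N F" using H unfolding Hs_def F_def by blast
  have hb: "hbr (hmono p) (hmono q :: 'k hser) (\<rho>, \<sigma>) = br (mono_at (enc p)) (mono_at (enc q)) S"
    if "finite (enc p)" "finite (enc q)" for p q
  proof -
    have 1: "Phi (hmono r :: 'k hser) = mono_at (enc r)" for r
      by (simp add: Phi_def hmono_def mono_at_def fun_eq_iff) (metis dec_enc enc_dec)
    have M: "mono_at R \<in> (Hs :: (pvar set \<Rightarrow> 'k) set)" if R: "finite R" for R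
    proof -
      obtain n where n: "\<And>v. v \<in> R \<Longrightarrow> snd v < n" using bound_exists[OF R, of 0] by blast
      have "i < n" if "vx i \<in> R" for i using n[OF that] by simp
      hence "adm n (mono_at R :: pvar set \<Rightarrow> 'k)" using R by (auto simp: adm_def mono_at_def split: if_splits)
      thus ?thesis unfolding Hs_def by blast
    qed
    have "Phi (hbr (hmono p) (hmono q :: 'k hser)) = br (mono_at (enc p)) (mono_at (enc q))"
      using Phi_hbr[of "hmono p :: 'k hser" "hmono q"] M[OF that(1)] M[OF that(2)] by (simp only: 1)
    from fun_cong[OF this, of S] show ?thesis unfolding S_def Phi_enc .
  qed
  show "hsq f (\<rho>, \<sigma>) = sq F S"
  proof (cases "finite S")
    case False
    have h0: "hbr (hmono p) (hmono q) (\<rho>, \<sigma>) = (0::'k)" if "f p \<noteq> 0" "f q \<noteq> 0" for p q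
    proof -
      have "finite (enc p)" "finite (enc q)"
        using that admD(1)[OF N, of "enc p"] admD(1)[OF N, of "enc q"] by (auto simp: F_def Phi_enc)
      from hb[OF this] show ?thesis using False by simp
    qed
    have "sqterm f p (\<rho>, \<sigma>) = 0" for p
      unfolding sqterm_def by (cases "f (fst p) = 0 \<or> f (snd p) = 0") (simp_all add: h0)
    thus ?thesis using False by (simp add: hsq_def)
  next
    case True
    obtain n where n: "n \<ge> N" "\<And>v. v \<in> S \<Longrightarrow> snd v < n" using bound_exists[OF True, of N] by blast
    \<comment> \<open>The monomials in variables of index below \<open>n\<close>. By
      \<open>ZI\<close> no others contribute to the coefficient at \<open>S\<close>, which makes
      every sum finite.\<close>
    define Z where "Z = Pow (UNIV \<times> {..<n} :: pvar set)"
    have Z: "finite Z" "\<And>P. P \<in> Z \<Longrightarrow> finite P" unfolding Z_def by (auto intro: finite_subset[of _ "UNIV \<times> {..<n}"])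
    define u where "u = (\<lambda>P Q. \<Sum>i<n. pt (comp_at F P) (comp_at F Q) (vx i) S)"
    note C = adm_comp_at[OF N]
    have HC: "comp_at F P \<in> Hs" for P using C unfolding Hs_def by blast
    have ZI: "P \<in> Z" "Q \<in> Z" if ne: "pt (comp_at F P) (comp_at F Q) v S \<noteq> 0" for P Q v
    proof -
      obtain A where A: "A \<subseteq> S" "comp_at F P (insert (conj_var v) A) \<noteq> 0" "comp_at F Q (insert v (S - A)) \<noteq> 0"
        using ne by (rule pt_nonzeroD)
      have e: "insert (conj_var v) A = P" "insert v (S - A) = Q"
        using comp_at_nonzero[OF A(2)] comp_at_nonzero[OF A(3)] by auto
      have "snd v < n" using pt_support[OF C C n] ne by (cases v) fastforce
      moreover have "w = conj_var v \<or> w = v \<or> w \<in> S" if "w \<in> P \<union> Q" for w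
        using that A(1) unfolding e[symmetric] by blast
      ultimately have "snd w < n" if "w \<in> P \<union> Q" for w
        using that n(2) conj_var_simps(5) by metis
      hence "P \<union> Q \<subseteq> UNIV \<times> {..<n}" by (intro subsetI) (simp add: mem_Times_iff)
      thus "P \<in> Z" "Q \<in> Z" unfolding Z_def by blast+
    qed
    have bru: "br (comp_at F P) (comp_at F Q) S = u P Q + u Q P" for P Q
    proof -
      have "br (comp_at F P) (comp_at F Q) S = br_upto n (comp_at F P) (comp_at F Q) S"
        by (rule br_eq_upto[OF C C n])
      thus ?thesis unfolding br_upto_char2[OF c2] u_def plus_fun_apply sum_fun_apply .
    qed
    have st: "sqterm f p (\<rho>, \<sigma>) = (if before (enc (fst p)) (enc (snd p)) then u (enc (fst p)) (enc (snd p)) + u (enc (snd p)) (enc (fst p)) else 0)" for p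
    proof (cases "f (fst p) = 0 \<or> f (snd p) = 0")
      case True
      hence "comp_at F (enc (fst p)) = 0 \<or> comp_at F (enc (snd p)) = 0"
        by (auto simp: comp_at_def F_def Phi_enc)
      hence "u (enc (fst p)) (enc (snd p)) + u (enc (snd p)) (enc (fst p)) = 0"
        unfolding bru[symmetric] by (auto simp: zero_fun_apply)
      thus ?thesis using True by (auto simp: sqterm_def)
    next
      case False
      hence fin: "finite (enc (fst p))" "finite (enc (snd p))"
        using admD(1)[OF N, of "enc (fst p)"] admD(1)[OF N, of "enc (snd p)"] by (auto simp: F_def Phi_enc)
      have "mono_at R \<in> (Hs :: (pvar set \<Rightarrow> 'k) set)" if "F R \<noteq> 0" for R
      proof -
        have "mono_at R = fscale (inverse (F R)) (comp_at F R)"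
          using that by (simp add: comp_at_def fscale_def fun_eq_iff)
        thus ?thesis using Hs_scale[OF HC] by metis
      qed
      hence M: "mono_at (enc (fst p)) \<in> (Hs :: (pvar set \<Rightarrow> 'k) set)" "mono_at (enc (snd p)) \<in> (Hs :: (pvar set \<Rightarrow> 'k) set)"
        using False by (auto simp: F_def Phi_enc)
      have "br (comp_at F (enc (fst p))) (comp_at F (enc (snd p))) S
        = f (fst p) * f (snd p) * br (mono_at (enc (fst p))) (mono_at (enc (snd p))) S"
        unfolding comp_at_def F_def Phi_enc
        using br_bilinear(3)[OF M(1) Hs_0 Hs_scale[OF M(2)]] br_bilinear(4)[OF M(2) Hs_0 M(1)]
        by (simp add: fscale_def[of _ "br _ _"] mult.assoc) (simp add: fscale_def)
      thus ?thesis unfolding sqterm_def before_def dec_enc bru[symmetric] hb[OF fin] by simp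
    qed
    \<comment> \<open>Contracting a monomial with itself at index i and landing on a squarefree
      monomial is possible only for x_i y_i, which is even.\<close>
    have diag: "u P P = 0" for P
    proof -
      have "pt (comp_at F P) (comp_at F P) (vx i) S = 0" for i
      proof (rule ccontr)
        assume "pt (comp_at F P) (comp_at F P) (vx i) S \<noteq> 0"
        then obtain A where A: "A \<subseteq> S" "conj_var (vx i) \<notin> A" "vx i \<notin> S - A"
          "comp_at F P (insert (conj_var (vx i)) A) \<noteq> 0" "comp_at F P (insert (vx i) (S - A)) \<noteq> 0"
          by (rule pt_nonzeroD)
        have P: "insert (vy i) A = P" "insert (vx i) (S - A) = P" "F P \<noteq> 0"
          using comp_at_nonzero[OF A(4)] comp_at_nonzero[OF A(5)] by auto
        have "vx i \<in> P" unfolding P(2)[symmetric] by (rule insertI1)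
        hence "vx i \<in> A" unfolding P(1)[symmetric] by (rule insertE) simp_all
        moreover have "w = vx i" if "w \<in> A" for w
        proof -
          have "w \<in> P" unfolding P(1)[symmetric] using that by (rule insertI2)
          thus ?thesis unfolding P(2)[symmetric] using that by (elim insertE) simp_all
        qed
        ultimately have "A = {vx i}" by blast
        hence "card P = 2" unfolding P(1)[symmetric] by simp
        thus False using odd P(3) unfolding hom_def F_def by auto
      qed
      thus ?thesis by (simp add: u_def)
    qed
    define t where "t = (\<lambda>(P, Q). if before P Q then u P Q + u Q P else 0)"
    have "hsq f (\<rho>, \<sigma>) = (\<Sum>p | sqterm f p (\<rho>, \<sigma>) \<noteq> 0. sqterm f p (\<rho>, \<sigma>))" by (simp add: hsq_def)
    also have "\<dots> = (\<Sum>x | t x \<noteq> 0. t x)"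
    proof -
      have st': "sqterm f p (\<rho>, \<sigma>) = t (enc (fst p), enc (snd p))" for p
        unfolding st t_def prod.case ..
      show ?thesis
        by (rule sum.reindex_bij_witness[of _ "\<lambda>x. (dec (fst x), dec (snd x))"
              "\<lambda>p. (enc (fst p), enc (snd p))"]) (simp_all add: st')
    qed
    also have "\<dots> = (\<Sum>x\<in>Z \<times> Z. t x)"
    proof (rule sum.mono_neutral_left)
      show "{x. t x \<noteq> 0} \<subseteq> Z \<times> Z"
      proof
        fix x assume "x \<in> {x. t x \<noteq> 0}"
        then obtain P Q where x: "x = (P, Q)" and "u P Q + u Q P \<noteq> 0" by (cases x) (auto simp: t_def split: if_splits)
        hence "u P Q \<noteq> 0 \<or> u Q P \<noteq> 0" by auto
        then obtain i where "pt (comp_at F P) (comp_at F Q) (vx i) S \<noteq> 0 \<or> pt (comp_at F Q) (comp_at F P) (vx i) S \<noteq> 0"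
          unfolding u_def by (meson sum.not_neutral_contains_not_neutral)
        thus "x \<in> Z \<times> Z" unfolding x using ZI by blast
      qed
    qed (use Z in auto)
    also have "\<dots> = (\<Sum>P\<in>Z. \<Sum>Q\<in>Z. t (P, Q))" by (simp add: sum.cartesian_product)
    also have "\<dots> = (\<Sum>P\<in>Z. \<Sum>Q\<in>Z. (if before P Q then u P Q else 0)) + (\<Sum>P\<in>Z. \<Sum>Q\<in>Z. (if before P Q then u Q P else 0))"
      unfolding sum.distrib[symmetric] t_def by (intro sum.cong refl) auto
    also have "(\<Sum>P\<in>Z. \<Sum>Q\<in>Z. (if before P Q then u Q P else 0)) = (\<Sum>P\<in>Z. \<Sum>Q\<in>Z. (if before Q P then u P Q else 0))"
      by (rule sum.swap)
    also have "(\<Sum>P\<in>Z. \<Sum>Q\<in>Z. (if before P Q then u P Q else 0)) + \<dots> = (\<Sum>P\<in>Z. \<Sum>Q\<in>Z. u P Q)"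
      unfolding sum.distrib[symmetric]
    proof (intro sum.cong refl)
      fix P Q assume "P \<in> Z" "Q \<in> Z"
      from before_total[OF Z(2)[OF this(1)] Z(2)[OF this(2)]]
      show "(if before P Q then u P Q else 0) + (if before Q P then u P Q else 0) = u P Q"
        using diag[of P] by auto
    qed
    also have "\<dots> = (\<Sum>i<n. \<Sum>P\<in>Z. \<Sum>Q\<in>Z. pt (comp_at F P) (comp_at F Q) (vx i) S)"
      unfolding u_def by (rule trans[OF sum.cong[OF refl sum.swap] sum.swap])
    also have "\<dots> = (\<Sum>i<n. pt F F (vx i) S)"
    proof (rule sum.cong[OF refl])
      fix i assume i: "i \<in> {..<n}"
      \<comment> \<open>A finite sum of components that agrees with \<open>F\<close> on every set
        entering the coefficient at \<open>S\<close>, so bilinearity can be applied.\<close>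
      define F' where "F' = (\<Sum>P\<in>Z. comp_at F P)"
      have F': "F' R = F R" if "R \<in> Z" for R
      proof -
        have "F' R = (\<Sum>P\<in>Z. if R = P then F R else 0)"
          unfolding F'_def sum_fun_apply by (rule sum.cong) (auto simp: comp_at_def fscale_def mono_at_def)
        thus ?thesis using that Z(1) by (simp add: sum.delta)
      qed
      have "(\<Sum>P\<in>Z. \<Sum>Q\<in>Z. pt (comp_at F P) (comp_at F Q) (vx i) S) = pt F' F' (vx i) S"
        unfolding F'_def pt_sum_left pt_sum_right sum_fun_apply by (rule sum.swap)
      also have "\<dots> = pt F F (vx i) S"
      proof -
        have "gi (der (vy i) F') A = gi (der (vy i) F) A" "der (vx i) F' A = der (vx i) F A" if "A \<subseteq> S" for A
        proof -
          have "insert (b, i) A \<in> Z" for b using that n(2) i by (auto simp: Z_def mem_Times_iff)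
          thus "gi (der (vy i) F') A = gi (der (vy i) F) A" "der (vx i) F' A = der (vx i) F A"
            by (auto simp: gi_def der_def F')
        qed
        thus ?thesis unfolding pt_def mul_def by (auto intro!: sum.cong)
      qed
      finally show "(\<Sum>P\<in>Z. \<Sum>Q\<in>Z. pt (comp_at F P) (comp_at F Q) (vx i) S) = pt F F (vx i) S" .
    qed
    also have "\<dots> = sq F S" using sq_eq_upto[OF N n] by (simp add: sq_upto_def sum_fun_apply)
    finally show ?thesis .
  qed
qed

section \<open>Comparison of the two notions of word\<close>

lemma pmon_pword: "pmon k f \<Longrightarrow> pword gens1 (real k) (Phi f)"
proof (induction rule: pmon.induct)
  case (pgen i)
  show ?case unfolding Phi_Vser by (rule pword.gen) (use pgen in \<open>simp add: gens1_def\<close>)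
next
  case (pmul a f b g)
  then show ?case unfolding Phi_hmul of_nat_add by (intro pword.mul)
next
  case (pbr a f b g)
  note H = pbr.IH[THEN pword_hom(1)[OF good_gens1]]
  from pbr show ?case unfolding Phi_hbr[OF H] of_nat_add by (intro pword.br)
next
  case (psq a f)
  note H = pword_hom(1)[OF good_gens1 psq.IH]
  have h: "hom False (Phi f)" using psq(3) hodd_iff[OF fin_supp_Hs[OF H]] by simp
  have "pword gens1 (2 * real a) (sq (Phi f))" by (rule pword.sq[OF psq(1) psq.IH h])
  thus ?case by (simp add: Phi_hsq[OF psq(1) H h])
qed

lemma Psi_Vg: "Psi (Vg i) = Vser i"
  by (metis Phi_Vser Psi_Phi)

lemma pword_pmon: "pword gens1 t F \<Longrightarrow> \<exists>k\<ge>1. t = real k \<and> pmon k (Psi F)"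
proof (induction rule: pword.induct)
  case (gen f t)
  then obtain i where "f = Vg i" "i < 3" "t = 1" by (auto simp: gens1_def)
  thus ?case using pmon.pgen[of i] by (intro exI[of _ 1]) (simp add: Psi_Vg)
next
  case (mul s f t g)
  then obtain a b where "a \<ge> 1" "s = real a" "pmon a (Psi f)" "t = real b" "pmon b (Psi g)" by blast
  moreover have "Psi (mul f g) = hmul (Psi f) (Psi g)" by (metis Phi_Psi Phi_hmul Psi_Phi)
  ultimately show ?case using pmon.pmul by (intro exI[of _ "a + b"]) simp
next
  case (br s f t g)
  note H = br.hyps[THEN pword_hom(1)[OF good_gens1]]
  from br obtain a b where "a \<ge> 1" "s = real a" "pmon a (Psi f)" "t = real b" "pmon b (Psi g)" by blast
  moreover have "Psi (br f g) = hbr (Psi f) (Psi g)" using Phi_hbr[of "Psi f" "Psi g"] H by (metis Phi_Psi Psi_Phi)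
  ultimately show ?case using pmon.pbr by (intro exI[of _ "a + b"]) simp
next
  case (sq t f)
  note H = pword_hom(1)[OF good_gens1 sq.hyps(2)]
  from sq obtain a where a: "a \<ge> 1" "t = real a" "pmon a (Psi f)" by blast
  have "Psi (sq f) = hsq (Psi f)" using Phi_hsq[of "Psi f"] H sq by (metis Phi_Psi Psi_Phi)
  moreover have "hodd (Psi f)" using hodd_iff[of "Psi f"] fin_supp_Hs[OF H] sq(3) by simp
  ultimately show ?case using pmon.psq[OF sq(1) a(3)] a by (intro exI[of _ "2 * a"]) simp
qed

lemma Psi_lin: "Psi (F + G) = Psi F + Psi G" "Psi (fscale c F) = fscale c (Psi F)"
  by (simp_all add: Psi_def fun_eq_iff fscale_def plus_fun_apply)

lemma span_image_fscale:
  assumes "\<And>F G. T (F + G) = T F + T G" "\<And>c F. T (fscale c F) = fscale c (T F)" "F \<in> fs.span W"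
  shows "T F \<in> fs.span (T ` W)"
proof (rule fs.span_induct[OF assms(3)])
  have 0: "T 0 = 0" using assms(2)[of 0 0] by simp
  show "fs.subspace {x. T x \<in> fs.span (T ` W)}"
    unfolding fs.subspace_def by (auto simp: assms 0 fs.span_zero fs.span_add fs.span_scale)
qed (simp add: fs.span_base)

lemma independent_preimage_fscale:
  assumes "\<And>F G. T (F + G) = T F + T G" "\<And>c F. T (fscale c F) = fscale c (T F)"
    and "inj_on T B" "fs.independent (T ` B)"
  shows "fs.independent B"
proof
  assume "fs.dependent B"
  then obtain a where a: "a \<in> B" "a \<in> fs.span (B - {a})" unfolding fs.dependent_def by blast
  have "T a \<in> fs.span (T ` (B - {a}))" by (rule span_image_fscale[OF assms(1,2) a(2)])
  also have "T ` (B - {a}) = T ` B - {T a}" using assms(3) a(1) by (auto simp: inj_on_def)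
  finally show False using assms(4) a(1) unfolding fs.dependent_def by blast
qed

lemma pmon_set:
  "{f :: 'k::field hser. \<exists>k. 1 \<le> k \<and> k \<le> n \<and> pmon k f} = Psi ` {F. \<exists>s\<le>real n. pword gens1 s F}"
proof (intro subset_antisym subsetI)
  fix f :: "'k hser" assume "f \<in> {f. \<exists>k. 1 \<le> k \<and> k \<le> n \<and> pmon k f}"
  then obtain k where "k \<le> n" "pmon k f" by blast
  hence "Phi f \<in> {F. \<exists>s\<le>real n. pword gens1 s F}" using pmon_pword by (auto intro!: exI[of _ "real k"])
  thus "f \<in> Psi ` {F. \<exists>s\<le>real n. pword gens1 s F}" by (rule image_eqI[rotated]) simp
next
  fix f :: "'k hser" assume "f \<in> Psi ` {F. \<exists>s\<le>real n. pword gens1 s F}"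
  then obtain s F where "f = Psi F" "s \<le> real n" "pword gens1 s F" by blast
  with pword_pmon[OF this(3)] show "f \<in> {f. \<exists>k. 1 \<le> k \<and> k \<le> n \<and> pmon k f}" by auto
qed

context cubic_root
begin

text \<open>V_0, V_1, V_2 weigh at most l^2. This is the source of the factor l^2 in the upper
  bounds.\<close>

lemma pword_weight: "pword gens1 t F \<Longrightarrow> \<exists>s\<le>l\<^sup>2 * t. pword (gens 0) s F"
proof (induction rule: pword.induct)
  case (gen f t)
  then obtain i where i: "f = Vg i" "i < 3" "t = 1" by (auto simp: gens1_def)
  have "i \<in> {0, Suc 0, 0 + 2}" using i(2) by (auto simp: less_Suc_eq numeral_3_eq_3)
  hence "(Vg i, l ^ i) \<in> gens 0" unfolding gens_def by (intro insertI2[of "(_, _)"] imageI)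
  moreover have "l ^ i \<le> l\<^sup>2" using i(2) by (intro power_increasing) (simp_all add: less_imp_le)
  ultimately show ?case unfolding i mult_1_right using pword.gen by blast
next
  case (mul s f t g)
  then obtain a b where "a \<le> l\<^sup>2 * s" "pword (gens 0) a f" "b \<le> l\<^sup>2 * t" "pword (gens 0) b g" by blast
  then show ?case using pword.mul by (intro exI[of _ "a + b"]) (auto simp: algebra_simps)
next
  case (br s f t g)
  then obtain a b where "a \<le> l\<^sup>2 * s" "pword (gens 0) a f" "b \<le> l\<^sup>2 * t" "pword (gens 0) b g" by blast
  then show ?case using pword.br by (intro exI[of _ "a + b"]) (auto simp: algebra_simps)
next
  case (sq t f)
  then obtain a where "a \<le> l\<^sup>2 * t" "pword (gens 0) a f" by blast
  then show ?case using pword.sq[OF sq(1) _ sq(3)] by (intro exI[of _ "2 * a"]) auto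
qed

lemma pgrowth_bounds:
  "\<exists>c. (\<forall>n j. l\<^sup>2 * real n \<le> l ^ j \<longrightarrow> pgrowth TYPE('k::field) n \<le> 4 ^ j * c)
     \<and> (\<forall>n r. 2 * l ^ 5 * l ^ (2 * r) \<le> real n \<longrightarrow> 16 ^ r \<le> pgrowth TYPE('k) n)"
proof -
  let ?S = "\<lambda>n. {F :: pvar set \<Rightarrow> 'k. \<exists>s\<le>real n. pword gens1 s F}"
  have g: "pgrowth TYPE('k) n = fs.dim (Psi ` ?S n)" for n
    unfolding pgrowth_def span_dim_def pmon_set ..
  obtain c where c: "\<And>j t. t \<le> l ^ j \<Longrightarrow> \<exists>W. finite W \<and> card W \<le> 4 ^ j * c
    \<and> (pspan (gens 0) t :: (pvar set \<Rightarrow> 'k) set) \<subseteq> fs.span W"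
    using pspan_upper by blast
  have W: "\<exists>W. finite W \<and> card W \<le> 4 ^ j * c \<and> Psi ` ?S n \<subseteq> fs.span W" if nj: "l\<^sup>2 * real n \<le> l ^ j" for n j
  proof -
    obtain W where W: "finite W" "card W \<le> 4 ^ j * c" "(pspan (gens 0) (l ^ j) :: (pvar set \<Rightarrow> 'k) set) \<subseteq> fs.span W"
      using c[OF order_refl] by blast
    have "F \<in> fs.span W" if "F \<in> ?S n" for F
    proof -
      from that obtain s where "s \<le> real n" "pword gens1 s F" by blast
      with pword_weight obtain s' where s': "s' \<le> l\<^sup>2 * s" "pword (gens 0) s' F" by blast
      have "l\<^sup>2 * s \<le> l\<^sup>2 * real n" using \<open>s \<le> real n\<close> by (intro mult_left_mono) auto
      hence "F \<in> pspan (gens 0) (l ^ j)" using s' nj by (intro pword_pspan[OF s'(2)]) linarith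
      thus ?thesis using W(3) by blast
    qed
    hence "Psi ` ?S n \<subseteq> fs.span (Psi ` W)"
      using span_image_fscale[of Psi, OF Psi_lin] by blast
    moreover have "card (Psi ` W) \<le> 4 ^ j * c" using card_image_le[OF W(1), of Psi] W(2) by linarith
    ultimately show ?thesis using W(1) by (intro exI[of _ "Psi ` W"]) simp
  qed
  show ?thesis
  proof (intro exI[of _ c] conjI allI impI)
    fix n j assume "l\<^sup>2 * real n \<le> l ^ j"
    from W[OF this] show "pgrowth TYPE('k) n \<le> 4 ^ j * c"
      unfolding g using fs.dim_le_card by (meson order_trans)
  next
    fix n r assume r: "2 * l ^ 5 * l ^ (2 * r) \<le> real n"
    obtain B where B: "fs.independent B" "16 ^ r \<le> card B" "B \<subseteq> M1 TYPE('k) (2 * l ^ 5 * l ^ (2 * r))"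
      using pspan_lower by blast
    have B': "B \<subseteq> fs.span (?S n)" using B(3) pspan_mono[OF r, of "gens1 :: ((pvar set \<Rightarrow> 'k) \<times> real) set"]
      unfolding pspan_def by blast
    have ind: "fs.independent (Psi ` B)"
    proof (rule independent_preimage_fscale[of Phi])
      show "fs.independent (Phi ` Psi ` B)" using B(1) by (simp add: image_image)
      show "inj_on Phi (Psi ` B)" by (metis Psi_Phi inj_onI)
    qed (simp_all add: Phi_plus Phi_def fscale_def fun_eq_iff)
    have "Psi ` B \<subseteq> fs.span (Psi ` ?S n)"
      using B' span_image_fscale[of Psi, OF Psi_lin] by blast
    \<comment> \<open>Any large j will do; it only certifies the finite dimension that
      \<open>card_le_dim\<close> asks for.\<close>
    moreover obtain j where "l\<^sup>2 * real n \<le> l ^ j"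
      using real_arch_pow[OF l_pos(3), of "l\<^sup>2 * real n"] less_imp_le by blast
    from W[OF this] obtain W where "finite W" "Psi ` ?S n \<subseteq> fs.span W" by blast
    ultimately have "card (Psi ` B) \<le> pgrowth TYPE('k) n"
      unfolding g using fs.card_le_dim[OF _ _ ind] by blast
    moreover have "card (Psi ` B) = card B" by (rule card_image) (metis Phi_Psi inj_onI)
    ultimately show "16 ^ r \<le> pgrowth TYPE('k) n" using B(2) by linarith
  qed
qed

end

section \<open>Operators on the Grassmann algebra\<close>

type_synonym 'k op = "(nat set \<Rightarrow> 'k) \<Rightarrow> nat set \<Rightarrow> 'k"

abbreviation op_comp :: "'k op \<Rightarrow> 'k op \<Rightarrow> 'k op" (infixl "\<odot>" 70) where
  "t \<odot> u \<equiv> (t \<circ> u)"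

text \<open>Coefficients at infinite sets are junk; \<open>proj\<close> discards them and is the unit of the algebra of
  operators below.\<close>
definition proj :: "'k::field op" where
  "proj a R = (if finite R then a R else 0)"

fun pl :: "nat \<Rightarrow> nat \<Rightarrow> 'k::field op" where
  "pl i 0 a = proj a"
| "pl i (Suc k) a = lm i (lm (Suc i) (pl (i + 3) k a))"

definition vo_upto :: "nat \<Rightarrow> nat \<Rightarrow> 'k::field op" where
  "vo_upto M i a = (\<Sum>k\<le>M. pl i k (der (i + 3 * k) a))"

text \<open>The k-th term has 2k factors x in front, so its coefficient at \<open>R\<close> vanishes
  once 2k exceeds \<open>card R\<close>. Cutting off at \<open>card R\<close> defines the operator
  on all coefficient functions, not just on polynomials.\<close>

definition vo :: "nat \<Rightarrow> 'k::field op" where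
  "vo i a R = vo_upto (card R) i a R"

lemma proj_lin: "proj (f + g) = proj f + proj g" "proj (fscale c f) = fscale c (proj f)"
  "proj 0 = 0" "proj (- f) = - proj f" "proj (proj f) = proj f"
  "proj (lm z f) = lm z f" "proj (der z f) = der z f"
  by (auto simp: proj_def fun_eq_iff plus_fun_apply fscale_def zero_fun_apply uminus_apply lm_def der_def)

lemma fin_supp_proj: "fin_supp (proj a)" by (simp add: fin_supp_def proj_def)

lemma lm_proj: "lm z (proj f) = lm z f" and der_proj: "der z (proj f) = der z f"
  by (auto simp: proj_def fun_eq_iff lm_def der_def)

lemma der_lm_proj: "der z (lm z a) = proj a - lm z (der z a)"
  using der_lm_same[OF fin_supp_proj[of a], of z] by (simp add: lm_proj der_proj)

lemma pl_lin: "pl i k (f + g) = pl i k f + pl i k g" "pl i k (fscale c f) = fscale c (pl i k f)"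
  "pl i k 0 = 0" "pl i k (- f) = - pl i k f"
  by (induction k arbitrary: i) (simp_all add: proj_lin lin_simps)

lemma low_proj: "low d f \<Longrightarrow> low d (proj f)"
  by (simp add: low_def proj_def)

lemma low_pl: "low d f \<Longrightarrow> low (d + 2 * int k) (pl i k f)"
proof (induction k arbitrary: i)
  case (Suc k)
  then have "low (d + 2 * int k + 1 + 1) (lm i (lm (Suc i) (pl (i + 3) k f)))" by (intro low_lm)
  then show ?case by (simp add: algebra_simps)
qed (simp add: low_proj)

lemma pl_high: "card R < 2 * k \<Longrightarrow> finite R \<Longrightarrow> pl i k f R = 0"
  using low_pl[of 0 f k i] by (simp add: low_def)

lemma pl_inf: "infinite R \<Longrightarrow> pl i k f R = 0"
  by (cases k) (simp_all add: proj_def)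

lemma vo_eq_upto: "card R \<le> M \<Longrightarrow> vo i a R = vo_upto M i a R"
  unfolding vo_def vo_upto_def sum_fun_apply
proof (rule sum.mono_neutral_left)
  assume "card R \<le> M"
  show "\<forall>k\<in>{..M} - {..card R}. pl i k (der (i + 3 * k) a) R = 0"
  proof
    fix k assume "k \<in> {..M} - {..card R}"
    hence "card R < 2 * k" by auto
    thus "pl i k (der (i + 3 * k) a) R = 0" using pl_high pl_inf by (cases "finite R") auto
  qed
qed auto

lemma vo_upto_rec: "vo_upto (Suc M) i a = der i a + lm i (lm (Suc i) (vo_upto M (i + 3) a))"
proof -
  have "vo_upto (Suc M) i a = pl i 0 (der (i + 3 * 0) a) + (\<Sum>k\<le>M. pl i (Suc k) (der (i + 3 * Suc k) a))"
    unfolding vo_upto_def by (rule sum.atMost_Suc_shift)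
  thus ?thesis unfolding vo_upto_def by (simp add: proj_lin lin_sum add.assoc)
qed

lemma vo_rec: "vo i a = der i a + lm i (lm (Suc i) (vo (i + 3) a))"
proof
  fix R
  have "vo i a R = vo_upto (Suc (card R)) i a R" by (rule vo_eq_upto) simp
  also have "\<dots> = der i a R + lm i (lm (Suc i) (vo_upto (card R) (i + 3) a)) R"
    by (simp add: vo_upto_rec plus_fun_apply)
  also have "lm i (lm (Suc i) (vo_upto (card R) (i + 3) a)) R = lm i (lm (Suc i) (vo (i + 3) a)) R"
    by (intro lm_cong vo_eq_upto[symmetric] card_mono) auto
  finally show "vo i a R = (der i a + lm i (lm (Suc i) (vo (i + 3) a))) R" by (simp add: plus_fun_apply)
qed

text \<open>Besides being linear, such an operator neither reads nor produces values at infinite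
  sets, so that \<open>proj\<close> is a two-sided unit.\<close>

definition lop :: "'k::field op \<Rightarrow> bool" where
  "lop t \<longleftrightarrow> (\<forall>a b. t (a + b) = t a + t b) \<and> (\<forall>c a. t (fscale c a) = fscale c (t a))
     \<and> (\<forall>a. t (proj a) = t a) \<and> (\<forall>a. proj (t a) = t a)"

lemma lopD: assumes "lop t" shows "t (a + b) = t a + t b" "t (fscale c a) = fscale c (t a)"
  "t (proj a) = t a" "proj (t a) = t a" "t 0 = 0" "t (- a) = - t a" "t (a - b) = t a - t b"
proof -
  show 1: "t (a + b) = t a + t b" "t (fscale c a) = fscale c (t a)"
    "t (proj a) = t a" "proj (t a) = t a" for a b c
    using assms by (auto simp: lop_def)
  show 0: "t 0 = 0" using 1(2)[of 0 0] by simp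
  show 2: "t (- a) = - t a" for a using 1(2)[of "-1" a] by (simp only: uminus_eq_fscale)
  show "t (a - b) = t a - t b" using 1(1)[of a "- b"] 2 by simp
qed

lemma lop_lm: "lop (lm z)" and lop_der: "lop (der z)" and lop_proj: "lop proj"
  by (simp_all add: lop_def lin_simps proj_lin lm_proj der_proj)

lemma lop_vo: "lop (vo i)"
  unfolding lop_def
proof (intro conjI allI)
  fix a b :: "nat set \<Rightarrow> 'a" and c
  show "vo i (a + b) = vo i a + vo i b"
    by (simp add: fun_eq_iff vo_def vo_upto_def lin_simps pl_lin sum.distrib plus_fun_apply)
  show "vo i (fscale c a) = fscale c (vo i a)"
    by (simp add: fun_eq_iff vo_def vo_upto_def lin_simps pl_lin fscale_sum[symmetric])
      (simp add: fscale_def vo_def vo_upto_def)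
  show "vo i (proj a) = vo i a" by (simp add: fun_eq_iff vo_def vo_upto_def der_proj)
  show "proj (vo i a) = vo i a"
    by (auto simp: fun_eq_iff vo_def vo_upto_def proj_def sum_fun_apply pl_inf)
qed

lemma lop_comp: "lop t \<Longrightarrow> lop u \<Longrightarrow> lop (t \<odot> u)"
  by (simp add: lop_def)

lemma pl_lm: "j < i \<Longrightarrow> pl i k (lm j a) = lm j (pl i k a)"
proof (induction k arbitrary: i)
  case (Suc k)
  then show ?case by (simp add: lin_simps lm_lm[of i j] lm_lm[of "Suc i" j])
qed (simp add: proj_lin lm_proj)

lemma pl_der: "j < i \<Longrightarrow> pl i k (der j a) = der j (pl i k a)"
proof (induction k arbitrary: i)
  case (Suc k)
  then show ?case by (simp add: lin_simps der_lm_other[of j i] der_lm_other[of j "Suc i"])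
qed (simp add: proj_lin der_proj)

text \<open>v_i is odd and involves only indices from i upwards.\<close>

lemma vo_lm: assumes "j < i" shows "vo i (lm j a) = - lm j (vo i a)"
proof
  fix R
  have "vo_upto M i (lm j a) = - lm j (vo_upto M i a)" for M
    using assms by (simp add: vo_upto_def lin_sum der_lm_other pl_lin pl_lm sum_negf)
  hence "vo i (lm j a) R = - lm j (vo_upto (card R) i a) R" by (simp add: vo_def uminus_apply)
  also have "lm j (vo_upto (card R) i a) R = lm j (vo i a) R"
    by (intro lm_cong vo_eq_upto[symmetric] card_mono) auto
  finally show "vo i (lm j a) R = (- lm j (vo i a)) R" by (simp add: uminus_apply)
qed

lemma vo_der: assumes "j < i" shows "vo i (der j a) = - der j (vo i a)"
proof
  fix R
  have u: "vo_upto M i (der j a) = - der j (vo_upto M i a)" for M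
    using assms by (simp add: vo_upto_def lin_sum der_der[of _ j] pl_lin pl_der sum_negf)
  have "vo i (der j a) R = vo_upto (Suc (card R)) i (der j a) R" by (rule vo_eq_upto) simp
  also have "\<dots> = - der j (vo_upto (Suc (card R)) i a) R" by (simp add: u uminus_apply)
  also have "der j (vo_upto (Suc (card R)) i a) R = der j (vo i a) R"
    by (intro der_cong vo_eq_upto[symmetric] card_insert_le_m1) auto
  finally show "vo i (der j a) R = (- der j (vo i a)) R" by (simp add: uminus_apply)
qed

lemma lm_vo_self: "lm j (vo j a) = lm j (der j a)"
  by (subst vo_rec) (simp add: lin_simps)

text \<open>The relation v_j x_j + x_j v_j = 1. The tail of v_j begins with x_j, and the rest of the
  tail can be moved past the other x_j.\<close>

lemma vo_lm_self: "vo j (lm j a) = proj a - lm j (vo j a)"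
proof -
  have "lm j (lm (Suc j) (vo (j + 3) (lm j a))) = 0"
    by (simp add: vo_lm lin_simps lm_lm[of "Suc j" j])
  thus ?thesis unfolding lm_vo_self by (subst vo_rec) (simp add: der_lm_proj)
qed

definition oscale :: "'k::field \<Rightarrow> 'k op \<Rightarrow> 'k op" where
  "oscale c t = (\<lambda>a. fscale c (t a))"

interpretation os: vector_space "oscale :: 'k::field \<Rightarrow> 'k op \<Rightarrow> 'k op"
  by unfold_locales (auto simp: oscale_def fun_eq_iff fscale_def plus_fun_apply algebra_simps)

lemma op_apply: "(t + u) a = t a + u a" "(- t) a = - t a" "(t - u) a = t a - u a"
  "oscale c t a = fscale c (t a)" "(0 :: 'k op) a = 0" for t u :: "'k::field op"
  by (simp_all add: plus_fun_apply uminus_apply minus_apply oscale_def zero_fun_apply)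

lemma lop_lin: "lop t \<Longrightarrow> lop u \<Longrightarrow> lop (t + u)" "lop t \<Longrightarrow> lop (oscale c t)" "lop 0"
proof -
  show "lop (t + u)" if "lop t" "lop u"
    unfolding lop_def by (simp add: op_apply lopD[OF that(1)] lopD[OF that(2)] proj_lin fs.scale_right_distrib algebra_simps)
  show "lop (oscale c t)" if "lop t"
    unfolding lop_def by (simp add: op_apply lopD[OF that] proj_lin fs.scale_right_distrib mult.commute)
  show "lop 0" unfolding lop_def by (simp add: op_apply proj_lin)
qed

lemma comp_lin: "(t + u) \<odot> s = t \<odot> s + u \<odot> s" "(oscale c t) \<odot> s = oscale c (t \<odot> s)" "0 \<odot> s = 0"
  "lop s \<Longrightarrow> s \<odot> (t + u) = s \<odot> t + s \<odot> u" "lop s \<Longrightarrow> s \<odot> (oscale c t) = oscale c (s \<odot> t)"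
  "lop s \<Longrightarrow> s \<odot> 0 = 0" for s t u :: "'k::field op"
  by (simp_all add: fun_eq_iff[where 'a="nat set \<Rightarrow> 'k"] op_apply lopD)

section \<open>Filtered algebras of operators\<close>

locale graded_ops =
  fixes C :: "real \<Rightarrow> 'k::field op set"
  assumes sub: "os.subspace (C t)"
    and lop: "f \<in> C t \<Longrightarrow> lop f"
    and comp: "f \<in> C s \<Longrightarrow> g \<in> C t \<Longrightarrow> f \<odot> g \<in> C (s + t)"
begin

lemma lin:
  "f \<in> C t \<Longrightarrow> g \<in> C t \<Longrightarrow> f + g \<in> C t" "f \<in> C t \<Longrightarrow> oscale c f \<in> C t" "0 \<in> C t"
  "f \<in> C t \<Longrightarrow> - f \<in> C t" "f \<in> C t \<Longrightarrow> g \<in> C t \<Longrightarrow> f - g \<in> C t"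
  by (rule os.subspace_add[OF sub] os.subspace_scale[OF sub] os.subspace_0[OF sub]
      os.subspace_neg[OF sub] os.subspace_diff[OF sub]; assumption)+

end

definition adjo :: "'k::field op \<Rightarrow> real \<Rightarrow> (real \<Rightarrow> 'k op set) \<Rightarrow> real \<Rightarrow> 'k op set" where
  "adjo z w C t = {f + z \<odot> g | f g. f \<in> C t \<and> g \<in> C (t - w)}"

lemma adjoI: "f \<in> C t \<Longrightarrow> g \<in> C (t - w) \<Longrightarrow> f + z \<odot> g \<in> adjo z w C t"
  unfolding adjo_def by blast

lemma adjoE:
  assumes "f \<in> adjo z w C t"
  obtains g h where "f = g + z \<odot> h" "g \<in> C t" "h \<in> C (t - w)"
  using assms unfolding adjo_def by blast

lemma adjo_base: "f \<in> C t \<Longrightarrow> 0 \<in> C (t - w) \<Longrightarrow> lop z \<Longrightarrow> f \<in> adjo z w C t"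
  using adjoI[of f C t 0 w z] by (simp add: comp_lin)

lemma adjo_comp: "0 \<in> C t \<Longrightarrow> g \<in> C (t - w) \<Longrightarrow> z \<odot> g \<in> adjo z w C t"
  using adjoI[of 0 C t g w z] by simp

lemma adjo_mono:
  assumes "\<And>s t. s \<le> t \<Longrightarrow> C s \<subseteq> C t" "s \<le> t"
  shows "adjo z w C s \<subseteq> adjo z w C t"
proof
  fix x assume "x \<in> adjo z w C s"
  then obtain g h where "x = g + z \<odot> h" "g \<in> C s" "h \<in> C (s - w)" by (rule adjoE)
  thus "x \<in> adjo z w C t" using assms(1)[of s t] assms(1)[of "s - w" "t - w"] assms(2)
    by (auto intro!: adjoI)
qed

text \<open>Hypothesis \<open>comm\<close> takes the place of the derivative condition in the
  Poisson case: moving \<open>z\<close> to the left leaves a correction f'' without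
  \<open>z\<close>, of the full weight t + w of \<open>f \<odot> z\<close>.\<close>

lemma (in graded_ops) adjo:
  assumes z: "lop z" "z \<odot> z = 0"
    and comm: "\<And>f t. f \<in> C t \<Longrightarrow> \<exists>f'\<in>C t. \<exists>f''\<in>C (t + w). f \<odot> z = z \<odot> f' + f''"
  shows "graded_ops (adjo z w C)"
proof
  fix t
  show "os.subspace (adjo z w C t)"
    unfolding os.subspace_def
  proof (intro conjI ballI allI)
    show "0 \<in> adjo z w C t" by (rule adjo_base[OF lin(3) lin(3) z(1)])
  next
    fix a b assume "a \<in> adjo z w C t" "b \<in> adjo z w C t"
    then obtain f g f' g' where *: "a = f + z \<odot> g" "b = f' + z \<odot> g'" "f \<in> C t" "g \<in> C (t - w)"
      "f' \<in> C t" "g' \<in> C (t - w)" by (elim adjoE)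
    have "a + b = (f + f') + z \<odot> (g + g')" by (simp add: * comp_lin z algebra_simps)
    thus "a + b \<in> adjo z w C t" using * by (simp only:) (intro adjoI lin)
  next
    fix c a assume "a \<in> adjo z w C t"
    then obtain f g where *: "a = f + z \<odot> g" "f \<in> C t" "g \<in> C (t - w)" by (elim adjoE)
    have "oscale c a = oscale c f + z \<odot> (oscale c g)"
      by (simp add: * comp_lin z os.scale_right_distrib)
    thus "oscale c a \<in> adjo z w C t" using * by (simp only:) (intro adjoI lin)
  qed
next
  fix a t assume "a \<in> adjo z w C t"
  then obtain f g where *: "a = f + z \<odot> g" "f \<in> C t" "g \<in> C (t - w)" by (elim adjoE)
  show "lop a" unfolding *(1) by (intro lop_lin lop_comp z lop[OF *(2)] lop[OF *(3)])
next
  fix a b s t assume "a \<in> adjo z w C s" "b \<in> adjo z w C t"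
  then obtain f g f' g' where *: "a = f + z \<odot> g" "b = f' + z \<odot> g'" "f \<in> C s" "g \<in> C (s - w)"
    "f' \<in> C t" "g' \<in> C (t - w)" by (elim adjoE)
  obtain f1 f2 where f: "f1 \<in> C s" "f2 \<in> C (s + w)" "f \<odot> z = z \<odot> f1 + f2" using comm[OF *(3)] by blast
  obtain g1 g2 where g: "g1 \<in> C (s - w)" "g2 \<in> C (s - w + w)" "g \<odot> z = z \<odot> g1 + g2" using comm[OF *(4)] by blast
  note L = *(3-6)[THEN lop] f(1,2)[THEN lop] g(1,2)[THEN lop]
  have fz: "f (z x) = z (f1 x) + f2 x" for x using fun_cong[OF f(3), of x] by (simp add: op_apply)
  have gz: "g (z x) = z (g1 x) + g2 x" for x using fun_cong[OF g(3), of x] by (simp add: op_apply)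
  have zz: "z (z x) = 0" for x using fun_cong[OF z(2), of x] by (simp add: op_apply)
  \<comment> \<open>The product after moving \<open>z\<close> to the left in f z g' and g z g'; z z
    = 0 removes \<open>g1\<close>.\<close>
  have "a \<odot> b = (f \<odot> f' + f2 \<odot> g') + z \<odot> (g \<odot> f' + f1 \<odot> g' + g2 \<odot> g')"
  proof
    fix x
    show "(a \<odot> b) x = ((f \<odot> f' + f2 \<odot> g') + z \<odot> (g \<odot> f' + f1 \<odot> g' + g2 \<odot> g')) x"
      by (simp add: *(1,2) op_apply lopD[OF z(1)] lopD[OF L(1)] lopD[OF L(2)] fz gz zz algebra_simps)
  qed
  moreover have "f \<odot> f' \<in> C (s + t)" by (rule comp[OF *(3,5)])
  moreover have "f2 \<odot> g' \<in> C (s + t)" using comp[OF f(2) *(6)] by (simp add: algebra_simps)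
  moreover have "g \<odot> f' \<in> C (s + t - w)" using comp[OF *(4,5)] by (simp add: algebra_simps)
  moreover have "f1 \<odot> g' \<in> C (s + t - w)" using comp[OF f(1) *(6)] by (simp add: algebra_simps)
  moreover have "g2 \<odot> g' \<in> C (s + t - w)" using comp[OF g(2) *(6)] by (simp add: algebra_simps)
  ultimately show "a \<odot> b \<in> adjo z w C (s + t)" by (simp only:) (intro adjoI lin)
qed

inductive aword :: "('k::field op \<times> real) set \<Rightarrow> real \<Rightarrow> 'k op \<Rightarrow> bool" for G where
  gen: "(f, t) \<in> G \<Longrightarrow> aword G t f"
| comp: "aword G s f \<Longrightarrow> aword G t g \<Longrightarrow> aword G (s + t) (f \<odot> g)"

definition aspan :: "('k::field op \<times> real) set \<Rightarrow> real \<Rightarrow> 'k op set" where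
  "aspan G t = os.span {f. \<exists>s\<le>t. aword G s f}"

definition good_ops :: "('k::field op \<times> real) set \<Rightarrow> bool" where
  "good_ops G \<longleftrightarrow> (\<forall>(f, t)\<in>G. lop f)"

lemma aword_lop: assumes "good_ops G" "aword G t f" shows "lop f"
  using assms(2)
proof induction
  case (gen f t)
  then show ?case using assms(1) by (auto simp: good_ops_def)
qed (rule lop_comp)

lemma aword_aspan: "aword G s f \<Longrightarrow> s \<le> t \<Longrightarrow> f \<in> aspan G t"
  unfolding aspan_def by (rule os.span_base) blast

lemma aspan_mono: "s \<le> t \<Longrightarrow> aspan G s \<subseteq> aspan G t"
  unfolding aspan_def by (rule os.span_mono) (auto intro: order_trans)

lemma aspan_sub: "os.subspace (aspan G t)"
  unfolding aspan_def by simp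

lemmas aspan_lin = os.subspace_add[OF aspan_sub] os.subspace_scale[OF aspan_sub]
  os.subspace_0[OF aspan_sub] os.subspace_neg[OF aspan_sub] os.subspace_diff[OF aspan_sub]

lemma aspan_induct [consumes 1, case_names 0 add scale word]:
  assumes "f \<in> aspan G t" "P 0" "\<And>f g. P f \<Longrightarrow> P g \<Longrightarrow> P (f + g)" "\<And>c f. P f \<Longrightarrow> P (oscale c f)"
    "\<And>s f. s \<le> t \<Longrightarrow> aword G s f \<Longrightarrow> P f"
  shows "P f"
proof (rule os.span_induct[of f "{f. \<exists>s\<le>t. aword G s f}" P])
  show "os.subspace (Collect P)" unfolding os.subspace_def using assms(2-4) by blast
qed (use assms(1,5) in \<open>auto simp: aspan_def\<close>)

lemma graded_ops_aspan: assumes G: "good_ops G" shows "graded_ops (aspan G)"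
proof
  show "os.subspace (aspan G t)" for t by (rule aspan_sub)
  show lop: "lop f" if "f \<in> aspan G t" for f t
    using that by (induction rule: aspan_induct) (rule lop_lin aword_lop[OF G]; assumption)+
  show "f \<odot> g \<in> aspan G (s + t)" if "f \<in> aspan G s" "g \<in> aspan G t" for f g s t
    using that(1)
  proof (induction rule: aspan_induct)
    case (word s' f)
    have f: "lop f" by (rule aword_lop[OF G word(2)])
    show ?case using that(2)
    proof (induction rule: aspan_induct)
      case (word t' g)
      show ?case by (rule aword_aspan[OF aword.comp[OF \<open>aword G s' f\<close> word(2)]])
          (use word(1) \<open>s' \<le> s\<close> in simp)
    qed (simp_all only: comp_lin(4-6)[OF f] aspan_lin)
  qed (simp_all only: comp_lin(1-3) aspan_lin)
qed

lemma (in graded_ops) aspan_mem: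
  assumes "f \<in> aspan G t" "\<And>g s. (g, s) \<in> G \<Longrightarrow> g \<in> C s" "\<And>s t. s \<le> t \<Longrightarrow> C s \<subseteq> C t"
  shows "f \<in> C t"
proof -
  have w: "f \<in> C t" if "aword G t f" for t f
    using that by induction (rule assms(2) comp; assumption)+
  show ?thesis using assms(1)
  proof (induction rule: aspan_induct)
    case (word s f)
    then show ?case using w assms(3) by blast
  qed (rule lin; assumption)+
qed

text \<open>For a product, (f g) z = f z g1 + f g2 = z f1 g1 + (f2 g1 + f g2), so the condition
  passes from generators to words.\<close>

lemma aspan_commute:
  assumes G: "good_ops G" and z: "lop z"
    and gen: "\<And>g s. (g, s) \<in> G \<Longrightarrow> \<exists>g'\<in>aspan G s. \<exists>g''\<in>aspan G (s + w). g \<odot> z = z \<odot> g' + g''"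
    and f: "f \<in> aspan G t"
  shows "\<exists>f'\<in>aspan G t. \<exists>f''\<in>aspan G (t + w). f \<odot> z = z \<odot> f' + f''"
proof -
  interpret graded_ops "aspan G" by (rule graded_ops_aspan[OF G])
  note comp_C = comp
  have w: "\<exists>f'\<in>aspan G t. \<exists>f''\<in>aspan G (t + w). f \<odot> z = z \<odot> f' + f''" if "aword G t f" for t f
    using that
  proof induction
    case (comp s f t g)
    obtain f1 f2 where f: "f1 \<in> aspan G s" "f2 \<in> aspan G (s + w)" "f \<odot> z = z \<odot> f1 + f2" using comp.IH(1) by blast
    obtain g1 g2 where g: "g1 \<in> aspan G t" "g2 \<in> aspan G (t + w)" "g \<odot> z = z \<odot> g1 + g2" using comp.IH(2) by blast
    have m: "f \<in> aspan G s" "g \<in> aspan G t" using comp.hyps aword_aspan by auto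
    have "(f \<odot> g) \<odot> z = f \<odot> (z \<odot> g1 + g2)" by (simp only: comp_assoc g(3))
    also have "\<dots> = (f \<odot> z) \<odot> g1 + f \<odot> g2" by (simp only: comp_lin(4)[OF lop[OF m(1)]] comp_assoc)
    also have "\<dots> = z \<odot> (f1 \<odot> g1) + (f2 \<odot> g1 + f \<odot> g2)" by (simp only: f(3) comp_lin comp_assoc add.assoc)
    finally have "(f \<odot> g) \<odot> z = \<dots>" .
    moreover have "f1 \<odot> g1 \<in> aspan G (s + t)" by (rule comp_C[OF f(1) g(1)])
    moreover have "f2 \<odot> g1 \<in> aspan G (s + t + w)" using comp_C[OF f(2) g(1)] by (simp add: algebra_simps)
    moreover have "f \<odot> g2 \<in> aspan G (s + t + w)" using comp_C[OF m(1) g(2)] by (simp add: algebra_simps)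
    ultimately show ?case using lin(1) by blast
  qed (rule gen)
  show ?thesis using f
  proof (induction rule: aspan_induct)
    case 0
    have "0 \<odot> z = z \<odot> 0 + 0" by (simp add: comp_lin z)
    then show ?case using lin(3) by blast
  next
    case (add f g)
    then obtain f1 f2 g1 g2 where *: "f1 \<in> aspan G t" "f2 \<in> aspan G (t + w)" "f \<odot> z = z \<odot> f1 + f2"
      "g1 \<in> aspan G t" "g2 \<in> aspan G (t + w)" "g \<odot> z = z \<odot> g1 + g2" by blast
    have "(f + g) \<odot> z = z \<odot> (f1 + g1) + (f2 + g2)" by (simp add: comp_lin z * algebra_simps)
    then show ?case using lin(1)[OF *(1,4)] lin(1)[OF *(2,5)] by blast
  next
    case (scale c f)
    then obtain f1 f2 where *: "f1 \<in> aspan G t" "f2 \<in> aspan G (t + w)" "f \<odot> z = z \<odot> f1 + f2" by blast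
    have "oscale c f \<odot> z = z \<odot> (oscale c f1) + oscale c f2" by (simp add: comp_lin z * os.scale_right_distrib)
    then show ?case using lin(2)[OF *(1)] lin(2)[OF *(2)] by blast
  next
    case (word s f)
    then obtain f1 f2 where *: "f1 \<in> aspan G s" "f2 \<in> aspan G (s + w)" "f \<odot> z = z \<odot> f1 + f2" using w by blast
    then show ?case using aspan_mono[OF word(1), of G] aspan_mono[of "s + w" "t + w" G] word(1) by (meson add_le_cancel_right in_mono)
  qed
qed

text \<open>As for \<open>pword_count\<close>, with composition as the only way to form longer
  words.\<close>

lemma aword_count:
  "\<exists>c. \<forall>(G :: ('k::field op \<times> real) set) \<mu>. finite G \<longrightarrow> card G \<le> 3 \<longrightarrow> 0 < \<mu>
     \<longrightarrow> (\<forall>(f, s)\<in>G. \<mu> \<le> s)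
     \<longrightarrow> finite {f. \<exists>s\<le>real k * \<mu>. aword G s f} \<and> card {f. \<exists>s\<le>real k * \<mu>. aword G s f} \<le> c"
proof (induction k)
  case 0
  have "\<not> aword G s f" if "0 < \<mu>" "\<forall>(f, s)\<in>G. \<mu> \<le> s" "s \<le> 0" for G and \<mu> s :: real and f :: "'k op"
  proof
    assume "aword G s f"
    hence "s > 0" by induction (use that in force)+
    thus False using that by simp
  qed
  hence e: "{f :: 'k op. \<exists>s\<le>0. aword G s f} = {}" if "0 < \<mu>" "\<forall>(f, s)\<in>G. \<mu> \<le> s"
    for \<mu> and G using that by blast
  show ?case
  proof (intro exI[of _ 0] allI impI)
    fix G :: "('k op \<times> real) set" and \<mu> :: real
    assume "0 < \<mu>" "\<forall>(f, s)\<in>G. \<mu> \<le> s"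
    from e[OF this] show "finite {f. \<exists>s\<le>real 0 * \<mu>. aword G s f} \<and>
        card {f. \<exists>s\<le>real 0 * \<mu>. aword G s f} \<le> 0"
      by (simp only: of_nat_0 mult_zero_left) simp
  qed
next
  case (Suc k)
  then obtain c where c: "\<And>(G :: ('k op \<times> real) set) \<mu>. finite G \<Longrightarrow> card G \<le> 3 \<Longrightarrow> 0 < \<mu>
     \<Longrightarrow> (\<forall>(f, s)\<in>G. \<mu> \<le> s)
     \<Longrightarrow> finite {f. \<exists>s\<le>real k * \<mu>. aword G s f} \<and> card {f. \<exists>s\<le>real k * \<mu>. aword G s f} \<le> c" by blast
  show ?case
  proof (rule exI[of _ "3 + c * c"], intro allI impI)
    fix G :: "('k op \<times> real) set" and \<mu> :: real
    assume G: "finite G" "card G \<le> 3" "0 < \<mu>" "\<forall>(f, s)\<in>G. \<mu> \<le> s"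
    define W where "W = {f. \<exists>s\<le>real k * \<mu>. aword G s f}"
    have W: "finite W" "card W \<le> c" using c[OF G] by (auto simp: W_def)
    have low: "\<mu> \<le> s" if "aword G s f" for s f
      using that by induction (use G(3,4) in force)+
    let ?T = "fst ` G \<union> (\<lambda>(f, g). f \<odot> g) ` (W \<times> W)"
    have WI: "f \<in> W" if "aword G s f" "s + \<mu> \<le> real (Suc k) * \<mu>" for s f
      using that unfolding W_def by (auto simp: algebra_simps intro!: exI[of _ s])
    have T: "f \<in> ?T" if s: "s \<le> real (Suc k) * \<mu>" and f: "aword G s f" for f s
      using f
    proof cases
      case gen
      hence "f \<in> fst ` G" by (rule image_eqI[of _ _ "(f, s)", rotated]) simp
      then show ?thesis by (rule UnI1)
    next
      case (comp s1 f1 t1 g1)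
      have "(f1, g1) \<in> W \<times> W"
        using WI[OF comp(3)] WI[OF comp(4)] low[OF comp(3)] low[OF comp(4)] s comp(1) by auto
      hence "f \<in> (\<lambda>(f, g). f \<odot> g) ` (W \<times> W)"
        by (rule image_eqI[rotated]) (simp add: comp(2))
      then show ?thesis by (rule UnI2)
    qed
    have sub: "{f. \<exists>s\<le>real (Suc k) * \<mu>. aword G s f} \<subseteq> ?T"
      using T by (intro subsetI) (elim CollectE exE conjE)
    have fT: "finite ?T" using W G by simp
    have c1: "card (fst ` G) \<le> 3" using card_image_le[OF G(1), of fst] G(2) by linarith
    have WW: "card (W \<times> W) \<le> c * c" using W by (simp add: card_cartesian_product mult_le_mono)
    have c2: "card ((\<lambda>(f, g). f \<odot> g) ` (W \<times> W)) \<le> c * c"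
      using card_image_le[of "W \<times> W" "\<lambda>(f, g). f \<odot> g"] W WW by fastforce
    have "card ?T \<le> 3 + c * c"
      by (intro order_trans[OF card_Un_le] add_mono c1 c2)
    thus "finite {f. \<exists>s\<le>real (Suc k) * \<mu>. aword G s f} \<and>
       card {f. \<exists>s\<le>real (Suc k) * \<mu>. aword G s f} \<le> 3 + c * c"
      using sub fT by (meson card_mono finite_subset order_trans)
  qed
qed

lemma proj_comp: "lop f \<Longrightarrow> proj \<odot> f = f" "lop f \<Longrightarrow> f \<odot> proj = f"
  by (simp_all add: fun_eq_iff[where 'a="nat set \<Rightarrow> 'a"] lopD)

lemma aword_unit:
  assumes "aword (insert (proj, 0) G) t f" "good_ops G"
  shows "(f = proj \<and> t = 0) \<or> aword G t f"
  using assms(1)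
proof induction
  case (gen f t)
  then show ?case by (auto intro: aword.gen)
next
  case (comp s f t g)
  have l: "lop h" if "aword G r h" for r h by (rule aword_lop[OF assms(2) that])
  note p = proj_comp(1)[OF lop_proj] proj_comp[OF l]
  from comp.IH show ?case
  proof (elim disjE conjE)
    assume "f = proj" "s = 0" "g = proj" "t = 0"
    thus ?case by (simp only: p) simp
  next
    assume "f = proj" "s = 0" "aword G t g"
    thus ?case by (simp only: p) simp
  next
    assume "aword G s f" "g = proj" "t = 0"
    thus ?case by (simp only: p) simp
  next
    assume "aword G s f" "aword G t g"
    thus ?case by (intro disjI2 aword.comp)
  qed
qed

lemma lm_lm_zero: "lm j \<odot> lm j = 0" and der_der_zero: "der j \<odot> der j = 0"
  by (auto simp: fun_eq_iff der_def zero_fun_apply)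

section \<open>The upper bound for the associative algebra\<close>

context cubic_root
begin

definition agens :: "nat \<Rightarrow> ('k::field op \<times> real) set" where
  "agens j = insert (proj, 0) ((\<lambda>i. (vo i, l ^ i)) ` {j, Suc j, j + 2})"

lemma good_agens: "good_ops (agens j)" "good_ops ((\<lambda>i. (vo i, l ^ i)) ` A)"
  by (auto simp: good_ops_def agens_def intro: lop_proj lop_vo)

lemma agensE:
  assumes "(g, s) \<in> agens j"
  obtains "g = proj" "s = 0" | i where "i \<in> {j, Suc j, j + 2}" "g = vo i" "s = l ^ i"
  using assms unfolding agens_def by blast

lemma proj_aspan: "0 \<le> t \<Longrightarrow> proj \<in> aspan (agens j) t"
  by (rule aword_aspan[OF aword.gen]) (auto simp: agens_def)

lemma vo_aspan: "i \<in> {j, Suc j, j + 2} \<Longrightarrow> vo i \<in> aspan (agens j) (l ^ i)"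
  by (rule aword_aspan[OF aword.gen order_refl], unfold agens_def, rule insertI2, rule imageI)

definition alevel :: "nat \<Rightarrow> real \<Rightarrow> 'k::field op set" where
  "alevel j = adjo (lm j) (- (l ^ j)) (aspan (agens j))"

text \<open>Normal form with x_j to the left of \<partial>_j. The derivative is adjoined first, so
  that \<partial>_j x_j = 1 - x_j \<partial>_j can serve as the commutation rule when x_j is
  adjoined.\<close>

definition aext :: "nat \<Rightarrow> real \<Rightarrow> 'k::field op set" where
  "aext j = adjo (lm j) (- (l ^ j)) (adjo (der j) (l ^ j) (alevel (Suc j)))"

lemma alevel_mono: "s \<le> t \<Longrightarrow> alevel j s \<subseteq> alevel j t"
  unfolding alevel_def by (rule adjo_mono[OF aspan_mono])

lemma aext_mono: "s \<le> t \<Longrightarrow> aext j s \<subseteq> aext j t"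
  unfolding aext_def by (intro adjo_mono alevel_mono)

lemma alevel_ops: "graded_ops (alevel j)"
proof -
  interpret graded_ops "aspan (agens j)" by (rule graded_ops_aspan[OF good_agens(1)])
  show ?thesis unfolding alevel_def
  proof (rule adjo[OF lop_lm lm_lm_zero])
    fix f :: "'a op" and t assume "f \<in> aspan (agens j) t"
    then show "\<exists>f'\<in>aspan (agens j) t. \<exists>f''\<in>aspan (agens j) (t + - (l ^ j)). f \<odot> lm j = lm j \<odot> f' + f''"
    proof (rule aspan_commute[OF good_agens(1) lop_lm, rotated])
      fix g :: "'a op" and s assume "(g, s) \<in> agens j"
      then show "\<exists>g'\<in>aspan (agens j) s. \<exists>g''\<in>aspan (agens j) (s + - (l ^ j)). g \<odot> lm j = lm j \<odot> g' + g''"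
      proof (cases rule: agensE)
        case 1
        have "proj \<odot> lm j = lm j \<odot> proj + (0 :: 'a op)"
          by (simp add: fun_eq_iff[where 'a="nat set \<Rightarrow> 'a"] op_apply proj_lin lm_proj)
        then show ?thesis unfolding 1 using proj_aspan[of 0] lin(3) by blast
      next
        case (2 i)
        show ?thesis
        proof (cases "i = j")
          case True
          \<comment> \<open>v_j x_j = 1 - x_j v_j, where the unit has exactly the weight 0 = l^j -
            l^j that is required.\<close>
          have "vo j \<odot> lm j = lm j \<odot> (- vo j) + (proj :: 'a op)"
            by (simp add: fun_eq_iff[where 'a="nat set \<Rightarrow> 'a"] op_apply vo_lm_self lin_simps)
          moreover have "proj \<in> aspan (agens j) (l ^ j + - (l ^ j))" by (simp add: proj_aspan)
          ultimately show ?thesis unfolding 2 True using lin(4)[OF vo_aspan[of j j]] by blast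
        next
          case False
          hence "vo i \<odot> lm j = lm j \<odot> (- vo i) + (0 :: 'a op)" using 2(1)
            by (auto simp: fun_eq_iff[where 'a="nat set \<Rightarrow> 'a"] op_apply vo_lm lin_simps)
          then show ?thesis unfolding 2 using lin(4)[OF vo_aspan[OF 2(1)]] lin(3) by blast
        qed
      qed
    qed
  qed
qed

text \<open>\<open>z\<close> is \<open>x_j\<close> or \<open>\<partial>_j\<close>, which anticommute with everything of larger index.\<close>
lemma alevel_commute:
  fixes z :: "'k::field op"
  assumes z: "lop z" and v: "\<And>i a. j < i \<Longrightarrow> vo i (z a) = - z (vo i a)"
    and x: "\<And>a. lm (Suc j) (z a) = - z (lm (Suc j) a)" and f: "f \<in> alevel (Suc j) t"
  shows "\<exists>f'\<in>alevel (Suc j) t. f \<odot> z = z \<odot> f'"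
proof -
  interpret S: graded_ops "aspan (agens (Suc j))" by (rule graded_ops_aspan[OF good_agens(1)])
  have s: "\<exists>f'\<in>aspan (agens (Suc j)) t. f \<odot> z = z \<odot> f'" if "f \<in> aspan (agens (Suc j)) t" for f t
    using that
  proof (induction rule: aspan_induct)
    case 0
    have "0 \<odot> z = z \<odot> 0" by (simp add: comp_lin z)
    then show ?case using S.lin(3) by blast
  next
    case (add f g)
    then obtain f' g' where *: "f' \<in> aspan (agens (Suc j)) t" "g' \<in> aspan (agens (Suc j)) t"
      "f \<odot> z = z \<odot> f'" "g \<odot> z = z \<odot> g'" by blast
    have "(f + g) \<odot> z = z \<odot> (f' + g')" by (simp add: comp_lin z *)
    then show ?case using S.lin(1)[OF *(1,2)] by blast
  next
    case (scale c f)
    then obtain f' where *: "f' \<in> aspan (agens (Suc j)) t" "f \<odot> z = z \<odot> f'" by blast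
    have "oscale c f \<odot> z = z \<odot> oscale c f'" by (simp add: comp_lin z *)
    then show ?case using S.lin(2)[OF *(1)] by blast
  next
    case (word s f)
    have "\<exists>f'\<in>aspan (agens (Suc j)) s. f \<odot> z = z \<odot> f'" using word(2)
    proof induction
      case (gen g s)
      then show ?case
      proof (cases rule: agensE)
        case 1
        have "proj \<odot> z = z \<odot> proj" using proj_comp[OF z] by simp
        then show ?thesis unfolding 1 using proj_aspan[of 0] by blast
      next
        case (2 i)
        have "vo i \<odot> z = z \<odot> (- vo i)" using 2(1)
          by (auto simp: fun_eq_iff[where 'a="nat set \<Rightarrow> 'k"] op_apply v lopD[OF z])
        then show ?thesis unfolding 2 using S.lin(4)[OF vo_aspan[OF 2(1)]] by blast
      qed
    next
      case (comp s f t g)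
      then obtain f' g' where *: "f' \<in> aspan (agens (Suc j)) s" "g' \<in> aspan (agens (Suc j)) t"
        "f \<odot> z = z \<odot> f'" "g \<odot> z = z \<odot> g'" by blast
      have "(f \<odot> g) \<odot> z = f \<odot> (g \<odot> z)" by (rule comp_assoc)
      also have "\<dots> = (f \<odot> z) \<odot> g'" unfolding *(4) by (rule comp_assoc[symmetric])
      also have "\<dots> = z \<odot> (f' \<odot> g')" unfolding *(3) by (rule comp_assoc)
      finally show ?case using S.comp[OF *(1,2)] by blast
    qed
    then show ?case using aspan_mono[OF word(1)] by blast
  qed
  obtain g h where gh: "f = g + lm (Suc j) \<odot> h" "g \<in> aspan (agens (Suc j)) t"
    "h \<in> aspan (agens (Suc j)) (t - - (l ^ Suc j))" using f unfolding alevel_def by (rule adjoE)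
  obtain g' where g': "g' \<in> aspan (agens (Suc j)) t" "g \<odot> z = z \<odot> g'" using s[OF gh(2)] by blast
  obtain h' where h': "h' \<in> aspan (agens (Suc j)) (t - - (l ^ Suc j))" "h \<odot> z = z \<odot> h'" using s[OF gh(3)] by blast
  have "f \<odot> z = z \<odot> (g' + lm (Suc j) \<odot> (- h'))"
  proof
    fix a
    show "(f \<odot> z) a = (z \<odot> (g' + lm (Suc j) \<odot> (- h'))) a"
      using fun_cong[OF g'(2), of a] fun_cong[OF h'(2), of a]
      by (simp add: gh(1) op_apply lopD[OF z] x lin_simps)
  qed
  moreover have "g' + lm (Suc j) \<odot> (- h') \<in> alevel (Suc j) t"
    unfolding alevel_def by (rule adjoI[of g' _ _ _ _ "lm (Suc j)", OF g'(1) S.lin(4)[OF h'(1)]])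
  ultimately show ?thesis by blast
qed

lemma alevel_lm: "f \<in> alevel (Suc j) t \<Longrightarrow> \<exists>f'\<in>alevel (Suc j) t. f \<odot> lm j = lm j \<odot> f'"
  by (rule alevel_commute[OF lop_lm vo_lm lm_lm]) simp_all

lemma alevel_der: "f \<in> alevel (Suc j) t \<Longrightarrow> \<exists>f'\<in>alevel (Suc j) t. f \<odot> der j = der j \<odot> f'"
  by (rule alevel_commute[OF lop_der vo_der]) (simp_all add: der_lm_other)

lemma aext_ops: "graded_ops (aext j :: real \<Rightarrow> 'k::field op set)"
proof -
  interpret L: graded_ops "alevel (Suc j) :: real \<Rightarrow> 'k op set" by (rule alevel_ops)
  have "graded_ops (adjo (der j) (l ^ j) (alevel (Suc j) :: real \<Rightarrow> 'k op set))"
  proof (rule L.adjo[OF lop_der der_der_zero])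
    fix f :: "'k op" and t assume "f \<in> alevel (Suc j) t"
    then obtain f' where "f' \<in> alevel (Suc j) t" "f \<odot> der j = der j \<odot> f' + 0" using alevel_der by fastforce
    then show "\<exists>f'\<in>alevel (Suc j) t. \<exists>f''\<in>alevel (Suc j) (t + l ^ j). f \<odot> der j = der j \<odot> f' + f''"
      using L.lin(3) by blast
  qed
  then interpret M: graded_ops "adjo (der j) (l ^ j) (alevel (Suc j) :: real \<Rightarrow> 'k op set)" .
  show ?thesis unfolding aext_def
  proof (rule M.adjo[OF lop_lm lm_lm_zero])
    fix f :: "'k op" and t assume "f \<in> adjo (der j) (l ^ j) (alevel (Suc j)) t"
    then obtain g h where f: "f = g + der j \<odot> h" "g \<in> alevel (Suc j) t" "h \<in> alevel (Suc j) (t - l ^ j)"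
      by (rule adjoE)
    obtain g' where g': "g' \<in> alevel (Suc j) t" "g \<odot> lm j = lm j \<odot> g'" using alevel_lm[OF f(2)] by blast
    obtain h' where h': "h' \<in> alevel (Suc j) (t - l ^ j)" "h \<odot> lm j = lm j \<odot> h'" using alevel_lm[OF f(3)] by blast
    \<comment> \<open>\<partial>_j h x_j = \<partial>_j x_j h' = h' - x_j \<partial>_j h'.\<close>
    have "f \<odot> lm j = lm j \<odot> (g' + der j \<odot> (- h')) + h'"
    proof
      fix a
      show "(f \<odot> lm j) a = (lm j \<odot> (g' + der j \<odot> (- h')) + h') a"
        using fun_cong[OF g'(2), of a] fun_cong[OF h'(2), of a]
        by (simp add: f(1) op_apply lin_simps der_lm_proj lopD(4)[OF L.lop[OF h'(1)]] algebra_simps)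
    qed
    moreover have "g' + der j \<odot> (- h') \<in> adjo (der j) (l ^ j) (alevel (Suc j)) t"
      by (rule adjoI[of g' _ _ _ _ "der j", OF g'(1) L.lin(4)[OF h'(1)]])
    moreover have "h' \<in> adjo (der j) (l ^ j) (alevel (Suc j)) (t + - (l ^ j))"
      by (rule adjo_base[OF _ L.lin(3) lop_der]) (use h'(1) in simp)
    ultimately show "\<exists>f'\<in>adjo (der j) (l ^ j) (alevel (Suc j)) t.
      \<exists>f''\<in>adjo (der j) (l ^ j) (alevel (Suc j)) (t + - (l ^ j)). f \<odot> lm j = lm j \<odot> f' + f''" by blast
  qed
qed

lemma aspan_alevel: "f \<in> aspan (agens j) t \<Longrightarrow> f \<in> alevel j t"
  unfolding alevel_def by (rule adjo_base[OF _ aspan_lin(3) lop_lm])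

lemma alevel_ext: assumes f: "f \<in> alevel (Suc j) t" shows "f \<in> aext j t"
proof -
  interpret L: graded_ops "alevel (Suc j)" by (rule alevel_ops)
  show ?thesis unfolding aext_def by (intro adjo_base f L.lin lop_lm lop_der)
qed

lemma agens_aext: assumes "(g, s) \<in> agens j" shows "g \<in> aext j s"
proof -
  interpret L: graded_ops "alevel (Suc j)" by (rule alevel_ops)
  from assms show ?thesis
  proof (cases rule: agensE)
    case 1
    then show ?thesis by (auto intro: alevel_ext aspan_alevel proj_aspan)
  next
    case (2 i)
    show ?thesis
    proof (cases "i = j")
      case True
      have "lm (Suc j) \<odot> vo (j + 3) \<in> alevel (Suc j) (l ^ (j + 3) - l ^ Suc j)"
        unfolding alevel_def by (rule adjo_comp[OF aspan_lin(3)]) (use vo_aspan[of "j + 3" "Suc j"] in simp)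
      also have "l ^ (j + 3) - l ^ Suc j = l ^ j - - (l ^ j)" using pow_3[of j] by simp
      finally have m: "lm (Suc j) \<odot> vo (j + 3) \<in> alevel (Suc j) (l ^ j - - (l ^ j))" .
      have p: "proj \<in> alevel (Suc j) (l ^ j - l ^ j)" by (simp add: aspan_alevel proj_aspan)
      have "vo j = der j \<odot> proj + lm j \<odot> (lm (Suc j) \<odot> vo (j + 3))"
      proof
        fix a show "vo j a = (der j \<odot> proj + lm j \<odot> (lm (Suc j) \<odot> vo (j + 3))) a"
          by (subst vo_rec) (simp add: op_apply der_proj)
      qed
      also have "\<dots> \<in> aext j (l ^ j)" unfolding aext_def
        by (intro adjoI[of "der j \<odot> proj" _ _ _ _ "lm j"] adjo_comp adjo_base m p L.lin lop_der)
      finally show ?thesis unfolding 2 True .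
    next
      case False
      then show ?thesis using 2 by (auto intro!: alevel_ext aspan_alevel vo_aspan)
    qed
  qed
qed

lemma alevel_step:
  assumes "f \<in> alevel j t"
  shows "\<exists>f0\<in>alevel (Suc j) (t + l ^ j). \<exists>f1\<in>alevel (Suc j) (t + l ^ j). \<exists>f2\<in>alevel (Suc j) (t + l ^ j).
    \<exists>f3\<in>alevel (Suc j) (t + l ^ j). f = f0 + lm j \<odot> f1 + der j \<odot> f2 + lm j \<odot> (der j \<odot> f3)"
proof -
  interpret L: graded_ops "alevel (Suc j)" by (rule alevel_ops)
  interpret E: graded_ops "aext j" by (rule aext_ops)
  have p: "g \<in> aext j s" if "g \<in> aspan (agens j) s" for g :: "'a op" and s
    by (rule E.aspan_mem[OF that agens_aext aext_mono])
  have dec: "\<exists>a0\<in>alevel (Suc j) s. \<exists>a1\<in>alevel (Suc j) (s + l ^ j). \<exists>a2\<in>alevel (Suc j) s. \<exists>a3\<in>alevel (Suc j) s.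
      g = a0 + der j \<odot> a2 + lm j \<odot> (a1 + der j \<odot> a3)"
    if g: "g \<in> aext j s" for g :: "'a op" and s
  proof -
    obtain p q where "g = p + lm j \<odot> q" "p \<in> adjo (der j) (l ^ j) (alevel (Suc j)) s"
      "q \<in> adjo (der j) (l ^ j) (alevel (Suc j)) (s - - (l ^ j))"
      using g unfolding aext_def by (rule adjoE)
    then obtain a0 a1 a2 a3 where a: "g = (a0 + der j \<odot> a2) + lm j \<odot> (a1 + der j \<odot> a3)"
      "a0 \<in> alevel (Suc j) s" "a2 \<in> alevel (Suc j) (s - l ^ j)"
      "a1 \<in> alevel (Suc j) (s - - (l ^ j))" "a3 \<in> alevel (Suc j) (s - - (l ^ j) - l ^ j)"
      by (elim adjoE) blast
    have "a2 \<in> alevel (Suc j) s" using a(3) alevel_mono[of "s - l ^ j" s] by auto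
    moreover have "s - - (l ^ j) = s + l ^ j" "s - - (l ^ j) - l ^ j = s" by simp_all
    ultimately show ?thesis using a by metis
  qed
  obtain g h where f: "f = g + lm j \<odot> h" "g \<in> aspan (agens j) t" "h \<in> aspan (agens j) (t - - (l ^ j))"
    using assms unfolding alevel_def by (rule adjoE)
  have h: "h \<in> aspan (agens j) (t + l ^ j)" using f(3) by simp
  obtain a0 a1 a2 a3 where a: "a0 \<in> alevel (Suc j) t" "a1 \<in> alevel (Suc j) (t + l ^ j)"
    "a2 \<in> alevel (Suc j) t" "a3 \<in> alevel (Suc j) t" "g = a0 + der j \<odot> a2 + lm j \<odot> (a1 + der j \<odot> a3)"
    using dec[OF p[OF f(2)]] by blast
  obtain b0 b1 b2 b3 where b: "b0 \<in> alevel (Suc j) (t + l ^ j)" "b2 \<in> alevel (Suc j) (t + l ^ j)"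
     "h = b0 + der j \<odot> b2 + lm j \<odot> (b1 + der j \<odot> b3)"
    using dec[OF p[OF h]] by blast
  have m: "a0 \<in> alevel (Suc j) (t + l ^ j)" "a2 \<in> alevel (Suc j) (t + l ^ j)" "a3 \<in> alevel (Suc j) (t + l ^ j)"
    using a alevel_mono[of t "t + l ^ j" "Suc j"] by auto
  \<comment> \<open>Here x_j x_j = 0 removes \<open>b1\<close> and \<open>b3\<close>, which keeps
    the bound at t + l^j as in \<open>level_step\<close>.\<close>
  have "f = a0 + lm j \<odot> (a1 + b0) + der j \<odot> a2 + lm j \<odot> (der j \<odot> (a3 + b2))"
  proof
    fix x show "f x = (a0 + lm j \<odot> (a1 + b0) + der j \<odot> a2 + lm j \<odot> (der j \<odot> (a3 + b2))) x"
      unfolding f(1) a(5) b(3) by (simp add: op_apply lin_simps algebra_simps)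
  qed
  with m(1) L.lin(1)[OF a(2) b(1)] m(2) L.lin(1)[OF m(3) b(2)] show ?thesis by blast
qed

lemma alevel_finite:
  "\<exists>c. \<forall>j t. t \<le> 3 * l ^ j \<longrightarrow> (\<exists>W. finite W \<and> card W \<le> c \<and> (alevel j t :: 'k::field op set) \<subseteq> os.span W)"
proof -
  obtain c where c: "\<And>(G :: ('k::field op \<times> real) set) \<mu>. finite G \<Longrightarrow> card G \<le> 3 \<Longrightarrow> 0 < \<mu>
     \<Longrightarrow> (\<forall>(f, s)\<in>G. \<mu> \<le> s)
     \<Longrightarrow> finite {f. \<exists>s\<le>real 4 * \<mu>. aword G s f} \<and> card {f. \<exists>s\<le>real 4 * \<mu>. aword G s f} \<le> c"
    using aword_count[of 4] by blast
  show ?thesis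
  proof (rule exI[of _ "Suc c + Suc c"], intro allI impI)
    fix j t assume t: "t \<le> 3 * l ^ j"
    define G :: "('k op \<times> real) set" where "G = (\<lambda>i. (vo i, l ^ i)) ` {j, Suc j, j + 2}"
    define W where "W = insert proj {f. \<exists>s\<le>real 4 * l ^ j. aword G s f}"
    have "card G \<le> card {j, Suc j, j + 2}" unfolding G_def by (rule card_image_le) simp
    hence "finite G" "card G \<le> 3" by (simp_all add: G_def)
    moreover have "l ^ j \<le> l ^ i" if "j \<le> i" for i
      using that by (intro power_increasing) (simp_all add: less_imp_le)
    hence "\<forall>(f, s)\<in>G. l ^ j \<le> s" unfolding G_def by (auto simp del: power_Suc)
    ultimately have "finite {f. \<exists>s\<le>real 4 * l ^ j. aword G s f}"
        "card {f. \<exists>s\<le>real 4 * l ^ j. aword G s f} \<le> c" using c[of G "l ^ j"] by auto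
    hence W: "finite W" "card W \<le> Suc c" unfolding W_def by (auto simp: card_insert_if)
    have good: "good_ops G" unfolding G_def by (rule good_agens)
    have p: "aspan (agens j) s \<subseteq> os.span W" if s: "s \<le> 4 * l ^ j" for s
    proof
      fix f :: "'k op" assume "f \<in> aspan (agens j) s"
      then show "f \<in> os.span W"
      proof (induction rule: aspan_induct)
        case (word r f)
        hence "aword (insert (proj, 0) G) r f" by (simp only: agens_def G_def)
        from aword_unit[OF this good] have "f \<in> W" unfolding W_def using word(1) s by auto
        then show ?case by (rule os.span_base)
      qed (rule os.span_zero os.span_add os.span_scale; assumption)+
    qed
    have "card (W \<union> (\<lambda>f. lm j \<odot> f) ` W) \<le> Suc c + Suc c"
      using card_image_le[OF W(1), of "\<lambda>f. lm j \<odot> f"] W(2) by (intro order_trans[OF card_Un_le] add_mono) auto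
    moreover have "(alevel j t :: 'k op set) \<subseteq> os.span (W \<union> (\<lambda>f. lm j \<odot> f) ` W)"
    proof
      fix f :: "'k op" assume "f \<in> alevel j t"
      then obtain g h where f: "f = g + lm j \<odot> h" "g \<in> aspan (agens j) t" "h \<in> aspan (agens j) (t - - (l ^ j))"
        unfolding alevel_def by (rule adjoE)
      have "l ^ j \<ge> 0" by simp
      hence "t \<le> 4 * l ^ j" "t - - (l ^ j) \<le> 4 * l ^ j" using t by linarith+
      hence "g \<in> os.span W" "h \<in> os.span W" using f p by blast+
      moreover from this(2) have "lm j \<odot> h \<in> os.span ((\<lambda>f. lm j \<odot> f) ` W)"
        by (rule os.span_image_additive[rotated 2]) (simp_all only: comp_lin(4,5)[OF lop_lm])
      ultimately show "f \<in> os.span (W \<union> (\<lambda>f. lm j \<odot> f) ` W)" unfolding f(1)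
        by (meson os.span_add os.span_mono in_mono sup_ge1 sup_ge2)
    qed
    ultimately show "\<exists>W. finite W \<and> card W \<le> Suc c + Suc c \<and> (alevel j t :: 'k op set) \<subseteq> os.span W"
      using W(1) by (intro exI[of _ "W \<union> (\<lambda>f. lm j \<odot> f) ` W"]) simp
  qed
qed

lemma aspan_upper:
  "\<exists>c. \<forall>j t. t \<le> l ^ j \<longrightarrow> (\<exists>W. finite W \<and> card W \<le> 4 ^ j * c \<and> (aspan (agens 0) t :: 'k::field op set) \<subseteq> os.span W)"
proof -
  obtain c where c: "\<And>j t. t \<le> 3 * l ^ j \<Longrightarrow> \<exists>W. finite W \<and> card W \<le> c \<and> (alevel j t :: 'k op set) \<subseteq> os.span W"
    using alevel_finite by blast
  have "\<exists>W. finite W \<and> card W \<le> 4 ^ j * c \<and> (alevel 0 t :: 'k op set) \<subseteq> os.span W"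
    if "t \<le> l ^ j" for j t
  proof (rule os.span_iterate[of "\<lambda>j f. lm j \<odot> f" "\<lambda>j f. der j \<odot> f" alevel])
    fix j t and f :: "'k op" assume "f \<in> alevel j t"
    thus "\<exists>f0\<in>alevel (Suc j) (t + l ^ j). \<exists>f1\<in>alevel (Suc j) (t + l ^ j). \<exists>f2\<in>alevel (Suc j) (t + l ^ j).
      \<exists>f3\<in>alevel (Suc j) (t + l ^ j). f = f0 + lm j \<odot> f1 + der j \<odot> f2 + lm j \<odot> (der j \<odot> f3)"
      by (rule alevel_step)
  qed (simp_all only: comp_lin(4,5)[OF lop_lm] comp_lin(4,5)[OF lop_der] c sum_pow that)
  moreover have "(aspan (agens 0) t :: 'k op set) \<subseteq> alevel 0 t" for t
    using aspan_alevel by blast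
  ultimately show ?thesis by (meson order_trans)
qed

end

section \<open>The lower bound for the associative algebra\<close>

abbreviation Qo :: "nat \<Rightarrow> nat set \<Rightarrow> 'k::field op" where
  "Qo \<equiv> qop (\<lambda>i. i)"

text \<open>One sign for all arguments. Which sign it is depends on how many factors x are present,
  and this is never tracked.\<close>

definition sign_comm :: "'k::field op \<Rightarrow> 'k op \<Rightarrow> bool" where
  "sign_comm T U \<longleftrightarrow> (\<forall>a. T (U a) = U (T a)) \<or> (\<forall>a. T (U a) = - U (T a))"

lemma sign_comm_clm:
  assumes "\<And>a. T (lm z a) = - lm z (T a)" shows "sign_comm T (clm b z)"
  using assms by (simp add: sign_comm_def clm_def)

lemma sign_comm_comp:
  assumes "sign_comm T U" "sign_comm T W" "\<And>a. U (- a) = - U a"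
  shows "sign_comm T (\<lambda>a. U (W a))"
  using assms(1,2)[unfolded sign_comm_def]
proof (elim disjE)
  assume *: "\<forall>a. T (U a) = U (T a)" "\<forall>a. T (W a) = W (T a)"
  show ?thesis unfolding sign_comm_def by (intro disjI1 allI) (simp only: *)
next
  assume *: "\<forall>a. T (U a) = U (T a)" "\<forall>a. T (W a) = - W (T a)"
  show ?thesis unfolding sign_comm_def by (intro disjI2 allI) (simp only: * assms(3))
next
  assume *: "\<forall>a. T (U a) = - U (T a)" "\<forall>a. T (W a) = W (T a)"
  show ?thesis unfolding sign_comm_def by (intro disjI2 allI) (simp only: *)
next
  assume *: "\<forall>a. T (U a) = - U (T a)" "\<forall>a. T (W a) = - W (T a)"
  show ?thesis unfolding sign_comm_def by (intro disjI1 allI) (simp only: * assms(3) minus_minus)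
qed

lemma sign_comm_qop:
  assumes "\<And>i a. i \<in> qset r \<Longrightarrow> T (lm i a) = - lm i (T a)"
  shows "sign_comm T (Qo r \<alpha>)"
  using assms
proof (induction r)
  case (Suc r)
  have 1: "sign_comm T (clm (2 * r \<in> \<alpha>) (2 * r))" "sign_comm T (clm (2 * r + 3 \<in> \<alpha>) (2 * r + 3))"
    by (rule sign_comm_clm, rule Suc.prems, simp add: qset_Suc)+
  have 2: "sign_comm T (Qo r \<alpha>)" by (rule Suc.IH, rule Suc.prems) (simp add: qset_Suc)
  have 3: "sign_comm T (\<lambda>a. clm (2 * r \<in> \<alpha>) (2 * r) (Qo r \<alpha> a))"
    by (rule sign_comm_comp[where U = "clm (2 * r \<in> \<alpha>) (2 * r)" and W = "Qo r \<alpha>", OF 1(1) 2])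
      (rule clm_lin)
  have "sign_comm T (\<lambda>a. clm (2 * r + 3 \<in> \<alpha>) (2 * r + 3) (clm (2 * r \<in> \<alpha>) (2 * r) (Qo r \<alpha> a)))"
    by (rule sign_comm_comp[where U = "clm (2 * r + 3 \<in> \<alpha>) (2 * r + 3)"
          and W = "\<lambda>a. clm (2 * r \<in> \<alpha>) (2 * r) (Qo r \<alpha> a)", OF 1(2) 3]) (rule clm_lin)
  thus ?case unfolding sign_comm_def qop.simps .
qed (simp add: sign_comm_def)

lemma clm_add: "clm b z (f + g) = clm b z f + clm b z g"
  by (simp add: clm_def lin_simps)

lemma qop_add: "qop x r \<alpha> (f + g) = qop x r \<alpha> f + qop x r \<alpha> g"
  by (induction r) (simp_all add: clm_add)

lemma proj_clm: "proj (clm b z f) = clm b z (proj f)"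
  by (simp add: clm_def proj_lin lm_proj)

lemma proj_qop: "proj (Qo r \<alpha> f) = Qo r \<alpha> (proj f)"
  by (induction r) (simp_all add: proj_clm)

lemma lop_qop: "lop f \<Longrightarrow> lop (Qo r \<alpha> \<odot> f)"
  by (simp add: lop_def qop_add qop_lin proj_qop)

lemma lop_clm: "lop f \<Longrightarrow> lop (clm b z \<odot> f)"
  by (simp add: lop_def clm_add clm_lin proj_clm)

section \<open>Supercommutators of the v_i\<close>

lemma vo_vo: "vo m (vo (Suc m) a) + vo (Suc m) (vo m a) = - lm m (vo (m + 3) a)"
proof -
  define c where "c = vo (m + 3) a"
  have pc: "proj c = c" unfolding c_def by (rule lopD[OF lop_vo])
  have 1: "vo m (vo (Suc m) a) = der m (vo (Suc m) a) + lm m (lm (Suc m) (vo (m + 3) (vo (Suc m) a)))"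
    by (rule vo_rec)
  have "vo (Suc m) (vo m a) = vo (Suc m) (der m a) + vo (Suc m) (lm m (lm (Suc m) c))"
    unfolding c_def by (subst vo_rec[of m]) (rule lopD[OF lop_vo])
  also have "\<dots> = - der m (vo (Suc m) a) - lm m (c - lm (Suc m) (der (Suc m) c))"
    by (simp add: vo_der vo_lm vo_lm_self pc lm_vo_self)
  finally have 2: "vo (Suc m) (vo m a) = \<dots>" .
  \<comment> \<open>The last summand starts with x_{m+1} and is killed by the x_{m+1} in front; the
    other one cancels against the term from v_{m+1} v_m.\<close>
  have "vo (m + 3) (vo (Suc m) a) = - der (Suc m) c - lm (Suc m) (vo (m + 3) (lm (Suc (Suc m)) (vo (Suc m + 3) a)))"
    unfolding c_def by (subst vo_rec[of "Suc m"]) (simp add: lopD[OF lop_vo] vo_der vo_lm)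
  hence 3: "lm (Suc m) (vo (m + 3) (vo (Suc m) a)) = - lm (Suc m) (der (Suc m) c)" by (simp add: lin_simps)
  show ?thesis unfolding 1 2 3 c_def[symmetric] by (simp add: lin_simps)
qed

text \<open>The associative form of \<open>br_Vg_lm\<close>: g = v_m x_m g + e x_m g v_m, where e is
  the sign with which g passes \<partial>_m. The right side involves only v_m and x_m g.\<close>

lemma recover:
  assumes g: "lop g" "sign_comm g (lm m)" and d: "\<And>a. g (der m a) = fscale e (der m (g a))" "e * e = 1"
  shows "g a = vo m (lm m (g a)) + fscale e (lm m (g (vo m a)))"
proof -
  have 1: "vo m (lm m (g a)) = g a - lm m (der m (g a))"
    by (simp add: vo_lm_self lm_vo_self lopD[OF g(1)])
  have "lm m (g (lm m b)) = 0" for b using g(2) by (auto simp: sign_comm_def lin_simps)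
  hence "lm m (g (vo m a)) = fscale e (lm m (der m (g a)))"
    by (subst vo_rec) (simp add: lopD[OF g(1)] d(1) lin_simps)
  thus ?thesis unfolding 1 by (simp add: d(2))
qed

definition agens1 :: "('k::field op \<times> real) set" where
  "agens1 = (\<lambda>i. (vo i, 1)) ` {..<3}"

lemma good_agens1: "good_ops agens1"
  by (auto simp: good_ops_def agens1_def intro: lop_vo)

interpretation A1: graded_ops "aspan agens1"
  by (rule graded_ops_aspan[OF good_agens1])

abbreviation N1 :: "'k::field itself \<Rightarrow> real \<Rightarrow> 'k op set" where
  "N1 T \<equiv> aspan agens1"

lemma recover_mem:
  assumes g: "lop g" "sign_comm g (lm m)" "sign_comm g (der m)"
    and m: "lm m \<odot> g \<in> N1 TYPE('k::field) s" "vo m \<in> N1 TYPE('k) t"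
  shows "g \<in> N1 TYPE('k) (t + s)"
proof -
  obtain e where e: "\<And>a. g (der m a) = fscale e (der m (g a))" "e * e = 1"
  proof (cases "\<forall>a. g (der m a) = der m (g a)")
    case True
    then show ?thesis using that[of 1] by simp
  next
    case False
    hence *: "g (der m a) = - der m (g a)" for a using g(3) unfolding sign_comm_def by blast
    show ?thesis
      by (rule that[of "-1"]) (simp_all only: * uminus_eq_fscale[symmetric] mult_minus_left mult_1 minus_minus)
  qed
  have "g = vo m \<odot> (lm m \<odot> g) + oscale e ((lm m \<odot> g) \<odot> vo m)"
  proof
    fix a show "g a = (vo m \<odot> (lm m \<odot> g) + oscale e ((lm m \<odot> g) \<odot> vo m)) a"
      using recover[OF g(1,2) e, of a] by (simp add: op_apply)
  qed
  also have "\<dots> \<in> N1 TYPE('k) (t + s)"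
    using A1.comp[OF m(2,1)] A1.comp[OF m] by (intro A1.lin) (simp_all add: add.commute)
  finally show ?thesis .
qed

lemma lm_vo_mem:
  assumes "vo m \<in> N1 TYPE('k::field) (real (glen m))" "vo (Suc m) \<in> N1 TYPE('k) (real (glen (Suc m)))"
  shows "lm m \<odot> vo (m + 3) \<in> N1 TYPE('k) (real (glen m + glen (Suc m)))"
proof -
  have "lm m \<odot> vo (m + 3) = - (vo m \<odot> vo (Suc m) + vo (Suc m) \<odot> vo m :: 'k op)"
  proof
    fix a :: "nat set \<Rightarrow> 'k"
    show "(lm m \<odot> vo (m + 3)) a = (- (vo m \<odot> vo (Suc m) + vo (Suc m) \<odot> vo m)) a"
      using vo_vo[of m a] by (simp only: comp_apply op_apply minus_minus)
  qed
  also have "\<dots> \<in> N1 TYPE('k) (real (glen m + glen (Suc m)))"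
    using A1.comp[OF assms] A1.comp[OF assms(2,1)] by (intro A1.lin) (simp_all add: add.commute)
  finally show ?thesis .
qed

lemma vo_mem: "vo i \<in> N1 TYPE('k::field) (real (glen i))"
proof (induction i rule: less_induct)
  case (less i)
  show ?case
  proof (cases "i < 3")
    case True
    then show ?thesis by (intro aword_aspan[OF aword.gen]) (auto simp: agens1_def glen_small)
  next
    case False
    then obtain m where m: "i = m + 3" by (metis add.commute le_Suc_ex not_less)
    have v: "vo m \<in> N1 TYPE('k) (real (glen m))" "vo (Suc m) \<in> N1 TYPE('k) (real (glen (Suc m)))"
      using less[of m] less[of "Suc m"] m by auto
    have "vo (m + 3) \<in> N1 TYPE('k) (real (glen m) + real (glen m + glen (Suc m)))"
      by (rule recover_mem[OF lop_vo _ _ lm_vo_mem[OF v] v(1)]) (auto simp: sign_comm_def vo_lm vo_der)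
    then show ?thesis unfolding m glen_rec by (simp add: algebra_simps)
  qed
qed

lemma sign_comm_sym: "sign_comm T U \<Longrightarrow> sign_comm U T"
  unfolding sign_comm_def by (metis minus_minus)

lemma sign_comm_vo:
  assumes "sign_comm T U" "\<And>a. U (- a) = - U a" "\<And>a. T (vo i a) = - vo i (T a)"
  shows "sign_comm T (U \<odot> vo i)"
  unfolding comp_def by (rule sign_comm_comp[OF assms(1) _ assms(2)]) (simp add: sign_comm_def assms(3))

text \<open>The argument of \<open>qop_mem\<close> with supercommutators. As signs are not tracked,
  the two orders of the product, \<open>?P\<close> and \<open>?R\<close>, are shown separately to
  lie in the span.\<close>

lemma qop_amem: "Qo r \<alpha> \<odot> vo (2 * r + 4) \<in> N1 TYPE('k::field) (real (glen (2 * r + 4)))"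
proof (induction r)
  case 0
  have "Qo 0 \<alpha> \<odot> vo 4 = (vo 4 :: 'k op)" by (simp add: fun_eq_iff)
  then show ?case using vo_mem[of 4, where 'k='k] by simp
next
  case (Suc r)
  define m where "m = 2 * r + 3"
  define c :: "'k op" where "c = clm (2 * r \<in> \<alpha>) (2 * r)"
  define q :: "'k op" where "q = Qo r \<alpha>"
  have m: "2 * r + 4 = Suc m" "2 * Suc r + 4 = m + 3" by (auto simp: m_def)
  define h0 where "h0 = c \<odot> (q \<odot> vo (m + 3))"
  have neg: "c (- a) = - c a" "q (- a) = - q a" for a by (simp_all add: c_def q_def clm_lin qop_lin)
  have add: "c (a + b) = c a + c b" "q (a + b) = q a + q b" for a b
    by (simp_all add: c_def q_def clm_add qop_add)
  have g: "q \<odot> vo (Suc m) \<in> N1 TYPE('k) (real (glen (Suc m)))" using Suc by (simp only: m q_def)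
  have "real (glen (2 * r) + glen (Suc (2 * r))) \<le> real (glen m)" unfolding m_def glen_rec by simp
  hence "lm (2 * r) \<odot> vo m \<in> N1 TYPE('k) (real (glen m))"
    using lm_vo_mem[OF vo_mem[of "2 * r", where 'k='k] vo_mem] aspan_mono unfolding m_def by blast
  moreover have "c \<odot> vo m = (if 2 * r \<in> \<alpha> then lm (2 * r) \<odot> vo m else vo m)"
    by (simp add: c_def clm_def fun_eq_iff)
  ultimately have e: "c \<odot> vo m \<in> N1 TYPE('k) (real (glen m))" using vo_mem[of m, where 'k='k] by simp
  have less: "i < m" "2 * r \<noteq> i" if "i \<in> qset r" for i
    using qset_less[OF that] qset_fresh[of r] that by (auto simp: m_def)
  have cm: "sign_comm (vo n) c" "sign_comm (vo n) q" if "m \<le> n" for n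
    unfolding c_def q_def using that less
    by (intro sign_comm_clm vo_lm sign_comm_qop, fastforce simp: m_def)+
  have cq: "sign_comm q c"
  proof (rule sign_comm_sym, cases "2 * r \<in> \<alpha>")
    case True
    show "sign_comm c q" unfolding q_def
      by (rule sign_comm_qop) (simp add: c_def clm_def True less lm_lm[of "2 * r"])
  qed (simp add: c_def clm_def sign_comm_def)
  have lc: "sign_comm (lm m) c" "sign_comm (lm m) q"
    unfolding c_def q_def using less
    by (intro sign_comm_clm lm_lm sign_comm_qop, fastforce simp: m_def)+
  have dc: "sign_comm (der m) c" "sign_comm (der m) q"
    unfolding c_def q_def using less
    by (intro sign_comm_clm der_lm_other sign_comm_qop, fastforce simp: m_def)+
  let ?P = "c \<odot> (q \<odot> (vo m \<odot> vo (Suc m)))" and ?R = "c \<odot> (q \<odot> (vo (Suc m) \<odot> vo m))"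
  have P: "?P = (c \<odot> vo m) \<odot> (q \<odot> vo (Suc m)) \<or> ?P = - ((c \<odot> vo m) \<odot> (q \<odot> vo (Suc m)))"
    using cm(2)[of m] by (auto simp: sign_comm_def fun_eq_iff[where 'a="nat set \<Rightarrow> 'k"] op_apply neg)
  have R: "?R = (q \<odot> vo (Suc m)) \<odot> (c \<odot> vo m) \<or> ?R = - ((q \<odot> vo (Suc m)) \<odot> (c \<odot> vo m))"
    using cm(1)[of "Suc m"] cq by (auto simp: sign_comm_def fun_eq_iff[where 'a="nat set \<Rightarrow> 'k"] op_apply neg)
  have PM: "?P \<in> N1 TYPE('k) (real (glen m) + real (glen (Suc m)))"
    using P A1.comp[OF e g] A1.lin(4) by fastforce
  have RM: "?R \<in> N1 TYPE('k) (real (glen m) + real (glen (Suc m)))"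
    using R A1.comp[OF g e] A1.lin(4) by (fastforce simp: add.commute)
  \<comment> \<open>Apply c and q to v_m v_{m+1} + v_{m+1} v_m = -x_m v_{m+3} and move x_m to the
    front.\<close>
  have "lm m \<odot> h0 = ?P + ?R \<or> lm m \<odot> h0 = - (?P + ?R)"
  proof -
    have s: "c (q (lm m (vo (m + 3) a))) = - (c (q (vo m (vo (Suc m) a))) + c (q (vo (Suc m) (vo m a))))" for a
    proof -
      have "c (q (vo m (vo (Suc m) a))) + c (q (vo (Suc m) (vo m a))) = c (q (vo m (vo (Suc m) a) + vo (Suc m) (vo m a)))"
        by (simp only: add)
      also have "\<dots> = - c (q (lm m (vo (m + 3) a)))" by (simp only: vo_vo neg)
      finally show ?thesis by (simp only: minus_minus)
    qed
    have "(\<forall>y. lm m (c (q y)) = c (q (lm m y))) \<or> (\<forall>y. lm m (c (q y)) = - c (q (lm m y)))"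
      using lc by (auto simp: sign_comm_def neg)
    thus ?thesis
    proof
      assume t: "\<forall>y. lm m (c (q y)) = c (q (lm m y))"
      have "lm m \<odot> h0 = - (?P + ?R)"
      proof
        fix a show "(lm m \<odot> h0) a = (- (?P + ?R)) a"
          by (simp only: h0_def comp_apply op_apply t s)
      qed
      thus ?thesis ..
    next
      assume t: "\<forall>y. lm m (c (q y)) = - c (q (lm m y))"
      have "lm m \<odot> h0 = ?P + ?R"
      proof
        fix a show "(lm m \<odot> h0) a = (?P + ?R) a"
          by (simp only: h0_def comp_apply op_apply t s minus_minus)
      qed
      thus ?thesis ..
    qed
  qed
  hence h1: "lm m \<odot> h0 \<in> N1 TYPE('k) (real (glen m) + real (glen (Suc m)))"
    using A1.lin(1)[OF PM RM] A1.lin(4) by fastforce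
  have l0: "lop h0" unfolding h0_def c_def q_def by (intro lop_clm lop_qop lop_vo)
  have s1: "sign_comm h0 (lm m)"
  proof (rule sign_comm_sym)
    have "sign_comm (lm m) (c \<odot> (q \<odot> vo (m + 3)))"
      unfolding comp_assoc[symmetric]
      by (rule sign_comm_vo) (use sign_comm_comp[OF lc neg(1)] in \<open>auto simp: comp_def neg vo_lm\<close>)
    thus "sign_comm (lm m) h0" by (simp only: h0_def)
  qed
  have s2: "sign_comm h0 (der m)"
  proof (rule sign_comm_sym)
    have "sign_comm (der m) (c \<odot> (q \<odot> vo (m + 3)))"
      unfolding comp_assoc[symmetric]
      by (rule sign_comm_vo) (use sign_comm_comp[OF dc neg(1)] in \<open>auto simp: comp_def neg vo_der\<close>)
    thus "sign_comm (der m) h0" by (simp only: h0_def)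
  qed
  have h: "h0 \<in> N1 TYPE('k) (real (glen (m + 3)))"
    using recover_mem[OF l0 s1 s2 h1 vo_mem] by (simp add: glen_rec algebra_simps)
  have "real (glen m) + real (glen (Suc m)) \<le> real (glen (m + 3))" by (simp add: glen_rec)
  hence "lm m \<odot> h0 \<in> N1 TYPE('k) (real (glen (m + 3)))" using h1 aspan_mono by blast
  moreover have e: "Qo (Suc r) \<alpha> \<odot> vo (m + 3) = (if m \<in> \<alpha> then lm m \<odot> h0 else h0)"
    by (simp add: fun_eq_iff[where 'a="nat set \<Rightarrow> 'k"] h0_def c_def q_def m_def clm_def)
  ultimately show ?case using h unfolding m(2) e by (cases "m \<in> \<alpha>") (simp_all only: if_True if_False)
qed

text \<open>The v_i are multiplied on the right, so that derivatives act first and the factors x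
  last; the leading part is then a normally ordered monomial.\<close>

fun rv :: "nat \<Rightarrow> nat set \<Rightarrow> 'k::field op \<Rightarrow> 'k op" where
  "rv 0 \<beta> t = t"
| "rv (Suc n) \<beta> t = (if n \<in> \<beta> then rv n \<beta> t \<odot> vo n else rv n \<beta> t)"

fun vv :: "nat \<Rightarrow> nat set \<Rightarrow> 'k::field op" where
  "vv 0 \<beta> a = a"
| "vv (Suc n) \<beta> a = vv n \<beta> (if n \<in> \<beta> then vo n a else a)"

fun vd :: "nat \<Rightarrow> nat set \<Rightarrow> 'k::field op" where
  "vd 0 \<beta> a = a"
| "vd (Suc n) \<beta> a = vd n \<beta> (if n \<in> \<beta> then der n a else a)"

lemma rv_vv: "rv n \<beta> t a = t (vv n \<beta> a)"
  by (induction n arbitrary: a) auto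

lemma rv_mem:
  assumes "f \<in> N1 TYPE('k::field) t"
  shows "rv n \<beta> f \<in> N1 TYPE('k) (t + (\<Sum>i<n. real (glen i)))"
proof (induction n)
  case (Suc n)
  have "rv n \<beta> f \<odot> vo n \<in> N1 TYPE('k) (t + (\<Sum>i<n. real (glen i)) + real (glen n))"
    by (rule A1.comp[OF Suc vo_mem])
  moreover have "rv n \<beta> f \<in> N1 TYPE('k) (t + (\<Sum>i<n. real (glen i)) + real (glen n))"
    by (rule subsetD[OF aspan_mono Suc]) simp
  ultimately show ?case by (simp add: algebra_simps)
qed (use assms in simp)

section \<open>Lowest-degree parts under derivatives and v_i\<close>

lemma lead_der: assumes "lead d a b" shows "lead (d - 1) (der z a) (der z b)"
proof -
  have "der z a R = der z b R" if "finite R" "int (card R) \<le> d - 1" for R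
  proof (rule der_cong)
    have "int (card (insert z R)) \<le> d" using that card_insert_le_m1[of "Suc (card R)" R z] by (simp add: card_insert_if)
    thus "a (insert z R) = b (insert z R)" using assms that(1) by (simp add: lead_def)
  qed
  moreover have "int (card R) = d - 1" if "der z b R \<noteq> 0" for R
  proof -
    have R: "finite R" "z \<notin> R" "b (insert z R) \<noteq> 0" using der_nonzeroD[OF that] by auto
    hence "int (card (insert z R)) = d" using assms unfolding lead_def by blast
    thus ?thesis using R by simp
  qed
  ultimately show ?thesis unfolding lead_def by (blast dest: der_nonzeroD)
qed

lemma low_der: assumes "low d a" shows "low (d - 1) (der z a)"
  unfolding low_def
proof (intro allI impI, rule ccontr)
  fix R assume R: "finite R" "int (card R) < d - 1" "der z a R \<noteq> 0"
  hence "z \<notin> R" "a (insert z R) \<noteq> 0" using der_nonzeroD[OF R(3)] by auto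
  moreover have "int (card (insert z R)) < d" using R \<open>z \<notin> R\<close> by simp
  ultimately show False using assms R(1) by (auto simp: low_def)
qed

lemma low_vo: assumes "low d a" shows "low (d - 1) (vo i a)"
  unfolding low_def
proof (intro allI impI)
  fix R :: "nat set" assume R: "finite R" "int (card R) < d - 1"
  have "pl i k (der (i + 3 * k) a) R = 0" for k
    using low_pl[OF low_der[OF assms], of k i "i + 3 * k"] R by (auto simp: low_def)
  thus "vo i a R = 0" by (simp add: vo_def vo_upto_def sum_fun_apply)
qed

text \<open>\<partial>_n lowers the degree by one, while the tail of v_n carries two extra factors
  x.\<close>

lemma lead_vo: assumes "lead d a b" shows "lead (d - 1) (vo n a) (der n b)"
proof -
  have "low (d - 1 + 1 + 1) (lm n (lm (Suc n) (vo (n + 3) a)))"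
    by (intro low_lm low_vo low_lead[OF assms])
  hence "low (d - 1 + 1) (lm n (lm (Suc n) (vo (n + 3) a)))" by (auto simp: low_def)
  from lead_add_low[OF lead_der[OF assms] this, of n] show ?thesis by (subst vo_rec)
qed

lemma lead_vv:
  assumes "lead d a b"
  shows "lead (d - int (card (\<beta> \<inter> {..<n}))) (vv n \<beta> a) (vd n \<beta> b)"
  using assms
proof (induction n arbitrary: d a b)
  case (Suc n)
  show ?case using Suc.IH[OF lead_vo[OF Suc.prems], of n] Suc.IH[OF Suc.prems]
    by (simp add: Int_lessThan_Suc algebra_simps)
qed simp

lemma pure_der:
  assumes "pure S f" "finite S"
  shows "if z \<in> S then pure (S - {z}) (der z f) else der z f = 0"
proof -
  obtain c where c: "c \<noteq> 0" "f = fscale c (mono_at S)" using assms(1) by (auto simp: pure_def)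
  show ?thesis
  proof (cases "z \<in> S")
    case True
    have "der z f = fscale (c * sg {z} (S - {z})) (mono_at (S - {z}))"
      using assms(2) True by (auto simp: c(2) der_def fscale_def mono_at_def fun_eq_iff)
    thus ?thesis unfolding pure_def using c(1) True
      by simp (intro exI[of _ "c * sg {z} (S - {z})"], simp)
  next
    case False
    thus ?thesis by (auto simp: c(2) der_def fscale_def mono_at_def fun_eq_iff zero_fun_apply)
  qed
qed

lemma vd_zero: "vd n \<beta> 0 = 0"
  by (induction n) (simp_all add: lin_simps)

lemma pure_vd:
  assumes "pure S b" "finite S"
  shows "if \<beta> \<inter> {..<n} \<subseteq> S then pure (S - \<beta> \<inter> {..<n}) (vd n \<beta> b) else vd n \<beta> b = 0"
  using assms
proof (induction n arbitrary: S b)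
  case (Suc n)
  show ?case
  proof (cases "n \<in> \<beta>")
    case True
    show ?thesis
    proof (cases "n \<in> S")
      case True
      hence "pure (S - {n}) (der n b)" using pure_der[OF Suc.prems, of n] by simp
      from Suc.IH[OF this] Suc.prems(2)
      have A: "if \<beta> \<inter> {..<n} \<subseteq> S - {n} then pure (S - {n} - \<beta> \<inter> {..<n}) (vd n \<beta> (der n b)) else vd n \<beta> (der n b) = 0"
        by simp
      have B: "\<beta> \<inter> {..<n} \<subseteq> S - {n} \<longleftrightarrow> \<beta> \<inter> {..<Suc n} \<subseteq> S" "S - {n} - \<beta> \<inter> {..<n} = S - \<beta> \<inter> {..<Suc n}"
        using True \<open>n \<in> \<beta>\<close> by (auto simp: Int_lessThan_Suc)
      from A show ?thesis unfolding B using \<open>n \<in> \<beta>\<close> by simp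
    next
      case False
      hence "der n b = 0" using pure_der[OF Suc.prems, of n] by simp
      moreover have "\<not> \<beta> \<inter> {..<Suc n} \<subseteq> S" using False \<open>n \<in> \<beta>\<close> by auto
      ultimately show ?thesis using \<open>n \<in> \<beta>\<close> by (simp add: vd_zero)
    qed
  next
    case False
    then show ?thesis using Suc.IH[OF Suc.prems] by (simp add: Int_lessThan_Suc)
  qed
qed simp

section \<open>Matrices of operators\<close>

text \<open>On these elements the sum over k in \<open>vop\<close> is finite, and \<open>vop\<close>
  agrees with \<open>vo\<close>. Matrices see operators only through their values on monomials,
  which are of this kind.\<close>

definition poly :: "(nat set \<Rightarrow> 'k::field) \<Rightarrow> bool" where
  "poly a \<longleftrightarrow> finite {R. a R \<noteq> 0} \<and> fin_supp a"

lemma polyI: "{R. b R \<noteq> 0} \<subseteq> X \<Longrightarrow> finite X \<Longrightarrow> fin_supp b \<Longrightarrow> poly b"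
  unfolding poly_def by (blast intro: finite_subset)

lemma poly_lm: assumes "poly a" shows "poly (lm z a)"
proof (rule polyI)
  show "{R. lm z a R \<noteq> 0} \<subseteq> insert z ` {R. a R \<noteq> 0}"
  proof
    fix R assume "R \<in> {R. lm z a R \<noteq> 0}"
    hence "lm z a R \<noteq> 0" by simp
    note R = lm_nonzeroD[OF this, THEN conjunct2, THEN conjunct1] lm_nonzeroD[OF this, THEN conjunct2, THEN conjunct2]
    have "R = insert z (R - {z})" by (rule insert_Diff[OF R(1), symmetric])
    thus "R \<in> insert z ` {R. a R \<noteq> 0}" by (rule image_eqI) (simp add: R(2))
  qed
  show "finite (insert z ` {R. a R \<noteq> 0})" using assms unfolding poly_def by (intro finite_imageI) blast
qed (simp add: fin_supp_def)

lemma poly_der: assumes "poly a" shows "poly (der z a)"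
proof (rule polyI)
  show "{R. der z a R \<noteq> 0} \<subseteq> (\<lambda>R. R - {z}) ` {R. a R \<noteq> 0}"
  proof
    fix R assume "R \<in> {R. der z a R \<noteq> 0}"
    hence "der z a R \<noteq> 0" by simp
    note R = der_nonzeroD[OF this, THEN conjunct2, THEN conjunct1] der_nonzeroD[OF this, THEN conjunct2, THEN conjunct2]
    have "R = insert z R - {z}" using R(1) by simp
    thus "R \<in> (\<lambda>R. R - {z}) ` {R. a R \<noteq> 0}" by (rule image_eqI) (simp add: R(2))
  qed
  show "finite ((\<lambda>R. R - {z}) ` {R. a R \<noteq> 0})" using assms unfolding poly_def by (intro finite_imageI) blast
qed (simp add: fin_supp_def)

lemma poly_0: "poly 0" by (simp add: poly_def fin_supp_def zero_fun_apply)

lemma poly_add: assumes "poly a" "poly b" shows "poly (a + b)"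
proof (rule polyI)
  show "{R. (a + b) R \<noteq> 0} \<subseteq> {R. a R \<noteq> 0} \<union> {R. b R \<noteq> 0}" by (auto simp: plus_fun_apply)
  show "finite ({R. a R \<noteq> 0} \<union> {R. b R \<noteq> 0})" using assms unfolding poly_def by blast
  show "fin_supp (a + b)" using assms unfolding poly_def fin_supp_def by (simp add: plus_fun_apply)
qed

lemma poly_sum: "(\<And>i. i \<in> A \<Longrightarrow> poly (f i)) \<Longrightarrow> poly (\<Sum>i\<in>A. f i)"
  by (induction A rule: infinite_finite_induct) (auto intro: poly_0 poly_add)

lemma poly_proj: "poly a \<Longrightarrow> proj a = a"
  by (auto simp: poly_def fin_supp_def proj_def fun_eq_iff)

lemma poly_pl: "poly a \<Longrightarrow> poly (pl i k a)"
  by (induction k arbitrary: i) (simp_all add: poly_proj poly_lm)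

lemma poly_mono_at: "finite S \<Longrightarrow> poly (mono_at S)"
  unfolding poly_def fin_supp_def mono_at_def by (auto split: if_splits)

lemma vo_poly:
  assumes "poly a"
  shows "finite {k. der (i + 3 * k) a \<noteq> 0}"
    "vo i a = (\<Sum>k | der (i + 3 * k) a \<noteq> 0. pl i k (der (i + 3 * k) a))"
proof -
  have fin: "finite (\<Union>{R. a R \<noteq> 0})" using assms unfolding poly_def fin_supp_def by auto
  have "{k. der (i + 3 * k) a \<noteq> 0} \<subseteq> (\<lambda>k. i + 3 * k) -` \<Union>{R. a R \<noteq> 0}"
  proof
    fix k assume "k \<in> {k. der (i + 3 * k) a \<noteq> 0}"
    then obtain R where "der (i + 3 * k) a R \<noteq> 0" by (auto simp: fun_eq_iff zero_fun_apply)
    thus "k \<in> (\<lambda>k. i + 3 * k) -` \<Union>{R. a R \<noteq> 0}" using der_nonzeroD[of "i + 3 * k" a R] by auto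
  qed
  moreover have "finite ((\<lambda>k. i + 3 * k) -` \<Union>{R. a R \<noteq> 0})"
    by (rule finite_vimageI[OF fin]) (auto simp: inj_on_def)
  ultimately show K: "finite {k. der (i + 3 * k) a \<noteq> 0}" by (rule finite_subset)
  show "vo i a = (\<Sum>k | der (i + 3 * k) a \<noteq> 0. pl i k (der (i + 3 * k) a))" (is "_ = ?S")
  proof
    fix R :: "nat set"
    obtain M where M: "\<forall>k\<in>{k. der (i + 3 * k) a \<noteq> 0}. k < M"
      using K[unfolded finite_nat_set_iff_bounded] ..
    have sub: "{k. der (i + 3 * k) a \<noteq> 0} \<subseteq> {..max M (card R)}"
    proof
      fix k assume "k \<in> {k. der (i + 3 * k) a \<noteq> 0}"
      hence "k < M" by (rule M[rule_format])
      thus "k \<in> {..max M (card R)}" by simp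
    qed
    have z: "\<forall>k\<in>{..max M (card R)} - {k. der (i + 3 * k) a \<noteq> 0}. pl i k (der (i + 3 * k) a) R = 0"
      by (simp add: pl_lin zero_fun_apply)
    have "vo i a R = vo_upto (max M (card R)) i a R" by (rule vo_eq_upto) simp
    also have "\<dots> = ?S R" unfolding vo_upto_def sum_fun_apply
      by (rule sum.mono_neutral_right[OF _ sub z]) simp
    finally show "vo i a R = ?S R" .
  qed
qed

lemma poly_vo: "poly a \<Longrightarrow> poly (vo i a)"
  unfolding vo_poly(2) by (intro poly_sum poly_pl poly_der)

lemma gmono_eq: "gmono S = mono_at S"
  by (simp add: gmono_def mono_at_def fun_eq_iff)

lemma gmul_eq: "gmul a b = mul a b"
proof
  fix R
  show "gmul a b R = mul a b R"
  proof (cases "finite R")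
    case True
    have "(-1) ^ inv_count A (R - A) = (sg A (R - A) :: 'a)" if "A \<in> Pow R" for A
      using that True finite_subset[of A R] by (simp add: sg_inv_count)
    thus ?thesis using True by (simp add: gmul_def mul_def)
  qed (simp add: gmul_def)
qed

lemma gder_eq: "fin_supp a \<Longrightarrow> gder j a = der j a"
  by (auto simp: gder_def der_def fun_eq_iff sg_single fin_supp_def)

lemma lm_mono_at: "finite S \<Longrightarrow> (\<And>b. b \<in> S \<Longrightarrow> z < b) \<Longrightarrow> lm z (mono_at S) = mono_at (insert z S)"
proof
  fix R assume S: "finite S" "\<And>b. b \<in> S \<Longrightarrow> z < b"
  have "z \<notin> S" using S(2) by blast
  thus "lm z (mono_at S) R = mono_at (insert z S) R"
    using S by (auto simp: lm_def mono_at_def sg_one)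
qed

lemma mul_pairset: "fin_supp b \<Longrightarrow> mul (mono_at (pairset i k)) b = pl i k b"
proof (induction k arbitrary: i)
  case 0
  then show ?case by (auto simp: mul_one proj_def fin_supp_def fun_eq_iff)
next
  case (Suc k)
  have g: "i + 3 \<le> a" if "a \<in> pairset (i + 3) k" for a using pairset_less[OF that] by simp
  have 1: "lm (Suc i) (mono_at (pairset (i + 3) k)) = (mono_at (insert (Suc i) (pairset (i + 3) k)) :: nat set \<Rightarrow> 'a)"
    by (rule lm_mono_at) (use g in force)+
  have 2: "lm i (mono_at (insert (Suc i) (pairset (i + 3) k)))
      = (mono_at (insert i (insert (Suc i) (pairset (i + 3) k))) :: nat set \<Rightarrow> 'a)"
    by (rule lm_mono_at) (use g in force)+
  have "mono_at (pairset i (Suc k)) = lm i (lm (Suc i) (mono_at (pairset (i + 3) k) :: nat set \<Rightarrow> 'a))"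
    unfolding 1 2 pairset_Suc by simp
  then show ?case using Suc by (simp add: lm_mul[symmetric])
qed

lemma vop_eq: assumes "poly a" shows "vop i a = vo i a"
proof -
  have f: "fin_supp a" "fin_supp (der j a)" for j using assms poly_der unfolding poly_def by blast+
  show ?thesis unfolding vop_def vo_poly(2)[OF assms] gder_eq[OF f(1)] gmul_eq gmono_eq mul_pairset[OF f(2)] ..
qed

definition mat :: "'k::field op \<Rightarrow> 'k gop" where
  "mat t = (\<lambda>(S, R). if finite S then t (mono_at S) R else 0)"

lemma mat_lin: "mat (t + u) = mat t + mat u" "mat (oscale c t) = fscale c (mat t)"
  by (auto simp: mat_def fun_eq_iff plus_fun_apply op_apply fscale_def)

lemma vmat_eq: "vmat i = mat (vo i)"
  by (auto simp: vmat_def mat_def fun_eq_iff gmono_eq vop_eq poly_mono_at)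

lemma lop_sum: "lop t \<Longrightarrow> t (\<Sum>i\<in>A. f i) = (\<Sum>i\<in>A. t (f i))"
  by (induction A rule: infinite_finite_induct) (simp_all add: lopD)

text \<open>The matrix product sums over the support of u(x_S); this is finite because
  \<open>u\<close> preserves polynomials, so linearity of \<open>t\<close> applies.\<close>

lemma mcomp_mat:
  assumes t: "lop t" and u: "\<And>a. poly a \<Longrightarrow> poly (u a)"
  shows "mcomp (mat t) (mat u) = mat (t \<odot> u)"
proof (rule ext, clarify)
  fix S R :: "nat set"
  show "mcomp (mat t) (mat u) (S, R) = mat (t \<odot> u) (S, R)"
  proof (cases "finite S")
    case True
    define a where "a = u (mono_at S)"
    have a: "poly a" unfolding a_def by (rule u[OF poly_mono_at[OF True]])
    have fin: "finite {Q. a Q \<noteq> 0}" "finite Q" if "a Q \<noteq> 0" for Q using a that unfolding poly_def fin_supp_def by auto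
    have e: "a = (\<Sum>Q | a Q \<noteq> 0. fscale (a Q) (mono_at Q))"
    proof
      fix R
      have "(\<Sum>Q | a Q \<noteq> 0. fscale (a Q) (mono_at Q)) R = (\<Sum>Q | a Q \<noteq> 0. if Q = R then a R else 0)"
        unfolding sum_fun_apply by (rule sum.cong) (auto simp: fscale_def mono_at_def)
      also have "\<dots> = a R" using a by (simp add: poly_def)
      finally show "a R = (\<Sum>Q | a Q \<noteq> 0. fscale (a Q) (mono_at Q)) R" ..
    qed
    have "mcomp (mat t) (mat u) (S, R) = (\<Sum>Q | a Q \<noteq> 0. a Q * mat t (Q, R))"
      using True by (simp add: mcomp_def mat_def a_def)
    also have "\<dots> = (\<Sum>Q | a Q \<noteq> 0. t (fscale (a Q) (mono_at Q)) R)"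
      unfolding lopD(2)[OF t] by (rule sum.cong) (simp_all add: mat_def fin fscale_def)
    also have "\<dots> = t a R" by (subst (2) e) (simp add: lop_sum[OF t] sum_fun_apply)
    finally show ?thesis using True by (simp add: mat_def a_def)
  qed (simp add: mcomp_def mat_def)
qed

lemma aword_poly: "aword agens1 t f \<Longrightarrow> poly a \<Longrightarrow> poly (f a)"
proof (induction arbitrary: a rule: aword.induct)
  case (gen f t)
  then show ?case by (auto simp: agens1_def poly_vo)
qed auto

lemma amon_aword: "amon k T \<Longrightarrow> \<exists>t. aword agens1 (real k) t \<and> T = mat t"
proof (induction rule: amon.induct)
  case (agen i)
  then show ?case unfolding vmat_eq by (intro exI[of _ "vo i"] conjI aword.gen) (auto simp: agens1_def)
next
  case (amul a T b U)
  then obtain t u where tu: "aword agens1 (real a) t" "T = mat t" "aword agens1 (real b) u" "U = mat u" by blast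
  have "mcomp T U = mat (t \<odot> u)" unfolding tu(2,4)
    by (rule mcomp_mat[OF aword_lop[OF good_agens1 tu(1)] aword_poly[OF tu(3)]])
  moreover have "aword agens1 (real (a + b)) (t \<odot> u)" unfolding of_nat_add by (rule aword.comp[OF tu(1,3)])
  ultimately show ?case by blast
qed

lemma aword_amon: "aword agens1 t f \<Longrightarrow> \<exists>k\<ge>1. t = real k \<and> amon k (mat f)"
proof (induction rule: aword.induct)
  case (gen f t)
  then obtain i where "f = vo i" "i < 3" "t = 1" by (auto simp: agens1_def)
  thus ?case using amon.agen[of i] by (intro exI[of _ 1]) (simp add: vmat_eq)
next
  case (comp s f t g)
  then obtain a b where ab: "a \<ge> 1" "s = real a" "amon a (mat f)" "t = real b" "amon b (mat g)" by blast
  have "mcomp (mat f) (mat g) = mat (f \<odot> g)"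
    by (rule mcomp_mat[OF aword_lop[OF good_agens1 comp.hyps(1)] aword_poly[OF comp.hyps(2)]])
  hence "amon (a + b) (mat (f \<odot> g))" using amon.amul[OF ab(3,5)] by (simp only:)
  moreover have "1 \<le> a + b" "s + t = real (a + b)" using ab(1,2,4) by simp_all
  ultimately show ?case by blast
qed

lemma amon_set:
  "{T :: 'k::field gop. \<exists>k. 1 \<le> k \<and> k \<le> n \<and> amon k T} = mat ` {f. \<exists>s\<le>real n. aword agens1 s f}"
proof (intro subset_antisym subsetI)
  fix T :: "'k gop" assume "T \<in> {T. \<exists>k. 1 \<le> k \<and> k \<le> n \<and> amon k T}"
  then obtain k where k: "k \<le> n" "amon k T" by blast
  then obtain t where "aword agens1 (real k) t" "T = mat t" using amon_aword by blast
  thus "T \<in> mat ` {f. \<exists>s\<le>real n. aword agens1 s f}" using k(1) by (intro image_eqI[of _ _ t] CollectI exI[of _ "real k"]) auto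
next
  fix T :: "'k gop" assume "T \<in> mat ` {f. \<exists>s\<le>real n. aword agens1 s f}"
  then obtain s f where "T = mat f" "s \<le> real n" "aword agens1 s f" by blast
  with aword_amon[OF this(3)] show "T \<in> {T. \<exists>k. 1 \<le> k \<and> k \<le> n \<and> amon k T}" by auto
qed

lemma span_image_mat: assumes "f \<in> os.span W" shows "mat f \<in> fs.span (mat ` W)"
proof (rule os.span_induct[OF assms])
  have 0: "mat 0 = 0" by (auto simp: mat_def fun_eq_iff op_apply zero_fun_apply)
  show "os.subspace {x. mat x \<in> fs.span (mat ` W)}"
    unfolding os.subspace_def by (auto simp: mat_lin 0 fs.span_zero fs.span_add fs.span_scale)
qed (simp add: fs.span_base)

context cubic_root
begin

lemma aword_weight: "aword agens1 t f \<Longrightarrow> \<exists>s\<le>l\<^sup>2 * t. aword (agens 0) s f"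
proof (induction rule: aword.induct)
  case (gen f t)
  then obtain i where i: "f = vo i" "i < 3" "t = 1" by (auto simp: agens1_def)
  have "i \<in> {0, Suc 0, 0 + 2}" using i(2) by (auto simp: less_Suc_eq numeral_3_eq_3)
  hence "(vo i, l ^ i) \<in> agens 0" unfolding agens_def by (intro insertI2[of "(_, _)"] imageI)
  moreover have "l ^ i \<le> l\<^sup>2" using i(2) by (intro power_increasing) (simp_all add: less_imp_le)
  ultimately show ?case unfolding i mult_1_right using aword.gen by blast
next
  case (comp s f t g)
  then obtain a b where "a \<le> l\<^sup>2 * s" "aword (agens 0) a f" "b \<le> l\<^sup>2 * t" "aword (agens 0) b g" by blast
  moreover from this have "a + b \<le> l\<^sup>2 * (s + t)" by (simp add: algebra_simps)
  ultimately show ?case using aword.comp by blast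
qed

lemma aspan_lower:
  "\<exists>B. fs.independent B \<and> 16 ^ r \<le> card B \<and> B \<subseteq> mat ` N1 TYPE('k::field) (2 * l ^ 5 * l ^ (2 * r))"
proof -
  let ?m = "2 * r + 4"
  define I where "I = Pow (qset r) \<times> Pow {..<?m}"
  define E :: "nat set \<times> nat set \<Rightarrow> 'k op" where "E = (\<lambda>(\<alpha>, \<beta>). rv ?m \<beta> (Qo r \<alpha> \<odot> vo ?m))"
  \<comment> \<open>The leading part of \<open>E (\<alpha>, \<beta>)\<close> sends the monomial on
    \<open>insert ?m \<beta>\<close> to a multiple of x^\<alpha>; this matrix entry is the
    pivot.\<close>
  define p where "p = (\<lambda>(\<alpha> :: nat set, \<beta>). (insert ?m \<beta>, \<alpha>))"
  \<comment> \<open>Lexicographic rank: first the degree shift card \<alpha> - card \<beta>, up to a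
    constant, then card \<beta>, which is at most \<open>?m\<close> and so is a digit in base
    \<open>?m + 1\<close>.\<close>
  define rk where "rk = (\<lambda>(\<alpha> :: nat set, \<beta> :: nat set). (int (card \<alpha>) - int (card \<beta>)) * (int ?m + 1) + int (card \<beta>))"
  have I: "finite I" "16 ^ r \<le> card I" using qop_index_card[of r] by (auto simp: I_def)
  have fI: "finite \<alpha>" "finite \<beta>" "card \<beta> \<le> ?m" "?m \<notin> \<beta>" if "(\<alpha>, \<beta>) \<in> I" for \<alpha> \<beta>
    using that finite_subset[of \<alpha> "qset r"] finite_subset[of \<beta> "{..<?m}"] card_mono[of "{..<?m}" \<beta>]
    by (auto simp: I_def)
  have lead: "lead (int (card S) - int (card \<beta>) - 1 + int (card \<alpha>)) (E (\<alpha>, \<beta>) (mono_at S))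
      (Qo r \<alpha> (der ?m (vd ?m \<beta> (mono_at S))))" if "(\<alpha>, \<beta>) \<in> I" "finite S" for \<alpha> \<beta> S
  proof -
    have "lead (int (card S)) (mono_at S :: nat set \<Rightarrow> 'k) (mono_at S)"
      using that(2) by (auto simp: lead_def mono_at_def split: if_splits)
    from lead_qop[OF lead_vo[OF lead_vv[OF this, of \<beta> ?m], of ?m], of \<alpha> r "\<lambda>i. i"]
    show ?thesis using that(1) by (simp add: E_def rv_vv I_def Int_absorb2)
  qed
  have val: "E (\<alpha>, \<beta>) (mono_at S) R = Qo r \<alpha> (der ?m (vd ?m \<beta> (mono_at S))) R"
    if "(\<alpha>, \<beta>) \<in> I" "finite S" "finite R" "int (card R) \<le> int (card S) - int (card \<beta>) - 1 + int (card \<alpha>)"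
    for \<alpha> \<beta> S R using lead[OF that(1,2)] that(3,4) by (simp add: lead_def)
  have pure1: "pure S (mono_at S :: nat set \<Rightarrow> 'k)" for S
    unfolding pure_def by (intro exI[of _ 1]) (simp add: fscale_def fun_eq_iff)
  have q0: "Qo r \<alpha> 0 = (0 :: nat set \<Rightarrow> 'k)" for \<alpha>
    using qop_lin(1)[of "\<lambda>i. i" r \<alpha> 0 0] by simp
  have dv: "if insert ?m \<beta> \<subseteq> S then pure (S - insert ?m \<beta>) (der ?m (vd ?m \<beta> (mono_at S :: nat set \<Rightarrow> 'k)))
      else der ?m (vd ?m \<beta> (mono_at S :: nat set \<Rightarrow> 'k)) = 0" if "(\<alpha>, \<beta>) \<in> I" "finite S" for \<alpha> \<beta> S
  proof -
    have b: "\<beta> \<inter> {..<?m} = \<beta>" using that(1) by (auto simp: I_def)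
    show ?thesis
    proof (cases "\<beta> \<subseteq> S")
      case True
      hence "pure (S - \<beta>) (vd ?m \<beta> (mono_at S :: nat set \<Rightarrow> 'k))"
        using pure_vd[OF pure1 that(2), of \<beta> ?m] unfolding b by simp
      from pure_der[OF this, of ?m] that(2) True fI(4)[OF that(1)] show ?thesis
        by (simp add: Diff_insert[symmetric] split: if_splits)
    next
      case False
      hence "vd ?m \<beta> (mono_at S :: nat set \<Rightarrow> 'k) = 0"
        using pure_vd[OF pure1 that(2), of \<beta> ?m] unfolding b by simp
      thus ?thesis using False by (simp add: lin_simps)
    qed
  qed
  have diag: "mat (E i) (p i) \<noteq> 0" if "i \<in> I" for i
  proof -
    obtain \<alpha> \<beta> where i: "i = (\<alpha>, \<beta>)" by force
    have ab: "(\<alpha>, \<beta>) \<in> I" using that i by simp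
    note f = fI[OF ab]
    have "pure {} (der ?m (vd ?m \<beta> (mono_at (insert ?m \<beta>) :: nat set \<Rightarrow> 'k)))"
      using dv[OF ab, of "insert ?m \<beta>"] f by simp
    hence "pure \<alpha> (Qo r \<alpha> (der ?m (vd ?m \<beta> (mono_at (insert ?m \<beta>) :: nat set \<Rightarrow> 'k))))"
      using pure_qop[of "{}" _ "\<lambda>i. i" r \<alpha> r] ab by (auto simp: I_def Int_absorb2)
    hence "Qo r \<alpha> (der ?m (vd ?m \<beta> (mono_at (insert ?m \<beta>) :: nat set \<Rightarrow> 'k))) \<alpha> \<noteq> 0"
      by (simp add: pure_nonzero)
    moreover have "E (\<alpha>, \<beta>) (mono_at (insert ?m \<beta>)) \<alpha> = Qo r \<alpha> (der ?m (vd ?m \<beta> (mono_at (insert ?m \<beta>)))) \<alpha>"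
      by (rule val[OF ab]) (use f in auto)
    ultimately show ?thesis using f by (simp add: i p_def mat_def)
  qed
  have tri: "rk i < rk j" if ij: "i \<in> I" "j \<in> I" "mat (E i) (p j) \<noteq> 0" "i \<noteq> j" for i j
  proof -
    obtain \<alpha> \<beta> \<gamma> \<delta> where e: "i = (\<alpha>, \<beta>)" "j = (\<gamma>, \<delta>)" by force
    have ab: "(\<alpha>, \<beta>) \<in> I" and gd: "(\<gamma>, \<delta>) \<in> I" using ij e by auto
    note f = fI[OF ab] and g = fI[OF gd]
    let ?S = "insert ?m \<delta>"
    have ne: "E (\<alpha>, \<beta>) (mono_at ?S) \<gamma> \<noteq> 0" using ij(3) g by (simp add: e p_def mat_def)
    let ?x = "int (card \<alpha>) - int (card \<beta>)" and ?y = "int (card \<gamma>) - int (card \<delta>)"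
    show ?thesis
    \<comment> \<open>No operator lowers degrees by more than its leading part, so a nonzero entry
      forces ?x \<le> ?y. For equality the entry belongs to the leading part, which needs \<beta>
      \<subseteq> \<delta>; equal \<beta> and \<delta> would give the same pair.\<close>
    proof (cases "?x < ?y")
      case True
      hence "(?x + 1) * (int ?m + 1) \<le> ?y * (int ?m + 1)" by (intro mult_right_mono) auto
      hence "?x * (int ?m + 1) + (int ?m + 1) \<le> ?y * (int ?m + 1)" by (simp only: distrib_right mult_1)
      moreover have "int (card \<beta>) < int ?m + 1" using f(3) by simp
      ultimately show ?thesis unfolding rk_def e prod.case by linarith
    next
      case False
      let ?b = "Qo r \<alpha> (der ?m (vd ?m \<beta> (mono_at ?S :: nat set \<Rightarrow> 'k)))"
      have "E (\<alpha>, \<beta>) (mono_at ?S) \<gamma> = ?b \<gamma>" by (rule val[OF ab]) (use g False in auto)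
      hence b: "?b \<gamma> \<noteq> 0" using ne by simp
      hence "int (card \<gamma>) = int (card ?S) - int (card \<beta>) - 1 + int (card \<alpha>)"
        using lead[OF ab, of ?S] g unfolding lead_def by blast
      hence xy: "?x = ?y" using g by simp
      have "der ?m (vd ?m \<beta> (mono_at ?S :: nat set \<Rightarrow> 'k)) \<noteq> 0" using b q0[of \<alpha>] by (auto simp: zero_fun_apply)
      hence sub: "insert ?m \<beta> \<subseteq> ?S" and pu: "pure (?S - insert ?m \<beta>) (der ?m (vd ?m \<beta> (mono_at ?S :: nat set \<Rightarrow> 'k)))"
        using dv[OF ab, of ?S] g by (auto split: if_splits)
      have sb: "\<beta> \<subseteq> \<delta>" using sub f(4) by blast
      have "\<beta> \<noteq> \<delta>"
      proof
        assume bd: "\<beta> = \<delta>"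
        hence "pure {} (der ?m (vd ?m \<beta> (mono_at ?S :: nat set \<Rightarrow> 'k)))" using pu by simp
        hence "pure \<alpha> ?b" using pure_qop[of "{}" _ "\<lambda>i. i" r \<alpha> r] ab by (auto simp: I_def Int_absorb2)
        hence "\<gamma> = \<alpha>" using b pure_nonzero by blast
        thus False using bd e ij(4) by simp
      qed
      hence "card \<beta> < card \<delta>" using sb g(2) by (simp add: psubset_card_mono psubset_eq)
      thus ?thesis using xy unfolding rk_def e prod.case by simp
    qed
  qed
  note ind = triangular_independent[of I "\<lambda>i. mat (E i)" p rk, OF I(1) diag tri]
  have mem: "E i \<in> N1 TYPE('k) (2 * l ^ 5 * l ^ (2 * r))" for i
  proof -
    obtain \<alpha> \<beta> where i: "i = (\<alpha>, \<beta>)" by force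
    have "E i \<in> N1 TYPE('k) (real (glen ?m) + (\<Sum>i<?m. real (glen i)))"
      unfolding i E_def by (simp only: prod.case) (rule rv_mem[OF qop_amem])
    moreover have "real (glen ?m) + (\<Sum>i<?m. real (glen i)) \<le> (\<Sum>i<Suc ?m. l ^ i)"
      using glen_le[of ?m] sum_mono[of "{..<?m}" "\<lambda>i. real (glen i)" "\<lambda>i. l ^ i", OF glen_le]
      unfolding sum.lessThan_Suc by linarith
    moreover have "\<dots> \<le> 2 * l ^ 5 * l ^ (2 * r)"
      using sum_pow[of "Suc ?m"] by (simp add: power_add numeral_eq_Suc algebra_simps)
    ultimately show ?thesis using aspan_mono by (meson in_mono order_trans)
  qed
  show ?thesis
    using ind card_image[OF ind(1)] I(2) mem by (intro exI[of _ "(\<lambda>i. mat (E i)) ` I"]) auto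
qed

lemma agrowth_bounds:
  "\<exists>c. (\<forall>n j. l\<^sup>2 * real n \<le> l ^ j \<longrightarrow> agrowth TYPE('k::field) n \<le> 4 ^ j * c)
     \<and> (\<forall>n r. 2 * l ^ 5 * l ^ (2 * r) \<le> real n \<longrightarrow> 16 ^ r \<le> agrowth TYPE('k) n)"
proof -
  let ?S = "\<lambda>n. {f :: 'k op. \<exists>s\<le>real n. aword agens1 s f}"
  have g: "agrowth TYPE('k) n = fs.dim (mat ` ?S n)" for n
    unfolding agrowth_def span_dim_def amon_set ..
  obtain c where c: "\<And>j t. t \<le> l ^ j \<Longrightarrow> \<exists>W. finite W \<and> card W \<le> 4 ^ j * c
    \<and> (aspan (agens 0) t :: 'k op set) \<subseteq> os.span W"
    using aspan_upper by blast
  have W: "\<exists>W. finite W \<and> card W \<le> 4 ^ j * c \<and> mat ` ?S n \<subseteq> fs.span W" if nj: "l\<^sup>2 * real n \<le> l ^ j" for n j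
  proof -
    obtain W where W: "finite W" "card W \<le> 4 ^ j * c" "(aspan (agens 0) (l ^ j) :: 'k op set) \<subseteq> os.span W"
      using c[OF order_refl] by blast
    have "f \<in> os.span W" if "f \<in> ?S n" for f
    proof -
      from that obtain s where "s \<le> real n" "aword agens1 s f" by blast
      with aword_weight obtain s' where s': "s' \<le> l\<^sup>2 * s" "aword (agens 0) s' f" by blast
      have "l\<^sup>2 * s \<le> l\<^sup>2 * real n" using \<open>s \<le> real n\<close> by (intro mult_left_mono) auto
      hence "f \<in> aspan (agens 0) (l ^ j)" using s' nj by (intro aword_aspan[OF s'(2)]) linarith
      thus ?thesis using W(3) by blast
    qed
    hence "mat ` ?S n \<subseteq> fs.span (mat ` W)" using span_image_mat by blast
    moreover have "card (mat ` W) \<le> 4 ^ j * c" using card_image_le[OF W(1), of mat] W(2) by linarith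
    ultimately show ?thesis using W(1) by (intro exI[of _ "mat ` W"]) simp
  qed
  show ?thesis
  proof (intro exI[of _ c] conjI allI impI)
    fix n j assume "l\<^sup>2 * real n \<le> l ^ j"
    from W[OF this] show "agrowth TYPE('k) n \<le> 4 ^ j * c"
      unfolding g using fs.dim_le_card by (meson order_trans)
  next
    fix n r assume r: "2 * l ^ 5 * l ^ (2 * r) \<le> real n"
    obtain B where B: "fs.independent B" "16 ^ r \<le> card B" "B \<subseteq> mat ` N1 TYPE('k) (2 * l ^ 5 * l ^ (2 * r))"
      using aspan_lower by blast
    have "B \<subseteq> mat ` os.span (?S n)" using B(3) aspan_mono[OF r, of "agens1 :: ('k op \<times> real) set"]
      unfolding aspan_def by blast
    hence "B \<subseteq> fs.span (mat ` ?S n)" using span_image_mat by blast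
    moreover obtain j where "l\<^sup>2 * real n \<le> l ^ j"
      using real_arch_pow[OF l_pos(3), of "l\<^sup>2 * real n"] less_imp_le by blast
    from W[OF this] obtain W where "finite W" "mat ` ?S n \<subseteq> fs.span W" by blast
    ultimately have "card B \<le> agrowth TYPE('k) n"
      unfolding g using fs.card_le_dim[OF _ _ B(1)] by blast
    thus "16 ^ r \<le> agrowth TYPE('k) n" using B(2) by linarith
  qed
qed

end

section \<open>The Gelfand-Kirillov dimensions\<close>

lemma GKdim_of_limit:
  assumes "(\<lambda>n. ln (real (\<gamma> n)) / ln (real n)) \<longlonglongrightarrow> L"
  shows "GKdim \<gamma> = ereal L" "lower_GKdim \<gamma> = ereal L"
proof -
  have "(\<lambda>n. ereal (ln (real (\<gamma> n)) / ln (real n))) \<longlonglongrightarrow> ereal L" using assms by simp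
  thus "GKdim \<gamma> = ereal L" "lower_GKdim \<gamma> = ereal L"
    unfolding GKdim_def lower_GKdim_def by (simp_all add: lim_imp_Limsup lim_imp_Liminf)
qed

lemma ln_affine_limit: "(\<lambda>n. (a + b * ln (real n)) / ln (real n)) \<longlonglongrightarrow> b"
proof -
  have "filterlim (\<lambda>n. ln (real n)) at_top sequentially"
    by (rule filterlim_compose[OF ln_at_top filterlim_real_sequentially])
  hence "(\<lambda>n. a * inverse (ln (real n)) + b) \<longlonglongrightarrow> a * 0 + b"
    by (intro tendsto_intros tendsto_inverse_0_at_top)
  moreover have "\<forall>\<^sub>F n in sequentially. a * inverse (ln (real n)) + b = (a + b * ln (real n)) / ln (real n)"
    using eventually_ge_at_top[of 2] by eventually_elim (simp add: field_simps)
  ultimately show ?thesis by (simp add: tendsto_cong)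
qed

text \<open>Constant factors in lengths and dimensions become bounded summands after taking
  logarithms and disappear after division by ln n.\<close>

lemma (in cubic_root) growth_limit:
  assumes upper: "\<And>n j. l\<^sup>2 * real n \<le> l ^ j \<Longrightarrow> \<gamma> n \<le> 4 ^ j * c"
    and lower: "\<And>n r. 2 * l ^ 5 * l ^ (2 * r) \<le> real n \<Longrightarrow> 16 ^ r \<le> \<gamma> n"
  shows "(\<lambda>n. ln (real (\<gamma> n)) / ln (real n)) \<longlonglongrightarrow> 2 * log l 2"
proof -
  define D where "D = 2 * l ^ 5"
  have D: "D > 0" by (simp add: D_def)
  have ll: "ln l > 0" by simp
  have l1: "l \<noteq> 1" using l_gt by simp
  \<comment> \<open>As 16^r = 4^(2r), both bounds have order 4 to the power log_l n.\<close>
  have k: "2 * log l 2 = ln 4 / ln l"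
    using ln_realpow[of 2 2] by (simp add: log_def)
  have ln4: "ln 4 > (0::real)" by simp
  \<comment> \<open>n \<ge> 2 makes ln n positive; n \<ge> D makes x - y nonnegative, so that
    \<open>nat\<close> does not truncate in the choice of r.\<close>
  define N where "N = max 2 (nat \<lceil>D\<rceil>)"
  have bounds: "(- (ln D / ln l + 2) * ln 4 + ln 4 / ln l * ln (real n)) / ln (real n) \<le> ln (real (\<gamma> n)) / ln (real n) \<and>
      ln (real (\<gamma> n)) / ln (real n) \<le> ((ln (real c) + 3 * ln 4) + ln 4 / ln l * ln (real n)) / ln (real n)"
    if n: "n \<ge> N" for n
  proof -
    have n2: "real n \<ge> 2" "real n \<ge> D" using n unfolding N_def by (simp, linarith)
    have lnn: "ln (real n) > 0" using n2 by simp
    define x where "x = ln (real n) / ln l"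
    define y where "y = ln D / ln l"
    have pw: "l powr x = real n" using n2 l1 by (simp add: x_def powr_def)
    have pD: "l powr y = D" using D l1 by (simp add: y_def powr_def)
    have "ln D \<le> ln (real n)" using D n2 by simp
    hence xy: "x - y \<ge> 0"
      using divide_right_mono[OF _ less_imp_le[OF ll]] unfolding x_def y_def by (simp del: ln_gt_zero_iff)
    define q where "q = (x - y) / 2"
    have q: "x - y = 2 * q" by (simp add: q_def)
    \<comment> \<open>The largest r with D l^(2r) \<le> n; rounding loses at most 2 in the exponent
      2r.\<close>
    define r where "r = nat \<lfloor>q\<rfloor>"
    have "real r = of_int \<lfloor>q\<rfloor>" using xy by (simp add: r_def q)
    hence r: "real r \<le> q" "real r \<ge> q - 1"
      using floor_correct[of q] by linarith+
    have "l ^ (2 * r) = l powr (2 * real r)" by (simp add: powr_realpow[symmetric])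
    also have "\<dots> \<le> l powr (x - y)"
      unfolding q using r(1) by (intro powr_mono) (auto simp: less_imp_le)
    also have "\<dots> = real n / D" by (simp add: powr_diff pw pD)
    finally have "2 * l ^ 5 * l ^ (2 * r) \<le> real n" using D unfolding D_def[symmetric] by (simp add: field_simps)
    from lower[OF this] have g1: "16 ^ r \<le> \<gamma> n" .
    hence g0: "1 \<le> \<gamma> n" by (meson one_le_numeral one_le_power order_trans)
    have "x - y - 2 \<le> 2 * real r" using r(2) q by linarith
    hence "(x - y - 2) * ln 4 \<le> (2 * real r) * ln 4" using ln4 by (intro mult_right_mono) simp_all
    also have "\<dots> = ln (real (16 ^ r))" using ln_realpow[of 16 r] ln_realpow[of 4 2] by simp
    also have "\<dots> \<le> ln (real (\<gamma> n))"
      using g0 of_nat_mono[OF g1, where 'a=real] by (subst ln_le_cancel_iff) simp_all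
    finally have lo: "(x - y - 2) * ln 4 \<le> ln (real (\<gamma> n))" .
    \<comment> \<open>The 2 pays for the factor l^2, and rounding up adds at most 1.\<close>
    define j where "j = nat \<lceil>x + 2\<rceil>"
    have x0: "x \<ge> 0" unfolding x_def by (rule less_imp_le[OF divide_pos_pos[OF lnn ll]])
    have "real j = of_int \<lceil>x + 2\<rceil>" using x0 by (simp add: j_def)
    hence j: "x + 2 \<le> real j" "real j \<le> x + 3"
      using ceiling_correct[of "x + 2"] by linarith+
    have "l\<^sup>2 * real n = l powr (x + 2)" by (simp add: powr_add pw powr_numeral)
    also have "\<dots> \<le> l powr real j" using j(1) by (intro powr_mono) (auto simp: less_imp_le)
    also have "\<dots> = l ^ j" by (simp add: powr_realpow)
    finally have "l\<^sup>2 * real n \<le> l ^ j" .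
    from upper[OF this] have g2: "\<gamma> n \<le> 4 ^ j * c" .
    \<comment> \<open>The lower bound makes \<gamma> n positive and thereby excludes c = 0, for
      which ln c would be meaningless.\<close>
    have c0: "c \<ge> 1" using g0 g2 by (cases c) auto
    have "ln (real (\<gamma> n)) \<le> ln (real (4 ^ j * c))"
      using g0 of_nat_mono[OF g2, where 'a=real] by (subst ln_le_cancel_iff) linarith+
    also have "\<dots> = real j * ln 4 + ln (real c)" using c0 by (simp add: ln_mult ln_realpow)
    also have "\<dots> \<le> (x + 3) * ln 4 + ln (real c)" using mult_right_mono[OF j(2) less_imp_le[OF ln4]] by simp
    finally have up: "ln (real (\<gamma> n)) \<le> (x + 3) * ln 4 + ln (real c)" .
    have "ln 4 / ln l * ln (real n) = x * ln 4" by (simp add: x_def)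
    hence "- (ln D / ln l + 2) * ln 4 + ln 4 / ln l * ln (real n) = (x - y - 2) * ln 4"
      "(ln (real c) + 3 * ln 4) + ln 4 / ln l * ln (real n) = (x + 3) * ln 4 + ln (real c)"
      by (simp_all add: y_def algebra_simps)
    with lo up show ?thesis
      using divide_right_mono[OF lo less_imp_le[OF lnn]] divide_right_mono[OF up less_imp_le[OF lnn]]
      by presburger
  qed
  show ?thesis unfolding k
  proof (rule tendsto_sandwich[OF _ _ ln_affine_limit ln_affine_limit])
    show "\<forall>\<^sub>F n in sequentially. (- (ln D / ln l + 2) * ln 4 + ln 4 / ln l * ln (real n)) / ln (real n)
        \<le> ln (real (\<gamma> n)) / ln (real n)"
      using eventually_ge_at_top[of N] by eventually_elim (use bounds in blast)
    show "\<forall>\<^sub>F n in sequentially. ln (real (\<gamma> n)) / ln (real n)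
        \<le> ((ln (real c) + 3 * ln 4) + ln 4 / ln l * ln (real n)) / ln (real n)"
      using eventually_ge_at_top[of N] by eventually_elim (use bounds in blast)
  qed
qed

theorem theorem11p3:
  fixes l :: real
  assumes "l ^ 3 - l - 2 = 0"
  shows "GKdim (pgrowth TYPE('k::field)) = ereal (2 * log l 2)
       \<and> lower_GKdim (pgrowth TYPE('k)) = ereal (2 * log l 2)
       \<and> GKdim (agrowth TYPE('k)) = ereal (2 * log l 2)
       \<and> lower_GKdim (agrowth TYPE('k)) = ereal (2 * log l 2)"
proof -
  interpret cubic_root l by unfold_locales (rule assms)
  obtain c where c: "\<And>n j. l\<^sup>2 * real n \<le> l ^ j \<Longrightarrow> pgrowth TYPE('k) n \<le> 4 ^ j * c"
    "\<And>n r. 2 * l ^ 5 * l ^ (2 * r) \<le> real n \<Longrightarrow> 16 ^ r \<le> pgrowth TYPE('k) n"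
    using pgrowth_bounds[where 'k='k] by blast
  obtain d where d: "\<And>n j. l\<^sup>2 * real n \<le> l ^ j \<Longrightarrow> agrowth TYPE('k) n \<le> 4 ^ j * d"
    "\<And>n r. 2 * l ^ 5 * l ^ (2 * r) \<le> real n \<Longrightarrow> 16 ^ r \<le> agrowth TYPE('k) n"
    using agrowth_bounds[where 'k='k] by blast
  have P: "(\<lambda>n. ln (real (pgrowth TYPE('k) n)) / ln (real n)) \<longlonglongrightarrow> 2 * log l 2"
    by (rule growth_limit[of "pgrowth TYPE('k)" c, OF c])
  have A: "(\<lambda>n. ln (real (agrowth TYPE('k) n)) / ln (real n)) \<longlonglongrightarrow> 2 * log l 2"
    by (rule growth_limit[of "agrowth TYPE('k)" d, OF d])
  show ?thesis using GKdim_of_limit[OF P] GKdim_of_limit[OF A] by blast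
qed

end
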